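(* Let $\mathbb T^2=\mathbb R^2/\mathbb Z^2$; for a positive integer $m$ let $\lambda^2=4\pi^2m$, $\mathcal E_\lambda=\{\mu\in\mathbb Z^2:\|\mu\|^2=m\}$, $N=|\mathcal E_\lambda|$, and $\kappa=N^{-3}$. Let $\gamma:[0,1]\to\mathbb T^2$ be an arc-length parametrized unit length curve with non-vanishing curvature, extending analytically to $[0,1]+B(0,\epsilon)\subset\mathbb C$ for some constant $\epsilon>0$. Then for almost all $\lambda$ there exist a collection of at most $N^2$ intervals $S_\alpha\subset[0,1]$, each of length $O(\kappa)$, such that for every eigenfunction $\Phi(x)=\sum_{\mu\in\mathcal E_\lambda}a_\mu e^{2\pi i\langle\mu,x\rangle}$ with $\sum_\mu|a_\mu|^2=1$: (1) $|N_\Phi\cap\bigcup_\alpha\gamma(S_\alpha)|\ll\lambda N^{-1}$, where $N_\Phi=\{x:\Phi(x)=0\}$; (2) for any $a\in[0,1]\setminus\bigcup_\alpha S_\alpha$, $\#\{z\in B(a,N^7/\lambda):\Phi(\gamma(z))=0\}\ll N^7$.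
   Context: "Almost all $\lambda$" means: for all $m$ that are sums of two squares outside a set of relative density zero among such integers. $B(a,r)$ is the complex disc, and $\Phi(\gamma(z))$ for complex $z$ uses the analytic continuation of $\gamma$. Implicit constants do not depend on $\lambda$, $N$ or $\Phi$. *)

theory Defs
  imports "HOL-Analysis.Analysis"
begin

definition sums_two_sq :: "nat set" where
  "sums_two_sq = {m. m > 0 \<and> (\<exists>a b :: int. a^2 + b^2 = int m)}"

definition rel_density_zero :: "nat set \<Rightarrow> nat set \<Rightarrow> bool" where
  "rel_density_zero E A \<longleftrightarrow>
     (\<lambda>n. real (card (E \<inter> A \<inter> {..n})) / real (card (A \<inter> {..n}))) \<longlonglongrightarrow> 0"

definition lattice_pts :: "nat \<Rightarrow> (int \<times> int) set" where
  "lattice_pts m = {(a, b). a^2 + b^2 = int m}"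

definition eigenfun :: "((int \<times> int) \<Rightarrow> complex) \<Rightarrow> nat \<Rightarrow> complex \<Rightarrow> complex \<Rightarrow> complex" where
  "eigenfun c m x y = (\<Sum>\<mu>\<in>lattice_pts m.
      c \<mu> * exp (2 * of_real pi * \<i> * (of_int (fst \<mu>) * x + of_int (snd \<mu>) * y)))"

definition nbhd01 :: "real \<Rightarrow> complex set" where
  "nbhd01 \<epsilon> = {complex_of_real t + w | t w. t \<in> {0..1} \<and> norm w < \<epsilon>}"

definition torus_proj :: "real \<times> real \<Rightarrow> real \<times> real" where
  "torus_proj p = (frac (fst p), frac (snd p))"

end

theory Submission
  imports Defs "HOL-Complex_Analysis.Complex_Analysis" "HOL-Library.Discrete_Functions"
    "HOL-Real_Asymp.Real_Asymp"
begin

text \<open>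
  Along the curve an eigenfunction is a sum of \<open>N\<close> exponentials \<open>a\<^sub>\<mu> exp (2 \<pi> i \<langle>\<mu>, \<gamma>(z)\<rangle>)\<close>, and on the scale
  \<open>u = \<lambda> (z - a)\<close> it is close to an exponential polynomial with frequencies \<open>\<omega>\<^sub>\<mu> = \<langle>\<mu>/\<bar>\<mu>\<bar>, \<gamma>'(a)\<rangle>\<close>. Zeros are counted by
  a Jensen type inequality, which needs a lower bound for the maximum of the function near \<open>a\<close>.

  For almost all \<open>m\<close> the lattice points are at mutual distance at least \<open>\<surd>m (ln m)\<^bsup>-5/2\<^esup>\<close> and \<open>N\<close> is at most a small
  power of \<open>m\<close>. Call \<open>a\<close> good if no chord \<open>\<mu> - \<nu>\<close> is nearly orthogonal to \<open>\<gamma>'(a)\<close>; then the frequencies are separated.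
  If \<open>N\<^sup>3\<close> is large compared with \<open>(ln m)\<^bsup>5/2\<^esup>\<close>, the mean square over \<open>\<bar>u\<bar> \<le> N\<^sup>7\<close> is bounded below; otherwise applying \<open>N - 1\<close>
  difference operators to isolate one term gives a lower bound by a small negative power of \<open>m\<close>. This suffices if \<open>N\<^sup>7\<close> exceeds a multiple of
  \<open>ln m\<close>. If not, the linear approximation is valid in complex discs and a Turan type inequality, insensitive to separation,
  bounds the growth of the exponential polynomial.

  By the curvature assumption each chord direction has boundedly many short arcs of bad points. There are at most
  \<open>N\<^bsup>8/5\<^esup>\<close> chord directions, since the direction of \<open>\<mu> - \<nu>\<close> is determined by the Gaussian product \<open>\<mu> \<nu>\<close> and
  a prime \<open>p \<equiv> 1 (mod 4)\<close> with \<open>p\<^sup>e\<close> exactly dividing \<open>m\<close> contributes a factor \<open>e + 1\<close> to \<open>N\<close> but at most \<open>2 e + 1\<close> to the number of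
  products. So \<open>N\<^sup>2\<close> arcs suffice once \<open>N\<close> is large; for bounded \<open>N\<close> the interval \<open>[0, 1]\<close> does.
\<close>

section \<open>Counting distinct zeros\<close>

text \<open>The first claim concerns arbitrary points, not good ones. Within distance
  \<open>\<rho>\<close>, of order N^(-3), of any point there is one that is good for a weaker
  threshold of order N^(-5), because the bad set of that threshold has measure below
  \<open>\<rho>\<close>. The longer range of u that this threshold requires, about N^6 (ln m)^(5/2),
  is still shorter than \<lambda> \<rho>. So a window of radius \<open>\<rho>\<close> has
  O(\<lambda> N^(-3)) zeros, and N^2 intervals of that scale have O(\<lambda> / N).

  The exponent 7 is what the mean square needs: N frequencies with gaps N^(-3) (ln m)^(-5/2) ask for
  about N^4 (ln m)^(5/2) samples, and N^7 is enough precisely when N^3 dominates (ln m)^(5/2).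

  The exponent 5/2 comes from counting. Distinct points of equal norm m at most X and at distance at
  most H form O(H sqrt(X) ln X) pairs, while Cauchy-Schwarz gives at least a constant times X / ln X
  sums of two squares. Hence H has to be of smaller order than sqrt(X) / (ln X)^2.\<close>

lemma holomorphic_many_zeros_bound:
  assumes "finite Z" "open U" "cball z0 R \<subseteq> U" "0 \<le> r" "4 * r \<le> R" "0 < R"
    and "f holomorphic_on U" "Z \<subseteq> cball z0 r" "\<And>z. z \<in> Z \<Longrightarrow> f z = 0"
    and "\<And>z. z \<in> cball z0 R \<Longrightarrow> norm (f z) \<le> M"
  shows "3 ^ card Z * norm (f z0) \<le> M"
  using assms
proof (induction Z arbitrary: f M rule: finite_induct)
  case empty
  then show ?case by simp
next
  case (insert a Z)
  \<comment> \<open>Each zero divided out gains a factor 3: on the circle of radius \<open>R\<close>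
    the quotient is at most \<open>M / (R - r)\<close>, the factor lost at \<open>z0\<close> is at
    most \<open>r\<close>, and \<open>3 * r \<le> R - r\<close>. The other zeros of \<open>f\<close>
    remain zeros of \<open>g\<close>.\<close>
  define g where "g z = (if z = a then deriv f a else (f z - f a) / (z - a))" for z
  have holg: "g holomorphic_on U"
    unfolding g_def by (rule pole_lemma_open) (use insert.prems in auto)
  have fg: "f z = (z - a) * g z" for z
    using insert.prems(8)[of a] by (simp add: g_def)
  have a: "dist z0 a \<le> r" using insert.prems(7) by auto
  have "0 \<le> M" using order_trans[OF norm_ge_zero insert.prems(9)[of z0]] insert.prems(5) by simp
  have "norm (g z) \<le> M / (R - r)" if "z \<in> cball z0 R" for z
  proof (rule maximum_modulus_frontier[of g "cball z0 R"])
    show "g holomorphic_on interior (cball z0 R)"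
      using holg insert.prems(2) interior_subset by (blast intro: holomorphic_on_subset)
    show "continuous_on (closure (cball z0 R)) g"
      using holg insert.prems(2) by (auto intro: holomorphic_on_imp_continuous_on holomorphic_on_subset)
    fix w assume "w \<in> frontier (cball z0 R)"
    then have w: "dist z0 w = R" by simp
    have "R - r \<le> norm (w - a)"
      using w a norm_triangle_ineq[of "z0 - a" "a - w"] by (simp add: dist_norm norm_minus_commute)
    then have "(R - r) * norm (g w) \<le> norm (w - a) * norm (g w)"
      by (rule mult_right_mono) simp
    also have "\<dots> = norm (f w)" by (simp add: fg norm_mult)
    also have "\<dots> \<le> M" using insert.prems(9)[of w] w by simp
    finally show "norm (g w) \<le> M / (R - r)"
      using insert.prems by (simp add: field_simps)
  qed (use that in auto)
  then have IH: "3 ^ card Z * norm (g z0) \<le> M / (R - r)"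
  proof (intro insert.IH insert.prems(1-5) holg)
    show "g z = 0" if "z \<in> Z" for z
      using that insert.hyps insert.prems(8)[of z] insert.prems(8)[of a] by (auto simp: g_def)
  qed (use insert.prems(7) in auto)
  have "3 ^ card (insert a Z) * norm (f z0) = (3 * norm (z0 - a)) * (3 ^ card Z * norm (g z0))"
    using insert.hyps by (simp add: fg norm_mult)
  also have "\<dots> \<le> (3 * r) * (M / (R - r))"
    using a IH insert.prems(3) by (intro mult_mono) (auto simp: dist_norm)
  also have "\<dots> \<le> (R - r) * (M / (R - r))"
    using insert.prems \<open>0 \<le> M\<close> by (intro mult_right_mono divide_nonneg_nonneg) auto
  also have "\<dots> = M" using insert.prems by simp
  finally show ?case .
qed

text \<open>Bounding the finite subsets of \<open>Z\<close> yields its finiteness as well. Since e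
  is below 3, a ratio \<open>exp B\<close> between the maximum and the value at the centre allows at
  most \<open>B\<close> zeros.\<close>

lemma card_zeros_le:
  assumes "open U" "cball z0 R \<subseteq> U" "4 * r \<le> R" "0 < R" "0 \<le> r"
    and "f holomorphic_on U" and f0: "f z0 \<noteq> 0"
    and M: "\<And>z. z \<in> cball z0 R \<Longrightarrow> norm (f z) \<le> M"
    and B: "M \<le> exp B * norm (f z0)"
    and Z: "Z \<subseteq> {z \<in> cball z0 r. f z = 0}"
  shows "finite Z" "real (card Z) \<le> B"
proof -
  have bd: "real (card G) \<le> B" if "G \<subseteq> Z" "finite G" for G
  proof -
    have "3 ^ card G * norm (f z0) \<le> M"
      by (rule holomorphic_many_zeros_bound[where U = U and R = R and r = r]) (use assms that in auto)
    with B have "3 ^ card G * norm (f z0) \<le> exp B * norm (f z0)" by linarith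
    then have "3 ^ card G \<le> exp B" using f0 by simp
    moreover have "exp (real (card G)) \<le> 3 ^ card G"
      using power_mono[of "exp 1" "3::real" "card G"] exp_le by (simp add: exp_of_nat_mult[symmetric])
    ultimately have "exp (real (card G)) \<le> exp B" by linarith
    then show ?thesis by simp
  qed
  have "finite Z \<and> card Z \<le> nat \<lfloor>B\<rfloor>"
  proof (rule finite_if_finite_subsets_card_bdd)
    fix G assume "G \<subseteq> Z" "finite G"
    from bd[OF this] show "card G \<le> nat \<lfloor>B\<rfloor>" by (simp add: le_nat_floor)
  qed
  then show "finite Z" by simp
  then show "real (card Z) \<le> B" using bd[of Z] by simp
qed

section \<open>Exponential sums with separated frequencies\<close>

text \<open>A Turan type estimate: the distances between the nodes do not enter. The combination
  s(n+1) - x_i s(n) is a power sum without the node i, hence controlled by induction, and solving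
  this recurrence for s costs a factor q + (1 + q) = 1 + 2 q per step.\<close>

lemma power_sum_growth:
  fixes b x :: "'a \<Rightarrow> complex"
  assumes "finite J" and q: "1 \<le> q" and x: "\<And>j. j \<in> J \<Longrightarrow> norm (x j) \<le> q"
    and small: "\<And>k. k < card J \<Longrightarrow> norm (\<Sum>j\<in>J. b j * x j ^ k) \<le> A" and "0 \<le> A"
  shows "norm (\<Sum>j\<in>J. b j * x j ^ n) \<le> (1 + 2 * q) ^ n * A"
  using assms
proof (induction J arbitrary: b A n rule: finite_induct)
  case empty
  then show ?case by simp
next
  case (insert i J)
  define s where "s n = (\<Sum>j\<in>insert i J. b j * x j ^ n)" for n
  define s' where "s' n = (\<Sum>j\<in>J. (b j * (x j - x i)) * x j ^ n)" for n
  have rec: "s (Suc n) = x i * s n + s' n" for n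
    using insert.hyps
    by (simp add: s_def s'_def sum_distrib_left algebra_simps sum_subtractf)
  have sA: "norm (s k) \<le> A" if "k < Suc (card J)" for k
    using insert.prems(3)[of k] insert.hyps that by (simp add: s_def)
  have xi: "norm (x i) \<le> q" using insert.prems by simp
  have "norm (s' k) \<le> (1 + q) * A" if "k < card J" for k
  proof -
    have "s' k = s (Suc k) - x i * s k" using rec[of k] by simp
    also have "norm \<dots> \<le> norm (s (Suc k)) + norm (x i) * norm (s k)"
      by (metis norm_mult norm_triangle_ineq4)
    also have "\<dots> \<le> A + q * A"
      using sA[of "Suc k"] sA[of k] that xi \<open>0 \<le> A\<close> q by (intro add_mono mult_mono) auto
    finally show ?thesis by (simp add: algebra_simps)
  qed
  then have s'n: "norm (s' n) \<le> (1 + 2 * q) ^ n * ((1 + q) * A)" for n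
    unfolding s'_def using insert.prems by (intro insert.IH) auto
  have "norm (s n) \<le> (1 + 2 * q) ^ n * A"
  proof (induction n)
    case 0
    show ?case using sA[of 0] by simp
  next
    case (Suc n)
    have "norm (s (Suc n)) \<le> norm (x i) * norm (s n) + norm (s' n)"
      unfolding rec by (metis norm_mult norm_triangle_ineq)
    also have "\<dots> \<le> q * ((1 + 2 * q) ^ n * A) + (1 + 2 * q) ^ n * ((1 + q) * A)"
      using xi Suc s'n[of n] q by (intro add_mono mult_mono) auto
    finally show ?case by (simp add: algebra_simps)
  qed
  then show ?case by (simp add: s_def)
qed

text \<open>The combination s(n+1) - x_l s(n) removes the node \<open>x l\<close>, multiplies the
  coefficient of \<open>i\<close> by \<open>x i - x l\<close> and at most doubles the bound, the
  nodes having modulus at most 1. Each removal uses up one sample, and in the end only the term of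
  \<open>i\<close> is left.\<close>

lemma power_sum_lower:
  fixes b x :: "'a \<Rightarrow> complex"
  assumes "finite J" "i \<notin> J" and x: "\<And>j. j \<in> insert i J \<Longrightarrow> norm (x j) \<le> 1"
    and "\<And>n. n \<le> card J \<Longrightarrow> norm (\<Sum>j\<in>insert i J. b j * x j ^ n) \<le> A"
  shows "norm (b i) * (\<Prod>j\<in>J. norm (x i - x j)) \<le> 2 ^ card J * A"
  using assms
proof (induction J arbitrary: b A rule: finite_induct)
  case empty
  from empty.prems(3)[of 0] show ?case by simp
next
  case (insert l J)
  define s where "s n = (\<Sum>j\<in>insert i (insert l J). b j * x j ^ n)" for n
  define b' where "b' j = b j * (x j - x l)" for j
  have il: "i \<noteq> l" "i \<notin> J" using insert.prems by auto
  have eq: "(\<Sum>j\<in>insert i J. b' j * x j ^ n) = s (Suc n) - x l * s n" for n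
    using insert.hyps il
    by (simp add: s_def b'_def sum_distrib_left algebra_simps sum_subtractf)
  have sA: "norm (s n) \<le> A" if "n \<le> Suc (card J)" for n
    using insert.prems(3)[of n] insert.hyps that unfolding s_def by simp
  have "norm (\<Sum>j\<in>insert i J. b' j * x j ^ n) \<le> 2 * A" if "n \<le> card J" for n
  proof -
    have "norm (s (Suc n) - x l * s n) \<le> norm (s (Suc n)) + norm (x l) * norm (s n)"
      by (metis norm_mult norm_triangle_ineq4)
    also have "\<dots> \<le> A + 1 * A"
      using sA[of "Suc n"] sA[of n] that insert.prems(2)[of l] by (intro add_mono mult_mono) auto
    finally show ?thesis by (simp add: eq)
  qed
  then have "norm (b' i) * (\<Prod>j\<in>J. norm (x i - x j)) \<le> 2 ^ card J * (2 * A)"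
    using insert.prems il by (intro insert.IH) auto
  moreover have "norm (b' i) = norm (b i) * norm (x i - x l)"
    by (simp add: b'_def norm_mult)
  ultimately show ?case using insert.hyps by (simp add: mult_ac)
qed

text \<open>The distance is twice the sine of half the difference, and
  \<open>x / 2 \<le> sin x\<close> on \<open>[0, 1]\<close> because the cosine is at least 1/2 up to
  pi/3. Frequencies in [-1, 1] differ by at most 2, so sampling at integers never confuses two of
  them.\<close>

lemma norm_cis_diff_ge:
  assumes "\<bar>a - b\<bar> \<le> 2"
  shows "\<bar>a - b\<bar> / 2 \<le> norm (cis a - cis b)"
proof -
  have sin_ge: "x / 2 \<le> sin x" if "0 \<le> x" "x \<le> 1" for x :: real
  proof (cases "x = 0")
    case False
    then have "0 < x" using that by simp
    then obtain z where z: "0 < z" "z < x" "sin x - sin 0 = (x - 0) * cos z"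
      using MVT2[of 0 x sin cos, OF _ DERIV_sin] by blast
    have "cos (pi / 3) \<le> cos z"
      using z that pi_gt3 by (intro cos_monotone_0_pi_le) auto
    then have "1 / 2 \<le> cos z" by (simp add: cos_60)
    then have "x * (1 / 2) \<le> x * cos z" using that by (intro mult_left_mono) auto
    then show ?thesis using z by simp
  qed simp
  define d where "d = a - b"
  have "cis a - cis b = cis b * (cis d - 1)"
    by (simp add: d_def algebra_simps cis_mult)
  then have "norm (cis a - cis b) = norm (exp (\<i> * of_real d) - 1)"
    by (simp add: norm_mult cis_conv_exp)
  also have "\<dots> = 2 * \<bar>sin (d / 2)\<bar>"
    by (rule dist_exp_i_1)
  also have "\<bar>sin (d / 2)\<bar> = \<bar>sin (\<bar>d\<bar> / 2)\<bar>"
    by (cases "d \<ge> 0") auto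
  finally show ?thesis
    using sin_ge[of "\<bar>d\<bar> / 2"] assms by (simp add: d_def)
qed

lemma sum_norm_le_sqrt_card:
  fixes b :: "'a \<Rightarrow> complex"
  assumes "(\<Sum>j\<in>J. (norm (b j))\<^sup>2) = 1"
  shows "(\<Sum>j\<in>J. norm (b j))\<^sup>2 \<le> card J"
proof -
  have "(\<Sum>j\<in>J. 1 * norm (b j))\<^sup>2 \<le> (\<Sum>j\<in>J. 1\<^sup>2) * (\<Sum>j\<in>J. (norm (b j))\<^sup>2)"
    by (rule Cauchy_Schwarz_ineq_sum)
  then show ?thesis using assms by simp
qed

text \<open>In the sum of squares over \<open>n < T\<close> the diagonal contributes
  \<open>T\<close>. Every other kernel is a geometric sum of size at most \<open>4 / s\<close>, so
  the off-diagonal part is at most \<open>4 * card J / s\<close>, hence at most T/2. If all values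
  were below 1/2, then T would be at most T/2 + T/4.\<close>

lemma exp_sum_mean_lower:
  fixes b :: "'a \<Rightarrow> complex" and \<omega> :: "'a \<Rightarrow> real"
  assumes fin: "finite J" and b1: "(\<Sum>j\<in>J. (norm (b j))\<^sup>2) = 1" and "0 < s"
    and sep: "\<And>i j. i \<in> J \<Longrightarrow> j \<in> J \<Longrightarrow> i \<noteq> j \<Longrightarrow> s \<le> \<bar>\<omega> i - \<omega> j\<bar> \<and> \<bar>\<omega> i - \<omega> j\<bar> \<le> 2"
    and T: "8 * real (card J) \<le> s * real T"
  shows "\<exists>n<T. 1 / 2 \<le> norm (\<Sum>j\<in>J. b j * cis (\<omega> j) ^ n)"
proof (rule ccontr)
  assume "\<not> ?thesis"
  then have small: "norm (\<Sum>j\<in>J. b j * cis (\<omega> j) ^ n) \<le> 1 / 2" if "n < T" for n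
    using that by force
  define P where "P n = (\<Sum>j\<in>J. b j * cis (\<omega> j) ^ n)" for n
  define K where "K i j = (\<Sum>n<T. (cis (\<omega> i) * cnj (cis (\<omega> j))) ^ n)" for i j
  have "J \<noteq> {}" using b1 by auto
  with fin have N0: "0 < card J" by (simp add: card_gt_0_iff)
  with T \<open>0 < s\<close> have T0: "0 < real T"
    by (metis mult_pos_pos of_nat_0_less_iff order_less_le_trans zero_less_mult_pos zero_less_numeral)
  have Kdiag: "K i i = of_nat T" for i
    by (simp add: K_def cis_mult cis_cnj)
  have Koff: "norm (K i j) \<le> 4 / s" if "i \<in> J" "j \<in> J" "i \<noteq> j" for i j
  proof -
    define x where "x = cis (\<omega> i) * cnj (cis (\<omega> j))"
    have x1: "norm x = 1" by (simp add: x_def norm_mult)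
    have "x - 1 = cis (\<omega> i - \<omega> j) - cis 0"
      by (simp add: x_def cis_cnj cis_mult)
    then have xs: "s / 2 \<le> norm (x - 1)"
      using norm_cis_diff_ge[of "\<omega> i - \<omega> j" 0] sep[OF that] by simp
    then have "x \<noteq> 1" using \<open>0 < s\<close> by auto
    then have "K i j = (x ^ T - 1) / (x - 1)"
      by (simp add: K_def geometric_sum flip: x_def)
    also have "norm \<dots> \<le> 2 / norm (x - 1)"
      using norm_triangle_ineq4[of "x ^ T" 1] x1
      by (simp add: norm_divide norm_power divide_right_mono)
    also have "\<dots> \<le> 2 / (s / 2)" using xs \<open>0 < s\<close> by (intro divide_left_mono mult_pos_pos) auto
    finally show ?thesis by simp
  qed
  have "(\<Sum>n<T. P n * cnj (P n)) = (\<Sum>n<T. \<Sum>i\<in>J. \<Sum>j\<in>J. b i * cnj (b j) * (cis (\<omega> i) * cnj (cis (\<omega> j))) ^ n)"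
    by (simp add: P_def sum_product power_mult_distrib mult_ac)
  also have "\<dots> = (\<Sum>i\<in>J. \<Sum>j\<in>J. b i * cnj (b j) * K i j)"
    unfolding K_def sum_distrib_left by (subst sum.swap, rule sum.cong[OF refl], rule sum.swap)
  also have "\<dots> = (\<Sum>i\<in>J. \<Sum>j\<in>J. (if i = j then b i * cnj (b i) * of_nat T else 0)
      + (if i = j then 0 else b i * cnj (b j) * K i j))"
    by (intro sum.cong refl) (auto simp: Kdiag)
  also have "\<dots> = (\<Sum>i\<in>J. b i * cnj (b i) * of_nat T)
      + (\<Sum>i\<in>J. \<Sum>j\<in>J. if i = j then 0 else b i * cnj (b j) * K i j)"
    by (simp add: sum.distrib sum.delta fin)
  also have "(\<Sum>i\<in>J. b i * cnj (b i) * of_nat T) = of_nat T"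
  proof -
    have "(\<Sum>i\<in>J. b i * cnj (b i)) = of_real (\<Sum>i\<in>J. (norm (b i))\<^sup>2)"
      by (simp add: complex_norm_square[symmetric])
    then show ?thesis using b1 by (simp flip: sum_distrib_right)
  qed
  finally have eq: "(\<Sum>n<T. P n * cnj (P n)) - of_nat T =
      (\<Sum>i\<in>J. \<Sum>j\<in>J. if i = j then 0 else b i * cnj (b j) * K i j)" by simp
  have "norm ((\<Sum>n<T. P n * cnj (P n)) - of_nat T) \<le> (\<Sum>i\<in>J. \<Sum>j\<in>J. norm (b i) * norm (b j) * (4 / s))"
    unfolding eq using Koff \<open>0 < s\<close>
    by (intro sum_norm_le order.trans[OF norm_sum] sum_mono)
       (auto simp: norm_mult simp del: times_divide_eq_right intro!: mult_left_mono divide_nonneg_pos mult_nonneg_nonneg)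
  also have "\<dots> = (\<Sum>j\<in>J. norm (b j))\<^sup>2 * (4 / s)"
    unfolding power2_eq_square sum_product by (simp only: sum_distrib_right)
  also have "\<dots> \<le> card J * (4 / s)"
    using sum_norm_le_sqrt_card[OF b1] \<open>0 < s\<close> by (intro mult_right_mono) auto
  also have "\<dots> \<le> T / 2"
    using T \<open>0 < s\<close> by (simp add: field_simps)
  finally have "norm ((\<Sum>n<T. P n * cnj (P n)) - of_nat T) \<le> T / 2" .
  moreover have "norm (\<Sum>n<T. P n * cnj (P n)) \<le> (\<Sum>n<T. 1/2 * (1/2))"
  proof (rule sum_norm_le)
    fix n assume "n \<in> {..<T}"
    then have "norm (P n) * norm (P n) \<le> 1/2 * (1/2)"
      using small[of n] by (intro mult_mono) (auto simp: P_def)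
    then show "norm (P n * cnj (P n)) \<le> 1/2 * (1/2)" by (simp add: norm_mult)
  qed
  ultimately have "real T \<le> T / 2 + T / 4"
    using norm_triangle_ineq4[of "\<Sum>n<T. P n * cnj (P n)" "(\<Sum>n<T. P n * cnj (P n)) - of_nat T"]
    by simp
  then show False using T0 by simp
qed

text \<open>Unlike the mean square, this needs only \<open>card J\<close> samples however small
  \<open>s\<close> is, at the price of a bound exponentially small in \<open>card J\<close>. All
  frequencies are eliminated except one whose coefficient is at least \<open>1 / card J\<close> in
  modulus.\<close>

lemma exp_sum_difference_lower:
  fixes b :: "'a \<Rightarrow> complex" and \<omega> :: "'a \<Rightarrow> real"
  assumes fin: "finite J" and b1: "(\<Sum>j\<in>J. (norm (b j))\<^sup>2) = 1" and "0 < s" "s \<le> 2"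
    and sep: "\<And>i j. i \<in> J \<Longrightarrow> j \<in> J \<Longrightarrow> i \<noteq> j \<Longrightarrow> s \<le> \<bar>\<omega> i - \<omega> j\<bar> \<and> \<bar>\<omega> i - \<omega> j\<bar> \<le> 2"
  shows "\<exists>n<card J. (s / 4) ^ card J / real (card J) \<le> norm (\<Sum>j\<in>J. b j * cis (\<omega> j) ^ n)"
proof (rule ccontr)
  assume "\<not> ?thesis"
  then have small: "norm (\<Sum>j\<in>J. b j * cis (\<omega> j) ^ n) < (s / 4) ^ card J / real (card J)"
    if "n < card J" for n using that by force
  let ?N = "real (card J)"
  have "J \<noteq> {}" using b1 by auto
  with fin have N0: "0 < card J" by (simp add: card_gt_0_iff)
  obtain i where i: "i \<in> J" "1 / ?N \<le> (norm (b i))\<^sup>2"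
  proof (rule ccontr)
    assume "\<not> thesis"
    then have "(\<Sum>j\<in>J. (norm (b j))\<^sup>2) < (\<Sum>j\<in>J. 1 / ?N)"
      using that fin \<open>J \<noteq> {}\<close> by (intro sum_strict_mono) (auto simp: not_le[symmetric])
    then show False using b1 N0 by simp
  qed
  have "norm (b i) \<le> 1"
  proof -
    have "(norm (b i))\<^sup>2 \<le> (\<Sum>j\<in>J. (norm (b j))\<^sup>2)"
      by (rule member_le_sum) (use i fin in auto)
    then show ?thesis using b1 by (simp add: power_le_one_iff)
  qed
  then have bi: "1 / ?N \<le> norm (b i)"
    using i(2) by (smt (verit) mult_left_le norm_ge_zero power2_eq_square)
  define J' where "J' = J - {i}"
  have J: "J = insert i J'" "i \<notin> J'" "finite J'" using i fin by (auto simp: J'_def)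
  then have cJ: "card J = Suc (card J')" by simp
  define A where "A = Max ((\<lambda>n. norm (\<Sum>j\<in>J. b j * cis (\<omega> j) ^ n)) ` {..card J'})"
  have A: "A < (s / 4) ^ card J / ?N"
    unfolding A_def using small cJ by (subst Max_less_iff) auto
  have "(1 / ?N) * (s / 2) ^ card J' \<le> norm (b i) * (\<Prod>j\<in>J'. norm (cis (\<omega> i) - cis (\<omega> j)))"
  proof (intro mult_mono bi)
    have "(\<Prod>j\<in>J'. s / 2) \<le> (\<Prod>j\<in>J'. norm (cis (\<omega> i) - cis (\<omega> j)))"
    proof (intro prod_mono conjI)
      fix j assume "j \<in> J'"
      then have "s \<le> \<bar>\<omega> i - \<omega> j\<bar>" "\<bar>\<omega> i - \<omega> j\<bar> \<le> 2" using sep[of i j] J by auto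
      then show "s / 2 \<le> norm (cis (\<omega> i) - cis (\<omega> j))"
        using norm_cis_diff_ge[of "\<omega> i" "\<omega> j"] by (meson divide_right_mono order_trans zero_le_numeral)
    qed (use \<open>0 < s\<close> in auto)
    then show "(s / 2) ^ card J' \<le> (\<Prod>j\<in>J'. norm (cis (\<omega> i) - cis (\<omega> j)))" by simp
  qed (use \<open>0 < s\<close> in auto)
  also have "\<dots> \<le> 2 ^ card J' * A"
    by (rule power_sum_lower[where x = "\<lambda>j. cis (\<omega> j)"]) (use J in \<open>auto simp: A_def intro!: Max_ge\<close>)
  also have "\<dots> < 2 ^ card J' * ((s / 4) ^ card J / ?N)"
    using A by (intro mult_strict_left_mono) auto
  also have "\<dots> = (1 / ?N) * ((s / 4) * (s / 2) ^ card J')"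
  proof -
    have "2 ^ card J' * (s / 4) ^ card J' = (2 * (s / 4)) ^ card J'" by (rule power_mult_distrib[symmetric])
    then show ?thesis unfolding cJ by (simp add: algebra_simps)
  qed
  also have "\<dots> \<le> (1 / ?N) * (1 * (s / 2) ^ card J')"
    using \<open>0 < s\<close> \<open>s \<le> 2\<close> by (intro mult_left_mono mult_right_mono) auto
  finally show False by simp
qed

text \<open>At the points \<open>k z / n\<close> of the ray to \<open>z\<close>, with
  \<open>n = 9 * card J\<close>, the sum is a power sum in k. The samples with k below
  \<open>card J\<close> lie in the disc of radius \<open>r\<close>, sample n is \<open>z\<close>
  itself, and \<open>power_sum_growth\<close> extrapolates. The nodes are bounded by
  \<open>q = exp (norm z / n)\<close>, so \<open>(1 + 2 q)^n\<close> is at most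
  \<open>3^n exp (norm z)\<close>.\<close>

lemma exp_sum_growth:
  fixes b :: "'a \<Rightarrow> complex" and \<omega> :: "'a \<Rightarrow> real"
  assumes fin: "finite J" "J \<noteq> {}" and w: "\<And>j. j \<in> J \<Longrightarrow> \<bar>\<omega> j\<bar> \<le> 1"
    and z: "norm z \<le> 9 * r"
    and A: "\<And>w. norm w \<le> r \<Longrightarrow> norm (\<Sum>j\<in>J. b j * exp (\<i> * of_real (\<omega> j) * w)) \<le> A"
  shows "norm (\<Sum>j\<in>J. b j * exp (\<i> * of_real (\<omega> j) * z)) \<le> 3 ^ (9 * card J) * exp (9 * r) * A"
proof -
  define n where "n = 9 * card J"
  have n0: "0 < n" using fin by (simp add: n_def card_gt_0_iff)
  have r0: "0 \<le> r" using z norm_ge_zero[of z] by linarith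
  have A0: "0 \<le> A" using order_trans[OF norm_ge_zero A[of 0]] r0 by simp
  define x where "x j = exp (\<i> * of_real (\<omega> j) * (z / of_nat n))" for j
  define q where "q = exp (norm z / n)"
  have xk: "x j ^ k = exp (\<i> * of_real (\<omega> j) * (of_nat k * (z / of_nat n)))" for j k
    unfolding x_def by (simp add: exp_of_nat_mult[symmetric] mult_ac)
  have q1: "1 \<le> q" by (simp add: q_def)
  have xq: "norm (x j) \<le> q" if "j \<in> J" for j
  proof -
    have "norm (x j) \<le> exp (norm (\<i> * of_real (\<omega> j) * (z / of_nat n)))"
      unfolding x_def by (rule norm_exp)
    also have "\<dots> \<le> exp (1 * (norm z / n))"
      using w[OF that] unfolding norm_mult norm_divide
      by (intro exp_le_cancel_iff[THEN iffD2] mult_mono) auto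
    finally show ?thesis by (simp add: q_def)
  qed
  have "norm (\<Sum>j\<in>J. b j * x j ^ n) \<le> (1 + 2 * q) ^ n * A"
  proof (rule power_sum_growth[OF fin(1) q1 xq _ A0])
    fix k assume k: "k < card J"
    have "norm (of_nat k * (z / of_nat n)) = real k / real n * norm z"
      by (simp add: norm_mult norm_divide)
    also have "\<dots> \<le> (1 / 9) * (9 * r)"
      using k z by (intro mult_mono) (auto simp: n_def field_simps)
    finally show "norm (\<Sum>j\<in>J. b j * x j ^ k) \<le> A"
      unfolding xk by (intro A) simp
  qed
  also have "(1 + 2 * q) ^ n \<le> (3 * q) ^ n"
    using q1 by (intro power_mono) auto
  also have "(3 * q) ^ n = 3 ^ n * exp (norm z)"
    using n0 by (simp add: q_def power_mult_distrib exp_of_nat_mult[symmetric])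
  also have "\<dots> \<le> 3 ^ n * exp (9 * r)" using z by simp
  finally show ?thesis
    using n0 A0 by (simp add: xk n_def mult_right_mono)
qed

section \<open>Products of Gaussian integers of equal norm\<close>

text \<open>Gaussian integers are kept inside \<open>complex\<close>, where conjugation, modulus and
  division are at hand. Divisibility by a prime is then derived from coordinates and congruences,
  not from unique factorization.\<close>

definition gauss_ints :: "complex set" where
  "gauss_ints = {z. Re z \<in> \<int> \<and> Im z \<in> \<int>}"

definition gauss_circle :: "nat \<Rightarrow> complex set" where
  "gauss_circle m = {z \<in> gauss_ints. (cmod z)\<^sup>2 = real m}"

definition gauss_products :: "nat \<Rightarrow> complex set" where
  "gauss_products m = (\<lambda>(z, w). z * w) ` (gauss_circle m \<times> gauss_circle m)"

lemma gauss_intsE: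
  assumes "z \<in> gauss_ints"
  obtains a b :: int where "z = Complex (of_int a) (of_int b)"
  using assms by (auto simp: gauss_ints_def complex_eq_iff elim!: Ints_cases)

lemma gauss_ints_Complex [simp]: "Complex (of_int a) (of_int b) \<in> gauss_ints"
  by (simp add: gauss_ints_def)

lemma gauss_ints_closed [simp]:
  "z \<in> gauss_ints \<Longrightarrow> w \<in> gauss_ints \<Longrightarrow> z * w \<in> gauss_ints"
  "z \<in> gauss_ints \<Longrightarrow> w \<in> gauss_ints \<Longrightarrow> z + w \<in> gauss_ints"
  "z \<in> gauss_ints \<Longrightarrow> - z \<in> gauss_ints"
  "z \<in> gauss_ints \<Longrightarrow> cnj z \<in> gauss_ints"
  "of_int i \<in> gauss_ints" "of_nat n \<in> gauss_ints" "1 \<in> gauss_ints"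
  by (simp_all add: gauss_ints_def)

lemma gauss_ints_power [simp]: "z \<in> gauss_ints \<Longrightarrow> z ^ n \<in> gauss_ints"
  by (induction n) auto

lemma gauss_circleE:
  assumes "z \<in> gauss_circle m"
  obtains a b :: int where "z = Complex (of_int a) (of_int b)" "a\<^sup>2 + b\<^sup>2 = int m"
proof -
  obtain a b where ab: "z = Complex (of_int a) (of_int b)"
    using assms by (auto simp: gauss_circle_def elim: gauss_intsE)
  then have "real_of_int (a\<^sup>2 + b\<^sup>2) = real_of_int (int m)"
    using assms by (simp add: gauss_circle_def cmod_def)
  then have "a\<^sup>2 + b\<^sup>2 = int m" by (simp only: of_int_eq_iff)
  with ab show ?thesis by (rule that)
qed

lemma finite_gauss_circle [simp]: "finite (gauss_circle m)"
proof -
  have "gauss_circle m \<subseteq> (\<lambda>(a, b). Complex (of_int a) (of_int b)) ` ({- int m..int m} \<times> {- int m..int m})"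
  proof
    fix z assume z: "z \<in> gauss_circle m"
    then obtain a b where ab: "z = Complex (of_int a) (of_int b)" and eq: "a\<^sup>2 + b\<^sup>2 = int m"
      by (rule gauss_circleE)
    have "\<bar>c\<bar> \<le> c\<^sup>2" for c :: int
      using mult_left_mono[of 1 "\<bar>c\<bar>" "\<bar>c\<bar>"] by (cases "c = 0") (auto simp: power2_eq_square)
    then have "\<bar>a\<bar> \<le> int m" "\<bar>b\<bar> \<le> int m"
      using eq zero_le_power2[of a] zero_le_power2[of b] by (smt (verit, best))+
    then show "z \<in> (\<lambda>(a, b). Complex (of_int a) (of_int b)) ` ({- int m..int m} \<times> {- int m..int m})"
      using ab by (intro image_eqI[of _ _ "(a, b)"]) auto
  qed
  then show ?thesis by (rule finite_subset) simp
qed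

lemma finite_gauss_products [simp]: "finite (gauss_products m)"
  by (simp add: gauss_products_def)

lemma gauss_circle_mult:
  "z \<in> gauss_ints \<Longrightarrow> (cmod z)\<^sup>2 = real k \<Longrightarrow> w \<in> gauss_circle m \<Longrightarrow> z * w \<in> gauss_circle (k * m)"
  by (simp add: gauss_circle_def norm_mult power_mult_distrib)

text \<open>The norms force p to divide \<open>(a x + b y) (a x - b y)\<close>. So for
  \<open>v\<close> equal to y or -y, p divides the real part \<open>a x + b v\<close> of z times the
  conjugate of x + i v. The squared modulus of that product is divisible by p, hence so is its
  imaginary part \<open>b x - a v\<close>. The product divided by p is the quotient of z by x + i
  v.\<close>

lemma gauss_divide_prime:
  fixes x y :: int and p :: nat
  assumes p: "prime p" and xy: "x\<^sup>2 + y\<^sup>2 = int p"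
    and z: "z \<in> gauss_circle (p * k)"
  obtains w where "w \<in> gauss_circle k"
    "z = Complex (of_int x) (of_int y) * w \<or> z = cnj (Complex (of_int x) (of_int y)) * w"
proof -
  define \<pi> where "\<pi> = Complex (of_int x) (of_int y)"
  obtain a b where ab: "z = Complex (of_int a) (of_int b)" and "a\<^sup>2 + b\<^sup>2 = int (p * k)"
    using z by (rule gauss_circleE)
  then have eq: "a\<^sup>2 + b\<^sup>2 = int p * int k" by simp
  have pp: "prime (int p)" using p by simp
  have xyr: "(real_of_int x)\<^sup>2 + (real_of_int y)\<^sup>2 = real p"
    using arg_cong[OF xy, of real_of_int] by simp
  have norm\<pi>: "(cmod \<pi>)\<^sup>2 = real p"
    by (simp add: \<pi>_def cmod_def xyr)
  have p0: "real p \<noteq> 0" using p by (auto simp: prime_gt_0_nat)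
  have wk: "w \<in> gauss_circle k" if "w \<in> gauss_ints" "z = \<pi> * w \<or> z = cnj \<pi> * w" for w
  proof -
    have "(cmod z)\<^sup>2 = real p * (cmod w)\<^sup>2"
      using that by (auto simp: norm_mult power_mult_distrib norm\<pi>)
    then show ?thesis using that z p0 by (simp add: gauss_circle_def)
  qed
  have "(a * x + b * y) * (a * x - b * y) = a\<^sup>2 * (x\<^sup>2 + y\<^sup>2) - y\<^sup>2 * (a\<^sup>2 + b\<^sup>2)"
    by (simp add: algebra_simps power2_eq_square)
  also have "\<dots> = int p * (a\<^sup>2 - y\<^sup>2 * int k)"
    unfolding xy eq by (simp add: algebra_simps)
  finally have "int p dvd (a * x + b * y) * (a * x - b * y)" by simp
  then have "int p dvd a * x + b * y \<or> int p dvd a * x + b * (- y)"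
    using pp by (auto simp: prime_dvd_mult_iff)
  then obtain v where v: "v = y \<or> v = - y" and dvd: "int p dvd a * x + b * v" by blast
  have xv: "x\<^sup>2 + v\<^sup>2 = int p" using v xy by auto
  have "(b * x - a * v)\<^sup>2 = (x\<^sup>2 + v\<^sup>2) * (a\<^sup>2 + b\<^sup>2) - (a * x + b * v)\<^sup>2"
    by (simp add: algebra_simps power2_eq_square)
  also have "\<dots> = int p * (int p * int k) - (a * x + b * v)\<^sup>2" unfolding xv eq ..
  finally have "int p dvd (b * x - a * v)\<^sup>2" using dvd by (simp add: power2_eq_square)
  then have "int p dvd b * x - a * v" using pp prime_dvd_power by blast
  with dvd obtain c d where cd: "a * x + b * v = int p * c" "b * x - a * v = int p * d"
    unfolding dvd_def by blast
  have "int p * (x * c - v * d) = x * (a * x + b * v) - v * (b * x - a * v)"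
    unfolding cd by (simp add: algebra_simps)
  also have "\<dots> = int p * a" unfolding xv[symmetric] by (simp add: algebra_simps power2_eq_square)
  finally have 1: "x * c - v * d = a" using p0 by simp
  have "int p * (x * d + v * c) = x * (b * x - a * v) + v * (a * x + b * v)"
    unfolding cd by (simp add: algebra_simps)
  also have "\<dots> = int p * b" unfolding xv[symmetric] by (simp add: algebra_simps power2_eq_square)
  finally have 2: "x * d + v * c = b" using p0 by simp
  have "z = Complex (of_int x) (of_int v) * Complex (of_int c) (of_int d)"
    unfolding ab 1[symmetric] 2[symmetric] by (simp add: complex_eq_iff)
  moreover have "Complex (of_int x) (of_int v) = \<pi> \<or> Complex (of_int x) (of_int v) = cnj \<pi>"
    using v by (auto simp: \<pi>_def complex_eq_iff)
  ultimately have "z = \<pi> * Complex (of_int c) (of_int d) \<or> z = cnj \<pi> * Complex (of_int c) (of_int d)" by auto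
  then show ?thesis using that[of "Complex (of_int c) (of_int d)"] wk by (auto simp: \<pi>_def)
qed

lemma gauss_divide_prime_power:
  fixes x y :: int and p :: nat
  assumes p: "prime p" and xy: "x\<^sup>2 + y\<^sup>2 = int p"
    and z: "z \<in> gauss_circle (p ^ e * k)"
  obtains w i where "w \<in> gauss_circle k" "i \<le> e"
    "z = Complex (of_int x) (of_int y) ^ i * cnj (Complex (of_int x) (of_int y)) ^ (e - i) * w"
  using z
proof (induction e arbitrary: z thesis)
  case 0
  then show ?case by auto
next
  case (Suc e)
  define \<pi> where "\<pi> = Complex (of_int x) (of_int y)"
  have "z \<in> gauss_circle (p * (p ^ e * k))" using Suc.prems by (simp add: mult_ac)
  then obtain v where v: "v \<in> gauss_circle (p ^ e * k)" "z = \<pi> * v \<or> z = cnj \<pi> * v"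
    unfolding \<pi>_def by (rule gauss_divide_prime[OF p xy])
  obtain w i where w: "w \<in> gauss_circle k" "i \<le> e" "v = \<pi> ^ i * cnj \<pi> ^ (e - i) * w"
    using Suc.IH[OF _ v(1)] unfolding \<pi>_def by blast
  from v(2) show ?case
  proof
    assume "z = \<pi> * v"
    then have "z = \<pi> ^ Suc i * cnj \<pi> ^ (Suc e - Suc i) * w" using w by (simp add: mult_ac)
    then show ?thesis using Suc.prems(1)[of w "Suc i"] w by (auto simp: \<pi>_def)
  next
    assume "z = cnj \<pi> * v"
    then have "z = \<pi> ^ i * cnj \<pi> ^ (Suc e - i) * w" using w by (simp add: mult_ac Suc_diff_le)
    then show ?thesis using Suc.prems(1)[of w i] w by (auto simp: \<pi>_def)
  qed
qed

text \<open>An element of trace 2x and norm p satisfies \<open>\<pi>^2 = 2 x \<pi> - p\<close>;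
  modulo p each further factor \<open>\<pi>\<close> thus acts as multiplication by 2x.\<close>

lemma gauss_power_mod_prime:
  fixes x y :: int and p :: nat
  assumes xy: "x\<^sup>2 + y\<^sup>2 = int p"
  obtains g where "g \<in> gauss_ints"
    "Complex (of_int x) (of_int y) ^ Suc j
       = of_int ((2 * x) ^ j) * Complex (of_int x) (of_int y) + of_nat p * g"
proof (induction j arbitrary: thesis)
  case 0
  show ?case by (rule 0[of 0]) (simp_all add: gauss_ints_def)
next
  case (Suc j)
  define \<pi> where "\<pi> = Complex (of_int x) (of_int y)"
  have p: "of_nat p = (of_int (x\<^sup>2 + y\<^sup>2) :: complex)" unfolding xy by simp
  have sq: "\<pi> * \<pi> = of_int (2 * x) * \<pi> - of_nat p"
    unfolding p \<pi>_def by (simp add: complex_eq_iff power2_eq_square algebra_simps)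
  obtain g where g: "g \<in> gauss_ints" "\<pi> ^ Suc j = of_int ((2 * x) ^ j) * \<pi> + of_nat p * g"
    using Suc.IH unfolding \<pi>_def by blast
  have "\<pi> ^ Suc (Suc j) = \<pi> * \<pi> ^ Suc j" by simp
  also have "\<dots> = of_int ((2 * x) ^ j) * (\<pi> * \<pi>) + of_nat p * (\<pi> * g)"
    unfolding g(2) by (simp add: algebra_simps)
  also have "\<dots> = of_int ((2 * x) ^ Suc j) * \<pi> + of_nat p * (\<pi> * g + - of_int ((2 * x) ^ j))"
    unfolding sq by (simp add: algebra_simps)
  finally show ?case
    using Suc.prems[of "\<pi> * g + - of_int ((2 * x) ^ j)"] g(1) unfolding \<pi>_def
    by (metis gauss_ints_Complex gauss_ints_closed)
qed

text \<open>This replaces coprimality of \<open>\<pi>\<close> and its conjugate. Multiplying an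
  equality by \<open>cnj \<pi> ^ k * cnj w'\<close> gives
  \<open>p^k w cnj w' = cnj \<pi>^(2k) m\<close>, and the right side is
  \<open>(2 x)^(2k-1) m cnj \<pi>\<close> modulo p. Its real part forces p to divide 2, m or x; but
  if p divided x it would divide y, and p^2 would divide p.\<close>

lemma gauss_prime_powers_distinct:
  fixes x y :: int and p :: nat
  assumes p: "prime p" "p \<noteq> 2" and xy: "x\<^sup>2 + y\<^sup>2 = int p" and pm: "\<not> p dvd m"
    and w: "w \<in> gauss_circle m" "w' \<in> gauss_circle m" and "0 < k"
  shows "Complex (of_int x) (of_int y) ^ k * w \<noteq> cnj (Complex (of_int x) (of_int y)) ^ k * w'"
proof
  define \<pi> where "\<pi> = Complex (of_int x) (of_int y)"
  assume "Complex (of_int x) (of_int y) ^ k * w = cnj (Complex (of_int x) (of_int y)) ^ k * w'"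
  then have eq: "\<pi> ^ k * w = cnj \<pi> ^ k * w'" by (simp add: \<pi>_def)
  have pp: "prime (int p)" using p by simp
  have p0: "p \<noteq> 0" using p by auto
  have xyr: "(real_of_int x)\<^sup>2 + (real_of_int y)\<^sup>2 = real p"
    using arg_cong[OF xy, of real_of_int] by simp
  have norm\<pi>: "\<pi> * cnj \<pi> = of_nat p"
    unfolding complex_norm_square[symmetric] by (simp add: \<pi>_def cmod_def xyr)
  have w': "w' * cnj w' = of_nat m"
    unfolding complex_norm_square[symmetric] using w by (simp add: gauss_circle_def)
  obtain l where l: "2 * k = Suc l" using \<open>0 < k\<close> by (cases "2 * k") auto
  obtain h where h: "k = Suc h" using \<open>0 < k\<close> by (cases k) auto
  have xy': "x\<^sup>2 + (- y)\<^sup>2 = int p" using xy by simp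
  have cnj\<pi>: "cnj \<pi> = Complex (of_int x) (of_int (- y))" by (simp add: \<pi>_def complex_eq_iff)
  obtain g where g: "g \<in> gauss_ints" "cnj \<pi> ^ Suc l = of_int ((2 * x) ^ l) * cnj \<pi> + of_nat p * g"
    using gauss_power_mod_prime[OF xy'] unfolding cnj\<pi> by blast
  define u where "u = of_nat (p ^ h) * (w * cnj w')"
  have u: "u \<in> gauss_ints" using w by (simp add: u_def gauss_circle_def del: of_nat_power)
  have "of_nat p * u = (\<pi> * cnj \<pi>) ^ k * (w * cnj w')"
    unfolding norm\<pi> u_def h by simp
  also have "\<dots> = cnj \<pi> ^ k * (\<pi> ^ k * w) * cnj w'"
    by (simp add: power_mult_distrib mult_ac)
  also have "\<dots> = cnj \<pi> ^ (2 * k) * of_nat m"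
  proof -
    have "cnj \<pi> ^ (2 * k) = cnj \<pi> ^ k * cnj \<pi> ^ k" by (simp add: mult_2 power_add)
    then show ?thesis unfolding eq w'[symmetric] by (simp add: mult_ac)
  qed
  also have "\<dots> = (of_int ((2 * x) ^ l) * cnj \<pi> + of_nat p * g) * of_nat m"
    unfolding l g(2) ..
  finally have "of_int ((2 * x) ^ l) * of_nat m * cnj \<pi> = of_nat p * (u + - (g * of_nat m))"
    by (simp add: algebra_simps)
  moreover have "u + - (g * of_nat m) \<in> gauss_ints"
    using u g(1) by (intro gauss_ints_closed)
  then obtain c d where "u + - (g * of_nat m) = Complex (of_int c) (of_int d)"
    by (rule gauss_intsE)
  ultimately have "of_int ((2 * x) ^ l) * of_nat m * cnj \<pi> = of_nat p * Complex (of_int c) (of_int d)"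
    by simp
  from arg_cong[OF this, of Re] have "real_of_int ((2 * x) ^ l * int m * x) = real_of_int (int p * c)"
    by (simp add: \<pi>_def del: of_int_power)
  then have "(2 * x) ^ l * int m * x = int p * c" by (simp only: of_int_eq_iff)
  then have "int p dvd (2 * x) ^ l * int m * x" by simp
  then have "int p dvd (2 * x) ^ l \<or> int p dvd x"
    using pm prime_dvd_mult_iff[OF pp] by (auto simp: int_dvd_int_iff)
  then have "int p dvd 2 \<or> int p dvd x"
    using prime_dvd_power[OF pp, of "2 * x" l] prime_dvd_mult_iff[OF pp] by blast
  moreover have "\<not> int p dvd 2"
  proof
    assume "int p dvd 2"
    then have "int p dvd int 2" by simp
    then have "p dvd 2" by (simp only: int_dvd_int_iff)
    then show False using p primes_dvd_imp_eq[of p 2] two_is_prime_nat by blast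
  qed
  moreover have "\<not> int p dvd x"
  proof
    assume px: "int p dvd x"
    have "y\<^sup>2 = int p - x * x" using xy by (simp add: power2_eq_square)
    then have "int p dvd y\<^sup>2" using px by simp
    then have py: "int p dvd y" using pp prime_dvd_power by blast
    have "(int p)\<^sup>2 dvd x\<^sup>2 + y\<^sup>2" using px py by (intro dvd_add) (auto simp: dvd_power_same)
    then have "int p * int p dvd int p * 1" unfolding xy by (simp add: power2_eq_square)
    then have "int p dvd 1" using p0 by (subst (asm) dvd_mult_cancel_left) simp
    then show False using pp not_prime_unit by blast
  qed
  ultimately show False by blast
qed

text \<open>The points \<open>\<pi>^i cnj \<pi>^(e-i) w\<close> are pairwise different: cancelling
  common powers in a coincidence with i < j leaves an equality that
  \<open>gauss_prime_powers_distinct\<close> excludes.\<close>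

lemma card_gauss_circle_prime_power:
  fixes x y :: int and p :: nat
  assumes p: "prime p" "p \<noteq> 2" and xy: "x\<^sup>2 + y\<^sup>2 = int p" and pm: "\<not> p dvd m"
  shows "(e + 1) * card (gauss_circle m) \<le> card (gauss_circle (p ^ e * m))"
proof -
  define \<pi> where "\<pi> = Complex (of_int x) (of_int y)"
  define f where "f = (\<lambda>(i, w). \<pi> ^ i * cnj \<pi> ^ (e - i) * w)"
  have xyr: "(real_of_int x)\<^sup>2 + (real_of_int y)\<^sup>2 = real p"
    using arg_cong[OF xy, of real_of_int] by simp
  have norm\<pi>: "(cmod \<pi>)\<^sup>2 = real p" by (simp add: \<pi>_def cmod_def xyr)
  have \<pi>0: "\<pi> \<noteq> 0" using norm\<pi> p(1) by auto
  have \<pi>: "\<pi> \<in> gauss_ints" by (simp add: \<pi>_def)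
  have aux: False if "f (i, w) = f (j, w')" "i < j" "j \<le> e" "w \<in> gauss_circle m" "w' \<in> gauss_circle m" for i j w w'
  proof -
    define k where "k = j - i"
    have k: "j = i + k" "0 < k" "e - i = (e - j) + k" using that by (auto simp: k_def)
    have "\<pi> ^ i * cnj \<pi> ^ (e - j) * (cnj \<pi> ^ k * w) = \<pi> ^ i * cnj \<pi> ^ (e - j) * (\<pi> ^ k * w')"
    proof -
      have "\<pi> ^ j = \<pi> ^ i * \<pi> ^ k" using k(1) by (simp add: power_add)
      then show ?thesis using that(1) unfolding f_def prod.case k(3) by (simp only: power_add mult_ac)
    qed
    then have "\<pi> ^ k * w' = cnj \<pi> ^ k * w" using \<pi>0 by simp
    then show False
      using gauss_prime_powers_distinct[OF p xy pm that(5,4) k(2)] unfolding \<pi>_def by blast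
  qed
  have "inj_on f ({..e} \<times> gauss_circle m)"
  proof (rule inj_onI)
    fix u v assume uv: "u \<in> {..e} \<times> gauss_circle m" "v \<in> {..e} \<times> gauss_circle m" "f u = f v"
    obtain i w j w' where [simp]: "u = (i, w)" "v = (j, w')" by (cases u, cases v)
    have "i = j" using aux[of i w j w'] aux[of j w' i w] uv by (cases i j rule: linorder_cases) auto
    then show "u = v" using uv(3) \<pi>0 by (simp add: f_def)
  qed
  moreover have "f ` ({..e} \<times> gauss_circle m) \<subseteq> gauss_circle (p ^ e * m)"
  proof (rule image_subsetI)
    fix u assume u: "u \<in> {..e} \<times> gauss_circle m"
    obtain i w where [simp]: "u = (i, w)" by (cases u)
    have i: "i \<le> e" "w \<in> gauss_circle m" using u by auto
    have "(cmod (\<pi> ^ i * cnj \<pi> ^ (e - i)))\<^sup>2 = ((cmod \<pi>)\<^sup>2) ^ i * ((cmod \<pi>)\<^sup>2) ^ (e - i)"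
      by (simp add: norm_mult norm_power power_mult_distrib flip: power_mult, simp add: mult.commute)
    also have "\<dots> = real (p ^ e)" using i by (simp add: norm\<pi> flip: power_add)
    finally show "f u \<in> gauss_circle (p ^ e * m)"
      unfolding f_def \<open>u = _\<close> prod.case by (intro gauss_circle_mult i) (simp_all add: \<pi>)
  qed
  ultimately have "card ({..e} \<times> gauss_circle m) \<le> card (gauss_circle (p ^ e * m))"
    by (rule card_inj_on_le) simp
  then show ?thesis by (simp add: card_cartesian_product)
qed

text \<open>In a product of two points the exponents of \<open>\<pi>\<close> merge into one sum
  between 0 and \<open>2 * e\<close>, and the cofactors merge into one product on the smaller
  circle. Hence the factor is linear in e and not (e + 1)^2.\<close>

lemma card_gauss_products_prime_power:
  fixes x y :: int and p :: nat
  assumes p: "prime p" and xy: "x\<^sup>2 + y\<^sup>2 = int p"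
  shows "card (gauss_products (p ^ e * m)) \<le> (2 * e + 1) * card (gauss_products m)"
proof -
  define \<pi> where "\<pi> = Complex (of_int x) (of_int y)"
  have "gauss_products (p ^ e * m)
      \<subseteq> (\<lambda>(i, w). \<pi> ^ i * cnj \<pi> ^ (2 * e - i) * w) ` ({..2 * e} \<times> gauss_products m)"
  proof
    fix u assume "u \<in> gauss_products (p ^ e * m)"
    then obtain z z' where u: "u = z * z'" and z: "z \<in> gauss_circle (p ^ e * m)" "z' \<in> gauss_circle (p ^ e * m)"
      by (auto simp: gauss_products_def)
    obtain w i where w: "w \<in> gauss_circle m" "i \<le> e" "z = \<pi> ^ i * cnj \<pi> ^ (e - i) * w"
      using gauss_divide_prime_power[OF p xy z(1)] unfolding \<pi>_def by blast
    obtain w' i' where w': "w' \<in> gauss_circle m" "i' \<le> e" "z' = \<pi> ^ i' * cnj \<pi> ^ (e - i') * w'"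
      using gauss_divide_prime_power[OF p xy z(2)] unfolding \<pi>_def by blast
    have "2 * e - (i + i') = (e - i) + (e - i')" using w w' by simp
    then have "u = \<pi> ^ (i + i') * cnj \<pi> ^ (2 * e - (i + i')) * (w * w')"
      unfolding u w w' by (simp add: power_add mult_ac)
    moreover have "w * w' \<in> gauss_products m" using w w' by (auto simp: gauss_products_def)
    ultimately show "u \<in> (\<lambda>(i, w). \<pi> ^ i * cnj \<pi> ^ (2 * e - i) * w) ` ({..2 * e} \<times> gauss_products m)"
      using w w' by (intro image_eqI[of _ _ "(i + i', w * w')"]) auto
  qed
  then have "card (gauss_products (p ^ e * m)) \<le> card ({..2 * e} \<times> gauss_products m)"
    by (meson card_image_le card_mono finite_SigmaI finite_atMost finite_gauss_products finite_imageI le_trans)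
  then show ?thesis by (simp add: card_cartesian_product)
qed

text \<open>Thue's argument: (s + 1)^2 > p pairs \<open>(u, v)\<close> cannot all have different
  residues \<open>u b - v a\<close>, so some difference \<open>(x, y)\<close> satisfies
  \<open>x b = y a\<close> modulo p. Then p divides \<open>a^2 (x^2 + y^2)\<close>, hence
  \<open>x^2 + y^2\<close>, which lies strictly between 0 and 2p.\<close>

lemma prime_dvd_sum_squares_imp_sum_squares:
  fixes a b :: int and p :: nat
  assumes p: "prime p" and dvd: "int p dvd a\<^sup>2 + b\<^sup>2" and na: "\<not> int p dvd a"
  shows "\<exists>x y :: int. x\<^sup>2 + y\<^sup>2 = int p"
proof -
  have pp: "prime (int p)" using p by simp
  have p0: "0 < int p" using pp prime_gt_0_int by blast
  define s where "s = floor_sqrt p"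
  have s: "s * s \<le> p" "p < Suc s * Suc s"
    using floor_sqrt_power2_le[of p] Suc_floor_sqrt_power2_gt[of p] by (simp_all add: s_def power2_eq_square)
  define f where "f = (\<lambda>(u, v). (int u * b - int v * a) mod int p)"
  have "f ` ({..s} \<times> {..s}) \<subseteq> {0..<int p}" using p0 by (auto simp: f_def)
  then have "card (f ` ({..s} \<times> {..s})) \<le> p"
    by (metis card_atLeastLessThan_int card_mono diff_zero finite_atLeastLessThan_int nat_int)
  also have "\<dots> < card ({..s} \<times> {..s})" using s by (simp add: card_cartesian_product)
  finally have "\<not> inj_on f ({..s} \<times> {..s})" by (metis card_image less_irrefl)
  then obtain u v u' v' where uv: "u \<le> s" "v \<le> s" "u' \<le> s" "v' \<le> s" "(u, v) \<noteq> (u', v')" "f (u, v) = f (u', v')"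
    by (auto simp: inj_on_def)
  define x where "x = int u - int u'"
  define y where "y = int v - int v'"
  have "int p dvd (int u * b - int v * a) - (int u' * b - int v' * a)"
    using uv(6) by (simp add: f_def mod_eq_dvd_iff)
  also have "(int u * b - int v * a) - (int u' * b - int v' * a) = x * b - y * a"
    by (simp add: x_def y_def algebra_simps)
  finally have d: "int p dvd x * b - y * a" .
  have "a\<^sup>2 * (x\<^sup>2 + y\<^sup>2) = x\<^sup>2 * (a\<^sup>2 + b\<^sup>2) - (x * b - y * a) * (x * b + y * a)"
    by (simp add: algebra_simps power2_eq_square)
  also have "int p dvd \<dots>" using d dvd by (intro dvd_diff) (simp_all add: dvd_mult)
  finally have "int p dvd a\<^sup>2 \<or> int p dvd x\<^sup>2 + y\<^sup>2"
    using prime_dvd_mult_iff[OF pp] by blast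
  then have "int p dvd x\<^sup>2 + y\<^sup>2" using na prime_dvd_power[OF pp, of a 2] by blast
  then obtain c where c: "x\<^sup>2 + y\<^sup>2 = int p * c" by (elim dvdE)
  have "x \<noteq> 0 \<or> y \<noteq> 0" using uv(5) by (auto simp: x_def y_def)
  then have "0 < x\<^sup>2 + y\<^sup>2" by (simp add: sum_power2_gt_zero_iff)
  then have c0: "0 < c" using c p0 by (simp add: zero_less_mult_iff)
  have "\<not> s * s = p" using p prime_product[of s s] by auto
  then have "s * s < p" using s by simp
  then have ss: "int s * int s < int p" by (metis of_nat_less_iff of_nat_mult)
  have sq: "z\<^sup>2 \<le> int s * int s" if "\<bar>z\<bar> \<le> int s" for z
    using power_mono[OF that, of 2] by (simp add: power2_eq_square)
  have "x\<^sup>2 + y\<^sup>2 \<le> int s * int s + int s * int s"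
    using uv by (intro add_mono sq) (auto simp: x_def y_def)
  then have "int p * c < int p * 2" using ss c by linarith
  then have "c < 2" using p0 by simp
  then have "c = 1" using c0 by simp
  then show ?thesis using c by auto
qed

text \<open>By the preceding lemma such a p must divide both coordinates of every point, so the
  circle is a smaller one scaled by p.\<close>

lemma gauss_circle_prime_divisor:
  assumes p: "prime p" and m: "p dvd m" "0 < m"
    and ne: "gauss_circle m \<noteq> {}" and no: "\<nexists>x y :: int. x\<^sup>2 + y\<^sup>2 = int p"
  obtains k where "m = p\<^sup>2 * k" "gauss_circle m = (*) (of_nat p) ` gauss_circle k"
proof -
  have pp: "prime (int p)" and p0: "p \<noteq> 0" using p by auto
  have div: "\<exists>w\<in>gauss_ints. z = of_nat p * w" if "z \<in> gauss_circle m" for z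
  proof -
    obtain a b where ab: "z = Complex (of_int a) (of_int b)" and "a\<^sup>2 + b\<^sup>2 = int m"
      using \<open>z \<in> gauss_circle m\<close> by (rule gauss_circleE)
    then have d: "int p dvd a\<^sup>2 + b\<^sup>2" using m by simp
    have a: "int p dvd a" using prime_dvd_sum_squares_imp_sum_squares[OF p d] no by blast
    have b: "int p dvd b"
      using prime_dvd_sum_squares_imp_sum_squares[OF p, of b a] d no by (auto simp: add.commute)
    from a b obtain c d where "a = int p * c" "b = int p * d" by (auto elim!: dvdE)
    then have "z = of_nat p * Complex (of_int c) (of_int d)" by (simp add: ab complex_eq_iff)
    then show ?thesis using gauss_ints_Complex by blast
  qed
  obtain z where z: "z \<in> gauss_circle m" using ne by blast
  from div[OF z] obtain w where w: "w \<in> gauss_ints" "z = of_nat p * w" by blast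
  obtain c d where cd: "w = Complex (of_int c) (of_int d)" using w(1) by (rule gauss_intsE)
  have "real_of_int ((int p)\<^sup>2 * (c\<^sup>2 + d\<^sup>2)) = real_of_int (int m)"
  proof -
    have "(cmod z)\<^sup>2 = (real p)\<^sup>2 * (cmod w)\<^sup>2" by (simp add: w(2) norm_mult power_mult_distrib)
    moreover have "(cmod w)\<^sup>2 = real_of_int (c\<^sup>2 + d\<^sup>2)" by (simp add: cd cmod_def)
    ultimately show ?thesis using z by (simp add: gauss_circle_def)
  qed
  then have "int m = (int p)\<^sup>2 * (c\<^sup>2 + d\<^sup>2)" by (simp only: of_int_eq_iff)
  then have "int m = int (p\<^sup>2 * nat (c\<^sup>2 + d\<^sup>2))" by simp
  then have mk: "m = p\<^sup>2 * nat (c\<^sup>2 + d\<^sup>2)" by (simp only: of_nat_eq_iff)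
  have "gauss_circle m = (*) (of_nat p) ` gauss_circle (nat (c\<^sup>2 + d\<^sup>2))"
  proof (intro equalityI subsetI)
    fix w assume w: "w \<in> gauss_circle m"
    with div obtain v where v: "v \<in> gauss_ints" "w = of_nat p * v" by blast
    have "(real p)\<^sup>2 * (cmod v)\<^sup>2 = (real p)\<^sup>2 * real (nat (c\<^sup>2 + d\<^sup>2))"
      using w unfolding v mk by (simp add: gauss_circle_def norm_mult power_mult_distrib)
    then have "v \<in> gauss_circle (nat (c\<^sup>2 + d\<^sup>2))" using v p0 by (simp add: gauss_circle_def)
    then show "w \<in> (*) (of_nat p) ` gauss_circle (nat (c\<^sup>2 + d\<^sup>2))" using v by blast
  next
    fix w assume "w \<in> (*) (of_nat p) ` gauss_circle (nat (c\<^sup>2 + d\<^sup>2))"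
    then show "w \<in> gauss_circle m"
      unfolding mk by (auto intro!: gauss_circle_mult)
  qed
  with mk show ?thesis by (rule that)
qed

lemma gauss_products_scale:
  assumes "gauss_circle m = (*) c ` gauss_circle k" "c \<noteq> 0"
  shows "card (gauss_circle m) = card (gauss_circle k)" "card (gauss_products m) = card (gauss_products k)"
proof -
  have "inj_on ((*) c) A" for A using assms(2) by (auto simp: inj_on_def)
  then show "card (gauss_circle m) = card (gauss_circle k)"
    unfolding assms(1) by (rule card_image)
  have "gauss_products m = (*) (c * c) ` gauss_products k"
    unfolding gauss_products_def assms(1) by (force simp: image_iff)
  moreover have "inj_on ((*) (c * c)) A" for A using assms(2) by (auto simp: inj_on_def)
  ultimately show "card (gauss_products m) = card (gauss_products k)"
    using card_image by metis
qed

text \<open>Strong induction on m, stripping one prime divisor. The prime 2 and the primes that are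
  not sums of two squares merely rescale the circle, which changes neither count; every other prime
  is removed with its full power.\<close>

theorem card_gauss_products_le:
  assumes "0 < m"
  shows "card (gauss_products m) ^ 5 \<le> card (gauss_circle m) ^ 8"
  using assms
proof (induction m rule: less_induct)
  case (less m)
  show ?case
  proof (cases "gauss_circle m = {} \<or> m = 1")
    case True
    have "gauss_products 1 \<subseteq> gauss_circle 1"
      using gauss_circle_mult[of _ 1 _ 1] by (auto simp: gauss_products_def gauss_circle_def)
    then have "card (gauss_products 1) \<le> card (gauss_circle 1)" by (intro card_mono) auto
    moreover have "1 \<in> gauss_circle 1" by (simp add: gauss_circle_def)
    then have "1 \<le> card (gauss_circle 1)" by (metis One_nat_def Suc_leI card_gt_0_iff emptyE finite_gauss_circle)
    ultimately have "card (gauss_products 1) ^ 5 \<le> card (gauss_circle 1) ^ 8"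
      using power_mono[of "card (gauss_products 1)" "card (gauss_circle 1)" 5]
        power_increasing[of 5 8 "card (gauss_circle 1)"] by linarith
    then show ?thesis using True by (auto simp: gauss_products_def)
  next
    case False
    then obtain p where p: "prime p" "p dvd m" using prime_factor_nat by blast
    show ?thesis
    proof (cases "\<exists>x y :: int. x\<^sup>2 + y\<^sup>2 = int p")
      case False
      obtain k where k: "m = p\<^sup>2 * k" "gauss_circle m = (*) (of_nat p) ` gauss_circle k"
        using gauss_circle_prime_divisor[OF p less.prems _ False] \<open>\<not> (_ \<or> _)\<close> by metis
      have "1 < p" using p prime_gt_1_nat by blast
      then have "1 < p\<^sup>2" by (intro one_less_power) auto
      then have "k < m" "0 < k" using k(1) less.prems by auto
      with less.IH[of k] gauss_products_scale[OF k(2)] p show ?thesis by auto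
    next
      case True
      then obtain x y :: int where xy: "x\<^sup>2 + y\<^sup>2 = int p" by blast
      show ?thesis
      proof (cases "p = 2")
        case 2: True
        from p(2) obtain k where k: "m = p * k" by (elim dvdE)
        have "gauss_circle m = (*) (Complex (of_int 1) (of_int 1)) ` gauss_circle k"
        proof (intro equalityI subsetI)
          fix w assume "w \<in> gauss_circle m"
          then have "w \<in> gauss_circle (p * k)" by (simp add: k)
          moreover have "(1 :: int)\<^sup>2 + 1\<^sup>2 = int p" using 2 by simp
          ultimately obtain v where v: "v \<in> gauss_circle k" "w = Complex (of_int 1) (of_int 1) * v \<or> w = cnj (Complex (of_int 1) (of_int 1)) * v"
            using gauss_divide_prime[OF p(1), of 1 1 w k] by blast
          \<comment> \<open>Since 1 - i is 1 + i times the unit -i, both alternatives are multiples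
            of 1 + i.\<close>
          have "cnj (Complex (of_int 1) (of_int 1)) * v = Complex (of_int 1) (of_int 1) * (- \<i> * v)"
            by (simp add: complex_eq_iff)
          moreover have "- \<i> * v \<in> gauss_circle k" using v(1) by (simp add: gauss_circle_def gauss_ints_def norm_mult)
          ultimately show "w \<in> (*) (Complex (of_int 1) (of_int 1)) ` gauss_circle k"
            using v by (metis image_eqI)
        next
          fix w assume "w \<in> (*) (Complex (of_int 1) (of_int 1)) ` gauss_circle k"
          moreover have "Complex (of_int 1) (of_int 1) * v \<in> gauss_circle (2 * k)" if "v \<in> gauss_circle k" for v
            using that by (intro gauss_circle_mult gauss_ints_Complex) (auto simp: cmod_def)
          ultimately show "w \<in> gauss_circle m" unfolding k 2 by auto
        qed
        note * = gauss_products_scale[OF this]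
        have "k < m" "0 < k" using k less.prems 2 by auto
        with less.IH[of k] * show ?thesis by (simp add: complex_eq_iff)
      next
        case False
        define e where "e = multiplicity p m"
        obtain k where k: "m = p ^ e * k" "\<not> p dvd k"
          using multiplicity_decompose'[of m p] p(1) less.prems unfolding e_def
          by (metis not_prime_unit less_irrefl)
        have "0 < e" using p less.prems unfolding e_def
          by (metis multiplicity_gt_zero_iff not_prime_unit less_irrefl)
        have "1 < p" using p prime_gt_1_nat by blast
        then have "1 < p ^ e" using \<open>0 < e\<close> by (intro one_less_power) auto
        then have "k < m" "0 < k" using k less.prems by auto
        note IH = less.IH[OF this]
        \<comment> \<open>The exponent 8/5 is dictated by \<open>e = 1\<close>, where 3^5 = 243 only
          just stays below 2^8 = 256. From \<open>e = 3\<close> on,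
          \<open>2 * e + 1 \<le> 2 * (e + 1)\<close> and 32 \<le> 4^3 suffice.\<close>
        have e: "(2 * e + 1) ^ 5 \<le> (e + 1) ^ 8"
        proof (cases "e = 1 \<or> e = 2")
          case True
          then have "2 * e + 1 = 3 \<and> e + 1 = 2 \<or> 2 * e + 1 = 5 \<and> e + 1 = 3" by auto
          then show ?thesis by (elim disjE conjE) (simp_all only:, simp_all)
        next
          case False
          then have "3 \<le> e" using \<open>0 < e\<close> by auto
          have "(2 * e + 1) ^ 5 \<le> (2 * (e + 1)) ^ 5" by (intro power_mono) auto
          also have "\<dots> = 32 * (e + 1) ^ 5" by (simp only: power_mult_distrib) simp
          also have "\<dots> \<le> (e + 1) ^ 3 * (e + 1) ^ 5"
            using power_mono[of 4 "e + 1" 3] \<open>3 \<le> e\<close> by (intro mult_right_mono) auto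
          finally show ?thesis by (simp only: power_add[symmetric]) simp
        qed
        have "card (gauss_products m) ^ 5 \<le> ((2 * e + 1) * card (gauss_products k)) ^ 5"
          unfolding k(1) by (intro power_mono card_gauss_products_prime_power[OF p(1) xy]) auto
        also have "\<dots> \<le> (e + 1) ^ 8 * card (gauss_circle k) ^ 8"
          unfolding power_mult_distrib by (intro mult_mono e IH) auto
        also have "\<dots> = ((e + 1) * card (gauss_circle k)) ^ 8" by (rule power_mult_distrib[symmetric])
        also have "\<dots> \<le> card (gauss_circle m) ^ 8"
          unfolding k(1) by (intro power_mono card_gauss_circle_prime_power[OF p(1) False xy k(2)]) auto
        finally show ?thesis .
      qed
    qed
  qed
qed

section \<open>Density of the exceptional set\<close>

text \<open>The common norm is left free, so all circles are treated at once. With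
  \<open>H = 2 * Y\<close> no pair of distinct points is lost, which serves the second moment; a
  small \<open>H\<close> serves the circles with close points.\<close>

definition close_pairs :: "nat \<Rightarrow> nat \<Rightarrow> ((int \<times> int) \<times> (int \<times> int)) set" where
  "close_pairs Y H = {((a, b), (c, d)). (a, b) \<noteq> (c, d) \<and> a\<^sup>2 + b\<^sup>2 = c\<^sup>2 + d\<^sup>2 \<and>
     \<bar>a\<bar> \<le> int Y \<and> \<bar>b\<bar> \<le> int Y \<and> \<bar>c\<bar> \<le> int Y \<and> \<bar>d\<bar> \<le> int Y \<and> \<bar>c - a\<bar> \<le> int H \<and> \<bar>d - b\<bar> \<le> int H}"

lemma finite_close_pairs [simp]: "finite (close_pairs Y H)"
proof (rule finite_subset)
  show "close_pairs Y H \<subseteq> ({- int Y..int Y} \<times> {- int Y..int Y}) \<times> ({- int Y..int Y} \<times> {- int Y..int Y})"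
    by (auto simp: close_pairs_def)
qed auto

text \<open>If \<open>\<mu>\<close> and \<open>\<nu>\<close> have equal norm then \<open>\<mu> + \<nu>\<close> is orthogonal to \<open>\<nu> - \<mu> = g k\<close>, with \<open>k\<close> primitive,
  hence \<open>\<mu> + \<nu> = l k'\<close> for the rotation \<open>k'\<close> of \<open>k\<close> by a right angle; one counts the triples \<open>(g, k, l)\<close>.\<close>

lemma equal_norm_parametrization:
  fixes a b c d :: int
  assumes ne: "(a, b) \<noteq> (c, d)" and eq: "a\<^sup>2 + b\<^sup>2 = c\<^sup>2 + d\<^sup>2"
  obtains g k1 k2 l where "0 < g" "(k1, k2) \<noteq> (0, 0)" "c - a = g * k1" "d - b = g * k2"
    "a + c = - l * k2" "b + d = l * k1"
proof -
  define g where "g = gcd (c - a) (d - b)"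
  have g: "0 < g" using ne by (auto simp: g_def)
  obtain k1 k2 where k: "c - a = k1 * g" "d - b = k2 * g" "coprime k1 k2"
    using gcd_coprime_exists[of "c - a" "d - b"] g unfolding g_def by (metis less_irrefl)
  obtain s t where st: "s * k1 + t * k2 = 1"
    using bezout_int[of k1 k2] coprime_imp_gcd_eq_1[OF k(3)] by metis
  define l where "l = s * (b + d) - t * (a + c)"
  have "g * (k1 * (a + c) + k2 * (b + d)) = (c - a) * (a + c) + (d - b) * (b + d)"
    unfolding k by (simp add: algebra_simps)
  also have "\<dots> = 0" using eq by (simp add: algebra_simps power2_eq_square)
  finally have o: "k1 * (a + c) = - (k2 * (b + d))" using g by simp
  have "l * k1 = s * k1 * (b + d) - t * (k1 * (a + c))" by (simp add: l_def algebra_simps)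
  also have "\<dots> = (s * k1 + t * k2) * (b + d)" unfolding o by (simp add: algebra_simps)
  finally have 1: "b + d = l * k1" using st by simp
  have "- l * k2 = s * (- (k2 * (b + d))) + t * k2 * (a + c)" by (simp add: l_def algebra_simps)
  also have "\<dots> = (s * k1 + t * k2) * (a + c)" unfolding o[symmetric] by (simp add: algebra_simps)
  finally have 2: "a + c = - l * k2" using st by simp
  have "(k1, k2) \<noteq> (0, 0)" using ne k by auto
  then show ?thesis using that[of g k1 k2 l] g k 1 2 by (simp add: mult.commute)
qed

text \<open>\<open>K n\<close> consists of the vectors \<open>(k1, k2)\<close> of sup norm n, at
  most \<open>12 * n\<close> of them. For each there are at most H/n values of g and 6Y/n of l, the
  hypothesis on \<open>H\<close> absorbing l = 0, so norm n contributes 72 H Y / n. \<open>F\<close>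
  recovers the two points from half the sum and half the difference of \<mu> + \<nu> and \<nu> -
  \<mu>.\<close>

lemma card_close_pairs_le:
  assumes H: "H \<le> 2 * Y"
  shows "real (card (close_pairs Y H)) \<le> 72 * real H * real Y * harm H"
proof -
  define K where "K n = {int n, - int n} \<times> {- int n..int n} \<union> {- int n..int n} \<times> {int n, - int n}" for n :: nat
  define T where "T n = {1..int (H div n)} \<times> K n \<times> {- int (2 * Y div n)..int (2 * Y div n)}" for n :: nat
  define F where "F = (\<lambda>(g :: int, (k1, k2), l). (((- l * k2 - g * k1) div 2, (l * k1 - g * k2) div 2),
      ((- l * k2 + g * k1) div 2, (l * k1 + g * k2) div 2)))"
  have finK: "finite (K n)" for n by (simp add: K_def)
  have cK: "card (K n) \<le> 12 * n" if "1 \<le> n" for n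
  proof -
    have "card (K n) \<le> card ({int n, - int n} \<times> {- int n..int n}) + card ({- int n..int n} \<times> {int n, - int n})"
      unfolding K_def by (rule card_Un_le)
    also have "\<dots> = 2 * (2 * (2 * n + 1))"
      using that by (simp add: card_cartesian_product)
    finally show ?thesis using that by simp
  qed
  have "close_pairs Y H \<subseteq> F ` (\<Union>n\<in>{1..H}. T n)"
  proof
    fix x assume x: "x \<in> close_pairs Y H"
    obtain a b c d where abcd: "x = ((a, b), (c, d))" by (metis surj_pair)
    have bd: "(a, b) \<noteq> (c, d)" "a\<^sup>2 + b\<^sup>2 = c\<^sup>2 + d\<^sup>2" "\<bar>a\<bar> \<le> int Y" "\<bar>b\<bar> \<le> int Y" "\<bar>c\<bar> \<le> int Y" "\<bar>d\<bar> \<le> int Y"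
       "\<bar>c - a\<bar> \<le> int H" "\<bar>d - b\<bar> \<le> int H"
      using x unfolding abcd close_pairs_def by auto
    obtain g k1 k2 l where g: "0 < g" "(k1, k2) \<noteq> (0, 0)" "c - a = g * k1" "d - b = g * k2"
       "a + c = - l * k2" "b + d = l * k1"
      by (rule equal_norm_parametrization[OF bd(1,2)])
    define n where "n = nat (max \<bar>k1\<bar> \<bar>k2\<bar>)"
    have n: "int n = max \<bar>k1\<bar> \<bar>k2\<bar>" by (simp add: n_def)
    have n1: "1 \<le> n" using g(2) by (auto simp: n_def)
    have "g * \<bar>k1\<bar> \<le> int H" "g * \<bar>k2\<bar> \<le> int H" using bd(7,8) g by (simp_all add: abs_mult)
    then have gH: "g * int n \<le> int H" unfolding n by (simp add: max_def)
    have "\<bar>l\<bar> * \<bar>k1\<bar> \<le> int (2 * Y)" "\<bar>l\<bar> * \<bar>k2\<bar> \<le> int (2 * Y)"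
      using bd(3-6) g(5,6) by (simp_all add: abs_mult[symmetric])
    then have lY: "\<bar>l\<bar> * int n \<le> int (2 * Y)" unfolding n by (simp add: max_def)
    have "int n * 1 \<le> int n * g" using g(1) by (intro mult_left_mono) auto
    then have nH: "n \<le> H" using gH by (simp add: mult.commute)
    have "g \<le> int H div int n"
      using zdiv_mono1[OF gH, of "int n"] n1 by simp
    moreover have "\<bar>l\<bar> \<le> int (2 * Y) div int n"
      using zdiv_mono1[OF lY, of "int n"] n1 by simp
    moreover have "(k1, k2) \<in> K n" using n by (auto simp: K_def max_def abs_if split: if_splits)
    ultimately have "(g, (k1, k2), l) \<in> T n" using g(1) by (auto simp: T_def zdiv_int)
    moreover have "F (g, (k1, k2), l) = x"
    proof -
      have "- l * k2 - g * k1 = a * 2" "l * k1 - g * k2 = b * 2" "- l * k2 + g * k1 = c * 2" "l * k1 + g * k2 = d * 2"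
        using g(3-6) by linarith+
      then show ?thesis by (simp add: F_def abcd)
    qed
    ultimately show "x \<in> F ` (\<Union>n\<in>{1..H}. T n)" using n1 nH by (force simp: image_iff)
  qed
  then have "card (close_pairs Y H) \<le> card (F ` (\<Union>n\<in>{1..H}. T n))"
    by (intro card_mono finite_imageI finite_UN_I) (auto simp: T_def finK)
  also have "\<dots> \<le> card (\<Union>n\<in>{1..H}. T n)"
    by (intro card_image_le finite_UN_I) (auto simp: T_def finK)
  also have "\<dots> \<le> (\<Sum>n\<in>{1..H}. card (T n))" by (intro card_UN_le) auto
  finally have "real (card (close_pairs Y H)) \<le> (\<Sum>n\<in>{1..H}. real (card (T n)))"
    by (metis of_nat_le_iff of_nat_sum)
  also have "\<dots> \<le> (\<Sum>n\<in>{1..H}. 72 * real H * real Y * inverse (real n))"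
  proof (intro sum_mono)
    fix n assume n: "n \<in> {1..H}"
    have nr: "0 < real n" "real n \<le> 2 * real Y" using n H by auto
    have "real (card (T n)) = real (H div n) * (real (card (K n)) * (2 * real (2 * Y div n) + 1))"
      by (simp add: T_def card_cartesian_product)
    also have "\<dots> \<le> (real H / real n) * (12 * real n * (6 * real Y / real n))"
    proof (intro mult_mono)
      show "real (H div n) \<le> real H / real n" by (rule of_nat_div_le_of_nat)
      show "real (card (K n)) \<le> 12 * real n" using cK[of n] n by (simp flip: of_nat_mult)
      have "real (2 * Y div n) \<le> real (2 * Y) / real n" by (rule of_nat_div_le_of_nat)
      moreover have "1 \<le> 2 * real Y / real n" using nr by simp
      ultimately have "2 * real (2 * Y div n) + 1 \<le> 2 * (real (2 * Y) / real n) + 2 * real Y / real n" by linarith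
      also have "\<dots> = 6 * real Y / real n" by (simp add: field_simps)
      finally show "2 * real (2 * Y div n) + 1 \<le> 6 * real Y / real n" .
    qed auto
    also have "\<dots> = 72 * real H * real Y * inverse (real n)" using nr by (simp add: field_simps)
    finally show "real (card (T n)) \<le> 72 * real H * real Y * inverse (real n)" .
  qed
  also have "\<dots> = 72 * real H * real Y * harm H"
    by (simp add: harm_def sum_distrib_left)
  finally show ?thesis .
qed

lemma harm_le: "0 < n \<Longrightarrow> harm n \<le> 1 + ln (real n)"
proof (induction n)
  case (Suc n)
  show ?case
  proof (cases "n = 0")
    case False
    then have "harm n \<le> 1 + ln (real n)" using Suc by simp
    moreover have "inverse (real (Suc n)) \<le> ln (real (Suc n)) - ln (real n)"
    proof -
      have "ln (real n / real (Suc n)) \<le> real n / real (Suc n) - 1"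
        using False by (intro ln_le_minus_one) auto
      also have "real n / real (Suc n) - 1 = - inverse (real (Suc n))" by (simp add: field_simps)
      finally show ?thesis using False by (simp add: ln_div)
    qed
    ultimately show ?thesis by (simp add: harm_Suc)
  qed (simp add: harm_def)
qed simp

section \<open>Moments of the number of lattice points on a circle\<close>

lemma abs_le_floor_sqrt:
  fixes a b :: int
  assumes "a\<^sup>2 + b\<^sup>2 = int m" "m \<le> X"
  shows "\<bar>a\<bar> \<le> int (floor_sqrt X)" "\<bar>b\<bar> \<le> int (floor_sqrt X)"
proof -
  have *: "\<bar>c\<bar> \<le> int (floor_sqrt X)" if "c\<^sup>2 \<le> int X" for c :: int
  proof -
    have "int ((nat \<bar>c\<bar>)\<^sup>2) \<le> int X" using that by simp
    then have "(nat \<bar>c\<bar>)\<^sup>2 \<le> X" by (simp only: of_nat_le_iff)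
    then have "nat \<bar>c\<bar> \<le> floor_sqrt X" by (simp add: le_floor_sqrt_iff)
    then show ?thesis by linarith
  qed
  have "a\<^sup>2 \<le> int X" "b\<^sup>2 \<le> int X"
    using assms zero_le_power2[of a] zero_le_power2[of b] by linarith+
  then show "\<bar>a\<bar> \<le> int (floor_sqrt X)" "\<bar>b\<bar> \<le> int (floor_sqrt X)" using * by auto
qed

lemma lattice_pts_subset:
  assumes "m \<le> X"
  shows "lattice_pts m \<subseteq> {- int (floor_sqrt X)..int (floor_sqrt X)} \<times> {- int (floor_sqrt X)..int (floor_sqrt X)}"
proof
  fix \<mu> assume "\<mu> \<in> lattice_pts m"
  then obtain a b where ab: "\<mu> = (a, b)" "a\<^sup>2 + b\<^sup>2 = int m" by (auto simp: lattice_pts_def)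
  from abs_le_floor_sqrt[OF ab(2) assms]
  show "\<mu> \<in> {- int (floor_sqrt X)..int (floor_sqrt X)} \<times> {- int (floor_sqrt X)..int (floor_sqrt X)}"
    by (auto simp: ab)
qed

lemma finite_lattice_pts [simp]: "finite (lattice_pts m)"
  by (rule finite_subset[OF lattice_pts_subset[OF order_refl]]) auto

lemma lattice_pts_disjoint: "m \<noteq> m' \<Longrightarrow> lattice_pts m \<inter> lattice_pts m' = {}"
  by (auto simp: lattice_pts_def)

lemma sums_two_sq_iff: "m \<in> sums_two_sq \<longleftrightarrow> 0 < m \<and> lattice_pts m \<noteq> {}"
  by (auto simp: sums_two_sq_def lattice_pts_def)

lemma sum_card_lattice_pts_le:
  assumes "finite A" "A \<subseteq> {..X}"
  shows "(\<Sum>m\<in>A. card (lattice_pts m)) \<le> (2 * floor_sqrt X + 1)\<^sup>2"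
proof -
  let ?B = "{- int (floor_sqrt X)..int (floor_sqrt X)}"
  have "(\<Sum>m\<in>A. card (lattice_pts m)) = card (\<Union>m\<in>A. lattice_pts m)"
    using assms lattice_pts_disjoint by (intro card_UN_disjoint[symmetric]) auto
  also have "\<dots> \<le> card (?B \<times> ?B)"
    using assms lattice_pts_subset by (intro card_mono) blast+
  also have "\<dots> = (2 * floor_sqrt X + 1)\<^sup>2"
  proof -
    have "card ?B = 2 * floor_sqrt X + 1" by (simp add: nat_eq_iff)
    then show ?thesis by (simp add: card_cartesian_product power2_eq_square)
  qed
  finally show ?thesis .
qed

text \<open>The box \<open>[0, s]\<close> squared, \<open>s\<close> the integer root of
  \<open>X div 2\<close>, lies in the disc of squared radius X. The origin is removed because
  \<open>sums_two_sq\<close> omits 0, and (s + 1)^2 - 1 points remain.\<close>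

lemma sum_card_lattice_pts_ge:
  "X div 2 \<le> (\<Sum>m\<in>sums_two_sq \<inter> {..X}. card (lattice_pts m))"
proof -
  define s where "s = floor_sqrt (X div 2)"
  let ?B = "{0..int s} \<times> {0..int s} - {(0, 0)}"
  have s: "s * s \<le> X div 2" "X div 2 < Suc s * Suc s"
    using floor_sqrt_power2_le[of "X div 2"] Suc_floor_sqrt_power2_gt[of "X div 2"]
    by (simp_all add: s_def power2_eq_square)
  have "?B \<subseteq> (\<Union>m\<in>sums_two_sq \<inter> {..X}. lattice_pts m)"
  proof
    fix \<mu> assume "\<mu> \<in> ?B"
    then obtain a b where ab: "\<mu> = (a, b)" "0 \<le> a" "a \<le> int s" "0 \<le> b" "b \<le> int s" "a \<noteq> 0 \<or> b \<noteq> 0"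
      by (cases \<mu>) force
    define m where "m = nat (a\<^sup>2 + b\<^sup>2)"
    have m: "a\<^sup>2 + b\<^sup>2 = int m" by (simp add: m_def)
    have "0 < a\<^sup>2 + b\<^sup>2" using ab by (simp add: sum_power2_gt_zero_iff)
    then have "0 < m" using m by simp
    have "a\<^sup>2 \<le> int s * int s" "b\<^sup>2 \<le> int s * int s"
      using ab by (simp_all add: power2_eq_square mult_mono)
    moreover have "2 * (s * s) \<le> X" using s by simp
    then have "2 * (int s * int s) \<le> int X" by (metis of_nat_le_iff of_nat_mult of_nat_numeral)
    ultimately have "int m \<le> int X" unfolding m[symmetric] by linarith
    then have "m \<le> X" by simp
    moreover have "\<mu> \<in> lattice_pts m" using ab m by (simp add: lattice_pts_def)
    ultimately show "\<mu> \<in> (\<Union>m\<in>sums_two_sq \<inter> {..X}. lattice_pts m)"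
      using \<open>0 < m\<close> sums_two_sq_iff[of m] by blast
  qed
  then have "card ?B \<le> card (\<Union>m\<in>sums_two_sq \<inter> {..X}. lattice_pts m)"
    by (intro card_mono) auto
  also have "\<dots> \<le> (\<Sum>m\<in>sums_two_sq \<inter> {..X}. card (lattice_pts m))" by (intro card_UN_le) auto
  also have "card ?B = Suc s * Suc s - 1" by (simp add: card_cartesian_product nat_add_distrib)
  finally show ?thesis using s by linarith
qed

text \<open>The square counts pairs on a circle: the equal ones give the first moment, and the
  distinct ones, over all circles together, are pairs in \<open>close_pairs\<close> with
  \<open>H = 2 * Y\<close>. The result is of order X ln X.\<close>

lemma sum_card_lattice_pts_squared_le:
  defines "Y \<equiv> \<lambda>X. floor_sqrt X"
  shows "real (\<Sum>m\<in>sums_two_sq \<inter> {..X}. (card (lattice_pts m))\<^sup>2)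
     \<le> (2 * real (Y X) + 1)\<^sup>2 + 144 * (real (Y X))\<^sup>2 * harm (2 * Y X)"
proof -
  let ?A = "sums_two_sq \<inter> {..X}"
  define D where "D = (\<Union>m\<in>?A. {(\<mu>, \<nu>) \<in> lattice_pts m \<times> lattice_pts m. \<mu> \<noteq> \<nu>})"
  have sq: "(card (lattice_pts m))\<^sup>2 = card (lattice_pts m) + card {(\<mu>, \<nu>) \<in> lattice_pts m \<times> lattice_pts m. \<mu> \<noteq> \<nu>}" for m
  proof -
    let ?D = "{(\<mu>, \<nu>) \<in> lattice_pts m \<times> lattice_pts m. \<mu> \<noteq> \<nu>}"
    have "finite ?D" by (rule finite_subset[of _ "lattice_pts m \<times> lattice_pts m"]) auto
    then have "card ((\<lambda>\<mu>. (\<mu>, \<mu>)) ` lattice_pts m \<union> ?D) = card ((\<lambda>\<mu>. (\<mu>, \<mu>)) ` lattice_pts m) + card ?D"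
      by (intro card_Un_disjoint) auto
    moreover have "(\<lambda>\<mu>. (\<mu>, \<mu>)) ` lattice_pts m \<union> ?D = lattice_pts m \<times> lattice_pts m" by auto
    ultimately show ?thesis by (simp add: card_cartesian_product power2_eq_square card_image inj_on_def)
  qed
  have "(\<Sum>m\<in>?A. card {(\<mu>, \<nu>) \<in> lattice_pts m \<times> lattice_pts m. \<mu> \<noteq> \<nu>}) = card D"
    unfolding D_def
  proof (intro card_UN_disjoint[symmetric] ballI impI)
    fix i j :: nat assume "i \<noteq> j"
    from lattice_pts_disjoint[OF this]
    show "{(\<mu>, \<nu>) \<in> lattice_pts i \<times> lattice_pts i. \<mu> \<noteq> \<nu>} \<inter> {(\<mu>, \<nu>) \<in> lattice_pts j \<times> lattice_pts j. \<mu> \<noteq> \<nu>} = {}"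
      by auto
  next
    show "finite {(\<mu>, \<nu>) \<in> lattice_pts i \<times> lattice_pts i. \<mu> \<noteq> \<nu>}" for i
      by (auto intro: finite_subset[of _ "lattice_pts i \<times> lattice_pts i"])
  qed auto
  also have "card D \<le> card (close_pairs (Y X) (2 * Y X))"
  proof (intro card_mono finite_close_pairs subsetI)
    fix x assume "x \<in> D"
    moreover obtain a b c d where abcd: "x = ((a, b), (c, d))" by (metis surj_pair)
    ultimately obtain m where x: "x = ((a, b), (c, d))" "(a, b) \<in> lattice_pts m" "(c, d) \<in> lattice_pts m"
      "(a, b) \<noteq> (c, d)" "m \<le> X" unfolding D_def by blast
    then have eq: "a\<^sup>2 + b\<^sup>2 = int m" "c\<^sup>2 + d\<^sup>2 = int m" by (auto simp: lattice_pts_def)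
    from abs_le_floor_sqrt[OF eq(1) x(5)] abs_le_floor_sqrt[OF eq(2) x(5)]
    show "x \<in> close_pairs (Y X) (2 * Y X)" using x(4) eq
      by (auto simp: x(1) close_pairs_def Y_def)
  qed
  finally have "real (\<Sum>m\<in>?A. card {(\<mu>, \<nu>) \<in> lattice_pts m \<times> lattice_pts m. \<mu> \<noteq> \<nu>}) \<le> 72 * real (2 * Y X) * real (Y X) * harm (2 * Y X)"
    using card_close_pairs_le[of "2 * Y X" "Y X"] by linarith
  moreover have "real (\<Sum>m\<in>?A. card (lattice_pts m)) \<le> real ((2 * Y X + 1)\<^sup>2)"
    unfolding Y_def using sum_card_lattice_pts_le[of ?A X] by (simp only: of_nat_le_iff) auto
  ultimately show ?thesis unfolding sq sum.distrib of_nat_add by (simp add: power2_eq_square algebra_simps)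
qed

lemma floor_sqrt_le_sqrt: "real (floor_sqrt X) \<le> sqrt (real X)"
  by (rule real_le_rsqrt) (metis floor_sqrt_power2_le of_nat_le_iff of_nat_power)

text \<open>Cauchy-Schwarz between the first moment, of order X, and the second, of order X ln X.
  This falls short of the true order by a factor sqrt(ln X), which the logarithmic saving in the
  exceptional set outweighs.\<close>

theorem card_sums_two_sq_ge:
  assumes "4 \<le> X"
  shows "real X / (9 * (297 + 144 * ln (real X))) \<le> real (card (sums_two_sq \<inter> {..X}))"
proof -
  let ?A = "sums_two_sq \<inter> {..X}" and ?Y = "floor_sqrt X" and ?N = "\<lambda>m. real (card (lattice_pts m))"
  have Y: "0 < ?Y" "real ?Y \<le> sqrt X" "(real ?Y)\<^sup>2 \<le> real X"
  proof -
    show "0 < ?Y" using assms by simp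
    show "real ?Y \<le> sqrt X" by (rule floor_sqrt_le_sqrt)
    show "(real ?Y)\<^sup>2 \<le> real X"
      using floor_sqrt_power2_le[of X] by (metis of_nat_le_iff of_nat_power)
  qed
  have "harm (2 * ?Y) \<le> 1 + ln (real (2 * ?Y))" using Y by (intro harm_le) auto
  also have "ln (real (2 * ?Y)) \<le> ln (2 * sqrt X)" using Y by (intro ln_mono) auto
  also have "\<dots> = ln 2 + ln X / 2" using assms by (simp add: ln_mult ln_sqrt)
  also have "ln 2 + ln (real X) / 2 \<le> 1 + ln X"
  proof -
    have "0 \<le> ln (real X)" using assms by simp
    then show ?thesis using ln_le_minus_one[of 2] by simp
  qed
  finally have h: "harm (2 * ?Y) \<le> 2 + ln X" by simp
  have "(2 * real ?Y + 1)\<^sup>2 \<le> (3 * real ?Y)\<^sup>2" using Y by (intro power_mono) (auto simp: Suc_le_eq)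
  also have "\<dots> \<le> 9 * real X" using Y by (simp add: power_mult_distrib)
  finally have 1: "(2 * real ?Y + 1)\<^sup>2 \<le> 9 * real X" .
  have "144 * (real ?Y)\<^sup>2 * harm (2 * ?Y) \<le> 144 * real X * (2 + ln X)"
    using Y h assms by (intro mult_mono) (auto intro: sum_nonneg simp: harm_def)
  with 1 sum_card_lattice_pts_squared_le[of X]
  have S2: "(\<Sum>m\<in>?A. (?N m)\<^sup>2) \<le> real X * (297 + 144 * ln X)" by (simp add: algebra_simps)
  have "real X / 3 \<le> real (X div 2)" using assms by linarith
  also have "\<dots> \<le> (\<Sum>m\<in>?A. 1 * ?N m)"
    using sum_card_lattice_pts_ge[of X] by (simp flip: of_nat_sum)
  finally have "(real X / 3)\<^sup>2 \<le> (\<Sum>m\<in>?A. 1 * ?N m)\<^sup>2" by (intro power_mono) auto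
  also have "\<dots> \<le> (\<Sum>m\<in>?A. 1\<^sup>2) * (\<Sum>m\<in>?A. (?N m)\<^sup>2)" by (rule Cauchy_Schwarz_ineq_sum)
  also have "\<dots> \<le> real (card ?A) * (real X * (297 + 144 * ln X))"
    using S2 by (simp add: mult_left_mono)
  finally have "real X * (real X / 9) \<le> real X * (real (card ?A) * (297 + 144 * ln X))"
    by (simp add: power2_eq_square algebra_simps)
  then have "real X / 9 \<le> real (card ?A) * (297 + 144 * ln X)"
    by (rule mult_left_le_imp_le) (use assms in simp)
  moreover have "0 \<le> ln (real X)" using assms by simp
  then have "0 < 297 + 144 * ln (real X)" by linarith
  moreover have "x / (9 * l) \<le> c" if "x / 9 \<le> c * l" "0 < l" for x c l :: real
    using that by (simp add: field_simps)
  ultimately show ?thesis by blast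
qed

section \<open>The exceptional set and its density\<close>

definition has_close_points :: "nat \<Rightarrow> bool" where
  "has_close_points m \<longleftrightarrow> (\<exists>\<mu>\<in>lattice_pts m. \<exists>\<nu>\<in>lattice_pts m. \<mu> \<noteq> \<nu> \<and>
     real_of_int ((fst \<mu> - fst \<nu>)\<^sup>2 + (snd \<mu> - snd \<nu>)\<^sup>2) * ln (real m) ^ 5 < real m)"

text \<open>\<open>m0\<close> discards the finitely many m too small for the inequalities required
  by a given curve; the set thus depends on the curve but on no eigenfunction.\<close>

definition exceptional :: "nat \<Rightarrow> nat set" where
  "exceptional m0 = {m \<in> sums_two_sq. m < m0 \<or> real (card (lattice_pts m)) > real m powr (1 / 200) \<or>
     has_close_points m}"

text \<open>Markov's inequality against the total of at most \<open>9 * n\<close> lattice points.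
  Restricting to m above \<open>floor_sqrt n\<close> makes the threshold at least
  \<open>n powr (1 / 400)\<close> throughout.\<close>

lemma card_many_lattice_pts_le:
  assumes "1 \<le> n"
  shows "real (card {m \<in> sums_two_sq. floor_sqrt n < m \<and> m \<le> n \<and> real m powr (1 / 200) < real (card (lattice_pts m))})
    \<le> 9 * real n / real n powr (1 / 400)"
proof -
  define B where "B = {m \<in> sums_two_sq. floor_sqrt n < m \<and> m \<le> n \<and> real m powr (1 / 200) < real (card (lattice_pts m))}"
  have B: "finite B" "B \<subseteq> {..n}" by (auto simp: B_def intro: finite_subset[of _ "{..n}"])
  have "real n powr (1 / 400) \<le> real (card (lattice_pts m))" if "m \<in> B" for m
  proof -
    have "Suc (floor_sqrt n) \<le> m" using that by (simp add: B_def)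
    then have "(Suc (floor_sqrt n))\<^sup>2 \<le> m\<^sup>2" by (intro power_mono) auto
    then have "n \<le> m\<^sup>2" using Suc_floor_sqrt_power2_gt[of n] by linarith
    then have "real n powr (1 / 400) \<le> real (m\<^sup>2) powr (1 / 400)" by (intro powr_mono2) simp_all
    also have "\<dots> = real m powr (1 / 200)"
      by (cases "m = 0") (simp_all add: powr_powr flip: powr_numeral)
    finally show ?thesis using that by (simp add: B_def)
  qed
  then have "real (card B) * real n powr (1 / 400) \<le> (\<Sum>m\<in>B. real (card (lattice_pts m)))"
    using sum_mono[of B "\<lambda>_. real n powr (1 / 400)"] by simp
  also have "\<dots> \<le> real ((2 * floor_sqrt n + 1)\<^sup>2)"
    using sum_card_lattice_pts_le[OF B] by (metis of_nat_le_iff of_nat_sum)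
  also have "\<dots> \<le> real ((3 * floor_sqrt n)\<^sup>2)"
    using assms unfolding of_nat_le_iff by (intro power_mono) (auto simp: Suc_le_eq)
  also have "\<dots> \<le> real (9 * n)"
    unfolding of_nat_le_iff using floor_sqrt_power2_le[of n] by (simp only: power_mult_distrib) simp
  finally show ?thesis using assms unfolding B_def[symmetric] by (simp add: field_simps)
qed

text \<open>Each such m is charged to a close pair on its own circle, and disjoint circles have
  different pairs. For m above \<open>floor_sqrt n\<close> one has
  \<open>ln n / 2 \<le> ln m\<close>, which produces 32 = 2^5 in \<open>u\<close>; \<open>uY\<close>
  guarantees \<open>H \<le> 2 * Y\<close> for \<open>H\<close> the ceiling of
  \<open>u\<close>.\<close>

lemma card_close_lattice_pts_le:
  fixes n :: nat and u :: real
  assumes n: "4 \<le> n" and u: "u = sqrt (32 * real n / ln (real n) ^ 5)" and uY: "u + 1 \<le> 2 * (sqrt (real n) - 1)"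
  shows "real (card {m \<in> sums_two_sq. floor_sqrt n < m \<and> m \<le> n \<and> has_close_points m})
    \<le> 72 * (u + 1) * sqrt (real n) * (1 + ln (2 * sqrt (real n)))"
proof -
  define B where "B = {m \<in> sums_two_sq. floor_sqrt n < m \<and> m \<le> n \<and> has_close_points m}"
  define H where "H = nat \<lceil>u\<rceil>"
  define Y where "Y = floor_sqrt n"
  have ln0: "0 < ln (real n)" using n by simp
  then have u0: "0 < u" using n by (simp add: u)
  have H: "u \<le> real H" "real H \<le> u + 1" "0 < H" using u0 by (simp_all add: H_def)
  have Y: "real Y \<le> sqrt n" "sqrt n - 1 \<le> real Y"
  proof -
    show "real Y \<le> sqrt n" unfolding Y_def by (rule floor_sqrt_le_sqrt)
    have "real n \<le> (real (Suc Y))\<^sup>2" using Suc_floor_sqrt_power2_gt[of n]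
      by (metis Y_def less_imp_le of_nat_le_iff of_nat_power)
    then have "sqrt n \<le> real (Suc Y)" by (intro real_le_lsqrt) auto
    then show "sqrt n - 1 \<le> real Y" by simp
  qed
  have "\<forall>m\<in>B. \<exists>\<mu> \<nu>. (\<mu>, \<nu>) \<in> close_pairs Y H \<and> \<mu> \<in> lattice_pts m"
  proof
    fix m assume m: "m \<in> B"
    then obtain a b c d where abcd: "(a, b) \<in> lattice_pts m" "(c, d) \<in> lattice_pts m" "(a, b) \<noteq> (c, d)"
      "real_of_int ((a - c)\<^sup>2 + (b - d)\<^sup>2) * ln (real m) ^ 5 < real m" "m \<le> n" "Y < m"
      unfolding B_def Y_def has_close_points_def by fastforce
    have "Suc Y \<le> m" using abcd by simp
    then have "(Suc Y)\<^sup>2 \<le> m\<^sup>2" by (intro power_mono) auto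
    then have "n \<le> m\<^sup>2" using Suc_floor_sqrt_power2_gt[of n] unfolding Y_def by linarith
    then have "ln (real n) \<le> ln (real (m\<^sup>2))" using n by (intro ln_mono) auto
    also have "\<dots> = 2 * ln (real m)" using abcd by (simp add: ln_realpow)
    finally have "ln (real n) / 2 \<le> ln (real m)" by simp
    then have "(ln (real n) / 2) ^ 5 \<le> ln (real m) ^ 5" using ln0 by (intro power_mono) auto
    then have "real_of_int ((a - c)\<^sup>2 + (b - d)\<^sup>2) * (ln (real n) / 2) ^ 5 \<le> real_of_int ((a - c)\<^sup>2 + (b - d)\<^sup>2) * ln (real m) ^ 5"
      by (intro mult_left_mono) auto
    also have "\<dots> < real n" using abcd by linarith
    finally have "real_of_int ((a - c)\<^sup>2 + (b - d)\<^sup>2) \<le> 32 * real n / ln (real n) ^ 5"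
      using ln0 by (simp add: power_divide field_simps)
    then have le: "(real_of_int (a - c))\<^sup>2 \<le> 32 * real n / ln (real n) ^ 5" "(real_of_int (b - d))\<^sup>2 \<le> 32 * real n / ln (real n) ^ 5"
      using zero_le_power2[of "real_of_int (a - c)"] zero_le_power2[of "real_of_int (b - d)"]
      by (simp_all only: of_int_add of_int_power)
    have "\<bar>real_of_int (a - c)\<bar> \<le> u" "\<bar>real_of_int (b - d)\<bar> \<le> u"
      unfolding u using le by (auto intro!: real_le_rsqrt simp: power2_abs)
    then have "real_of_int \<bar>a - c\<bar> \<le> real_of_int (int H)" "real_of_int \<bar>b - d\<bar> \<le> real_of_int (int H)"
      using H by simp_all
    then have h: "\<bar>a - c\<bar> \<le> int H" "\<bar>b - d\<bar> \<le> int H" by (simp_all only: of_int_le_iff)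
    have eq: "a\<^sup>2 + b\<^sup>2 = int m" "c\<^sup>2 + d\<^sup>2 = int m" using abcd by (auto simp: lattice_pts_def)
    from abs_le_floor_sqrt[OF eq(1) abcd(5)] abs_le_floor_sqrt[OF eq(2) abcd(5)] h
    have "((a, b), (c, d)) \<in> close_pairs Y H" using abcd(3) eq
      by (auto simp: close_pairs_def Y_def abs_minus_commute)
    then show "\<exists>\<mu> \<nu>. (\<mu>, \<nu>) \<in> close_pairs Y H \<and> \<mu> \<in> lattice_pts m" using abcd(1) by blast
  qed
  then obtain f g where fg: "\<And>m. m \<in> B \<Longrightarrow> (f m, g m) \<in> close_pairs Y H" "\<And>m. m \<in> B \<Longrightarrow> f m \<in> lattice_pts m"
    by metis
  have "inj_on (\<lambda>m. (f m, g m)) B"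
  proof (rule inj_onI)
    fix m m' assume "m \<in> B" "m' \<in> B" "(f m, g m) = (f m', g m')"
    then have "f m \<in> lattice_pts m \<inter> lattice_pts m'" using fg(2)[of m] fg(2)[of m'] by simp
    then show "m = m'" using lattice_pts_disjoint by blast
  qed
  then have "card B \<le> card (close_pairs Y H)"
    by (rule card_inj_on_le) (use fg in auto)
  also have "real (card (close_pairs Y H)) \<le> 72 * real H * real Y * harm H"
  proof (rule card_close_pairs_le)
    have "real H \<le> real (2 * Y)" using uY H Y by simp
    then show "H \<le> 2 * Y" by (simp only: of_nat_le_iff)
  qed
  finally have "real (card B) \<le> 72 * real H * real Y * harm H" by simp
  also have "\<dots> \<le> 72 * (u + 1) * sqrt n * (1 + ln (2 * sqrt n))"
  proof (intro mult_mono)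
    have "harm H \<le> 1 + ln (real H)" by (rule harm_le[OF H(3)])
    also have "ln (real H) \<le> ln (2 * sqrt n)" using H uY by (intro ln_mono) auto
    finally show "harm H \<le> 1 + ln (2 * sqrt n)" by simp
  qed (use H Y u0 n in \<open>auto simp: harm_def intro!: sum_nonneg\<close>)
  finally show ?thesis by (simp add: B_def)
qed

theorem rel_density_zero_exceptional:
  "rel_density_zero (exceptional m0) sums_two_sq"
proof -
  define u where "u n = sqrt (32 * real n / ln (real n) ^ 5)" for n :: nat
  define f where "f n = (real m0 + (sqrt (real n) + 1) + 9 * real n / real n powr (1 / 400)
       + 72 * (u n + 1) * sqrt (real n) * (1 + ln (2 * sqrt (real n))))
       / (real n / (9 * (297 + 144 * ln (real n))))" for n :: nat
  have lim: "f \<longlonglongrightarrow> 0" unfolding f_def u_def by real_asymp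
  have "\<forall>\<^sub>F n :: nat in sequentially. u n + 1 \<le> 2 * (sqrt (real n) - 1)"
    unfolding u_def by real_asymp
  then have "\<forall>\<^sub>F n in sequentially. norm (real (card (exceptional m0 \<inter> sums_two_sq \<inter> {..n})) / real (card (sums_two_sq \<inter> {..n}))) \<le> f n"
    using eventually_ge_at_top[of 4]
  proof eventually_elim
    case (elim n)
    define B2 where "B2 = {m \<in> sums_two_sq. floor_sqrt n < m \<and> m \<le> n \<and> real m powr (1 / 200) < real (card (lattice_pts m))}"
    define B3 where "B3 = {m \<in> sums_two_sq. floor_sqrt n < m \<and> m \<le> n \<and> has_close_points m}"
    have fin: "finite B2" "finite B3" by (auto simp: B2_def B3_def intro: finite_subset[of _ "{..n}"])
    have "exceptional m0 \<inter> sums_two_sq \<inter> {..n} \<subseteq> {..<m0} \<union> {..floor_sqrt n} \<union> B2 \<union> B3"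
    proof
      fix m assume "m \<in> exceptional m0 \<inter> sums_two_sq \<inter> {..n}"
      then show "m \<in> {..<m0} \<union> {..floor_sqrt n} \<union> B2 \<union> B3"
        unfolding exceptional_def B2_def B3_def by (cases "m \<le> floor_sqrt n") (simp, simp only: not_le mem_Collect_eq Int_iff Un_iff atMost_iff lessThan_iff, blast)
    qed
    then have "card (exceptional m0 \<inter> sums_two_sq \<inter> {..n}) \<le> card ({..<m0} \<union> {..floor_sqrt n} \<union> B2 \<union> B3)"
      using fin by (intro card_mono) auto
    also have "\<dots> \<le> card {..<m0} + card {..floor_sqrt n} + card B2 + card B3"
      by (meson add_mono card_Un_le le_refl order_trans)
    finally have "real (card (exceptional m0 \<inter> sums_two_sq \<inter> {..n})) \<le> real m0 + (real (floor_sqrt n) + 1) + real (card B2) + real (card B3)"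
      by simp
    also have "\<dots> \<le> real m0 + (sqrt (real n) + 1) + 9 * real n / real n powr (1 / 400)
       + 72 * (u n + 1) * sqrt (real n) * (1 + ln (2 * sqrt (real n)))"
      using card_many_lattice_pts_le[of n] card_close_lattice_pts_le[OF elim(2) u_def elim(1)] elim(2) floor_sqrt_le_sqrt[of n]
      unfolding B2_def B3_def by (intro add_mono) auto
    finally have 1: "real (card (exceptional m0 \<inter> sums_two_sq \<inter> {..n})) \<le> \<dots>" .
    have "0 \<le> ln (real n)" using elim by simp
    then have 2: "0 < real n / (9 * (297 + 144 * ln (real n)))" using elim by (intro divide_pos_pos mult_pos_pos add_pos_nonneg) auto
    have "norm (real (card (exceptional m0 \<inter> sums_two_sq \<inter> {..n})) / real (card (sums_two_sq \<inter> {..n})))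
      = real (card (exceptional m0 \<inter> sums_two_sq \<inter> {..n})) / real (card (sums_two_sq \<inter> {..n}))" by simp
    also have "\<dots> \<le> f n"
      unfolding f_def using card_sums_two_sq_ge[OF elim(2)] 1 2 by (intro frac_le) auto
    finally show ?case .
  qed
  then show ?thesis unfolding rel_density_zero_def by (rule Lim_null_comparison) (rule lim)
qed

section \<open>Tangent directions of an analytic curve\<close>

lemma open_nbhd01: "open (nbhd01 \<epsilon>)"
proof -
  have "nbhd01 \<epsilon> = (\<Union>t\<in>{0..1}. ball (complex_of_real t) \<epsilon>)"
  proof (intro equalityI subsetI)
    fix z assume "z \<in> (\<Union>t\<in>{0..1}. ball (complex_of_real t) \<epsilon>)"
    then obtain t where "t \<in> {0..1}" "norm (z - of_real t) < \<epsilon>" by (auto simp: dist_norm norm_minus_commute)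
    then show "z \<in> nbhd01 \<epsilon>" unfolding nbhd01_def
      by (auto intro!: exI[of _ t] exI[of _ "z - of_real t"])
  next
    fix z assume "z \<in> nbhd01 \<epsilon>"
    then obtain t w where "z = of_real t + w" "t \<in> {0..1}" "norm w < \<epsilon>" by (auto simp: nbhd01_def)
    then show "z \<in> (\<Union>t\<in>{0..1}. ball (complex_of_real t) \<epsilon>)" by (intro UN_I[of t]) (auto simp: dist_norm)
  qed
  then show ?thesis by auto
qed

lemma nbhd01I: "t \<in> {0..1} \<Longrightarrow> norm (z - of_real t) < \<epsilon> \<Longrightarrow> z \<in> nbhd01 \<epsilon>"
  unfolding nbhd01_def by (auto intro!: exI[of _ t] exI[of _ "z - of_real t"])

lemma continuous_on_cthickening_bound:
  fixes f :: "complex \<Rightarrow> complex"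
  assumes "0 < \<epsilon>" "continuous_on (nbhd01 \<epsilon>) f"
  obtains M where "0 < M" "\<And>t w. t \<in> {0..1} \<Longrightarrow> norm w \<le> \<epsilon> / 2 \<Longrightarrow> norm (f (of_real t + w)) \<le> M"
proof -
  define K where "K = {x + y | x y. x \<in> complex_of_real ` {0..1} \<and> y \<in> cball 0 (\<epsilon> / 2)}"
  have "compact (complex_of_real ` {0..1})" by (intro compact_continuous_image continuous_intros) auto
  then have K: "compact K" unfolding K_def by (intro compact_sums) auto
  have sub: "K \<subseteq> nbhd01 \<epsilon>"
    using \<open>0 < \<epsilon>\<close> by (auto simp: K_def intro!: nbhd01I)
  have "compact (f ` K)"
    by (intro compact_continuous_image K continuous_on_subset[OF assms(2) sub])
  then obtain M where M: "0 < M" "\<And>z. z \<in> f ` K \<Longrightarrow> norm z \<le> M"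
    using compact_imp_bounded bounded_pos by metis
  have "norm (f (of_real t + w)) \<le> M" if "t \<in> {0..1}" "norm w \<le> \<epsilon> / 2" for t w
  proof -
    have "of_real t + w \<in> K" using that unfolding K_def by (intro CollectI exI[of _ "of_real t"] exI[of _ w]) auto
    then show ?thesis using M(2) by blast
  qed
  with M(1) show ?thesis by (rule that)
qed

lemma holomorphic_Taylor_nbhd01:
  assumes eps: "0 < \<epsilon>" and g: "g holomorphic_on nbhd01 \<epsilon>"
  obtains M where "0 < M"
    "\<And>t w. t \<in> {0..1} \<Longrightarrow> norm w \<le> \<epsilon> / 2 \<Longrightarrow> norm (g (of_real t + w) - g (of_real t)) \<le> M * norm w"
    "\<And>t w. t \<in> {0..1} \<Longrightarrow> norm w \<le> \<epsilon> / 2 \<Longrightarrow>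
       norm (g (of_real t + w) - g (of_real t) - deriv g (of_real t) * w) \<le> M * (norm w)\<^sup>2"
    "\<And>t. t \<in> {0..1} \<Longrightarrow> norm (deriv (deriv g) (of_real t)) \<le> M"
proof -
  let ?U = "nbhd01 \<epsilon>"
  have g': "deriv g holomorphic_on ?U" "deriv (deriv g) holomorphic_on ?U"
    using g open_nbhd01 by (auto intro!: holomorphic_deriv)
  obtain M1 where M1: "0 < M1" "\<And>t w. t \<in> {0..1} \<Longrightarrow> norm w \<le> \<epsilon> / 2 \<Longrightarrow> norm (deriv g (of_real t + w)) \<le> M1"
    using continuous_on_cthickening_bound[OF eps] g' holomorphic_on_imp_continuous_on by metis
  obtain M2 where M2: "0 < M2" "\<And>t w. t \<in> {0..1} \<Longrightarrow> norm w \<le> \<epsilon> / 2 \<Longrightarrow> norm (deriv (deriv g) (of_real t + w)) \<le> M2"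
    using continuous_on_cthickening_bound[OF eps] g' holomorphic_on_imp_continuous_on by metis
  have sub: "cball (of_real t) (\<epsilon> / 2) \<subseteq> ?U" if "t \<in> {0..1}" for t
    using eps that by (auto simp: dist_norm norm_minus_commute intro!: nbhd01I[of t])
  show ?thesis
  proof (rule that[of "M1 + M2"])
    fix t and w :: complex assume t: "t \<in> {0..1::real}" and w: "norm w \<le> \<epsilon> / 2"
    let ?B = "cball (complex_of_real t) (\<epsilon> / 2)"
    have D: "(g has_field_derivative deriv g z) (at z within ?B)"
      "(deriv g has_field_derivative deriv (deriv g) z) (at z within ?B)" if "z \<in> ?B" for z
      using sub[OF t] that g g' open_nbhd01 by (auto intro!: holomorphic_derivI)
    have B: "norm (deriv g z) \<le> M1" "norm (deriv (deriv g) z) \<le> M2" if "z \<in> ?B" for z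
      using M1(2)[OF t, of "z - of_real t"] M2(2)[OF t, of "z - of_real t"] that
      by (auto simp: dist_norm norm_minus_commute)
    have tw: "of_real t + w \<in> ?B" "of_real t \<in> ?B" using w eps by (auto simp: dist_norm)
    have "norm (g (of_real t + w) - g (of_real t)) \<le> M1 * norm (of_real t + w - of_real t)"
      by (rule field_differentiable_bound[OF convex_cball D(1) B(1) tw])
    also have "\<dots> \<le> (M1 + M2) * norm w" using M2 by (simp add: mult_right_mono)
    finally show "norm (g (of_real t + w) - g (of_real t)) \<le> (M1 + M2) * norm w" .
    define F where "F = (\<lambda>i :: nat. if i = 0 then g else if i = 1 then deriv g else deriv (deriv g))"
    have "norm (F 0 (of_real t + w) - (\<Sum>i\<le>1. F i (of_real t) * (of_real t + w - of_real t) ^ i / fact i))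
       \<le> M2 * norm (of_real t + w - of_real t) ^ Suc 1 / fact 1"
    proof (rule complex_Taylor[OF convex_cball[of "of_real t" "\<epsilon> / 2"] _ _ tw(2,1)])
      fix i z assume "z \<in> ?B" "i \<le> (1 :: nat)"
      moreover from this have "i = 0 \<or> i = 1" by auto
      ultimately show "(F i has_field_derivative F (Suc i) z) (at z within ?B)"
        using D by (auto simp: F_def)
    qed (use B in \<open>auto simp: F_def\<close>)
    then have "norm (g (of_real t + w) - (g (of_real t) + deriv g (of_real t) * w)) \<le> M2 * (norm w)\<^sup>2"
      by (simp add: F_def power2_eq_square)
    also have "\<dots> \<le> (M1 + M2) * (norm w)\<^sup>2" using M1 by (simp add: mult_right_mono)
    finally show "norm (g (of_real t + w) - g (of_real t) - deriv g (of_real t) * w) \<le> (M1 + M2) * (norm w)\<^sup>2"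
      by (simp add: algebra_simps)
  next
    fix t assume "t \<in> {0..1::real}"
    then show "norm (deriv (deriv g) (of_real t)) \<le> M1 + M2"
      using M1(1) M2(2)[of t 0] eps by fastforce
  qed (use M1 M2 in auto)
qed

lemma deriv_Re_of_real:
  assumes g: "g holomorphic_on nbhd01 \<epsilon>" and t: "complex_of_real t \<in> nbhd01 \<epsilon>"
  shows "((\<lambda>t. Re (g (complex_of_real t))) has_real_derivative Re (deriv g (of_real t))) (at t within A)"
    "((\<lambda>t. Im (g (complex_of_real t))) has_real_derivative Im (deriv g (of_real t))) (at t within A)"
proof -
  have "(g has_field_derivative deriv g (of_real t)) (at (of_real t))"
    using g open_nbhd01 t by (rule holomorphic_derivI)
  then have "((\<lambda>t. g (of_real t)) has_vector_derivative deriv g (of_real t)) (at t within A)"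
    by (rule has_vector_derivative_real_field)
  then show "((\<lambda>t. Re (g (complex_of_real t))) has_real_derivative Re (deriv g (of_real t))) (at t within A)"
    "((\<lambda>t. Im (g (complex_of_real t))) has_real_derivative Im (deriv g (of_real t))) (at t within A)"
    by (rule has_field_derivative_Re, rule has_field_derivative_Im)
qed

text \<open>The second derivative needs the first formula on a real neighbourhood of
  \<open>t\<close>, even at the endpoints of \<open>[0, 1]\<close>. The open set \<open>?V\<close>
  of reals inside \<open>nbhd01 \<epsilon>\<close> provides it.\<close>

lemma deriv_deriv_Re_of_real:
  assumes g: "g holomorphic_on nbhd01 \<epsilon>" and eps: "0 < \<epsilon>" and t: "t \<in> {0..1}"
  shows "deriv (\<lambda>t. Re (g (complex_of_real t))) t = Re (deriv g (of_real t))"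
    "deriv (deriv (\<lambda>t. Re (g (complex_of_real t)))) t = Re (deriv (deriv g) (of_real t))"
proof -
  let ?V = "{t. complex_of_real t \<in> nbhd01 \<epsilon>}"
  have "open (complex_of_real -` nbhd01 \<epsilon>)"
    by (intro continuous_open_vimage open_nbhd01) (auto intro!: continuous_intros)
  then have V: "open ?V" by (simp add: vimage_def)
  have tV: "t \<in> ?V" using t eps by (auto intro!: nbhd01I[of t])
  have d: "deriv (\<lambda>t. Re (g (complex_of_real t))) s = Re (deriv g (of_real s))" if "s \<in> ?V" for s
    by (rule DERIV_imp_deriv, rule deriv_Re_of_real[OF g]) (use that in simp)
  show "deriv (\<lambda>t. Re (g (complex_of_real t))) t = Re (deriv g (of_real t))" by (rule d[OF tV])
  have "deriv g holomorphic_on nbhd01 \<epsilon>" using g open_nbhd01 by (rule holomorphic_deriv)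
  from deriv_Re_of_real(1)[OF this, of t UNIV] tV
  have "((\<lambda>t. Re (deriv g (complex_of_real t))) has_real_derivative Re (deriv (deriv g) (of_real t))) (at t)" by simp
  then have "(deriv (\<lambda>t. Re (g (complex_of_real t))) has_real_derivative Re (deriv (deriv g) (of_real t))) (at t)"
    by (rule has_field_derivative_transform_within_open[OF _ V tV]) (simp add: d)
  then show "deriv (deriv (\<lambda>t. Re (g (complex_of_real t)))) t = Re (deriv (deriv g) (of_real t))"
    by (rule DERIV_imp_deriv)
qed

text \<open>Reality of the curve and unit speed are known on \<open>[0, 1]\<close> only. They are
  differentiated relative to the closed interval, where derivatives are unique even at the
  endpoints.\<close>

lemma has_real_derivative_const_on_01:
  fixes f :: "real \<Rightarrow> real"
  assumes "(f has_real_derivative D) (at t within {0..1})" and t: "t \<in> {0..1}" and c: "\<And>s. s \<in> {0..1} \<Longrightarrow> f s = c"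
  shows "D = 0"
proof -
  have "((\<lambda>_. c) has_real_derivative D) (at t within {0..1})"
    using assms(1) by (rule has_field_derivative_transform_within[OF _ zero_less_one t]) (use c in auto)
  moreover have "((\<lambda>_. c) has_real_derivative 0) (at t within {0..1})" by (rule DERIV_const)
  ultimately show ?thesis
    using vector_derivative_unique_within_closed_interval[of 0 1 t "\<lambda>_. c" D 0] t
    by (simp add: has_real_derivative_iff_has_vector_derivative)
qed

text \<open>\<open>p1\<close> and \<open>p2\<close> are the components of the unit tangent, and
  \<open>M\<close> controls the Lipschitz and Taylor estimates. The curvature survives only through
  \<open>arcs\<close>, in which \<open>n0\<close> and \<open>L\<close> are uniform in the direction
  \<open>(e1, e2)\<close> and in \<open>\<eta>\<close>.\<close>

locale analytic_curve =
  fixes g1 g2 :: "complex \<Rightarrow> complex" and \<epsilon> M L :: real and p1 p2 :: "real \<Rightarrow> real" and n0 :: nat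
  assumes eps: "0 < \<epsilon>" and M: "1 \<le> M" and L: "1 \<le> L" and n0: "0 < n0"
    and hol: "g1 holomorphic_on nbhd01 \<epsilon>" "g2 holomorphic_on nbhd01 \<epsilon>"
    and real: "t \<in> {0..1} \<Longrightarrow> g1 (of_real t) \<in> \<real>" "t \<in> {0..1} \<Longrightarrow> g2 (of_real t) \<in> \<real>"
    and lipschitz: "t \<in> {0..1} \<Longrightarrow> norm w \<le> \<epsilon> / 2 \<Longrightarrow> norm (g1 (of_real t + w) - g1 (of_real t)) \<le> M * norm w"
      "t \<in> {0..1} \<Longrightarrow> norm w \<le> \<epsilon> / 2 \<Longrightarrow> norm (g2 (of_real t + w) - g2 (of_real t)) \<le> M * norm w"
    and taylor: "t \<in> {0..1} \<Longrightarrow> norm w \<le> \<epsilon> / 2 \<Longrightarrow>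
        norm (g1 (of_real t + w) - g1 (of_real t) - of_real (p1 t) * w) \<le> M * (norm w)\<^sup>2"
      "t \<in> {0..1} \<Longrightarrow> norm w \<le> \<epsilon> / 2 \<Longrightarrow>
        norm (g2 (of_real t + w) - g2 (of_real t) - of_real (p2 t) * w) \<le> M * (norm w)\<^sup>2"
    and unit: "t \<in> {0..1} \<Longrightarrow> (p1 t)\<^sup>2 + (p2 t)\<^sup>2 = 1"
    and arcs: "e1\<^sup>2 + e2\<^sup>2 = 1 \<Longrightarrow> 0 < \<eta> \<Longrightarrow> \<eta> < 1 / 4 \<Longrightarrow>
      \<exists>c :: nat \<Rightarrow> real. (\<forall>j<n0. c j \<in> {0..1}) \<and>
        (\<forall>a\<in>{0..1}. \<bar>e1 * p1 a + e2 * p2 a\<bar> < \<eta> \<longrightarrow> (\<exists>j<n0. \<bar>a - c j\<bar> \<le> L * \<eta>))"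

text \<open>The derivative of the unit tangent \<open>p\<close> is the curvature times the normal. Where \<open>p\<close> is nearly orthogonal to \<open>e\<close>,
  the normal is nearly parallel to \<open>e\<close>, so \<open>\<langle>e, p\<rangle>\<close> varies at a definite rate there.\<close>

lemma nearly_orthogonal_arcs:
  fixes p1 p2 q1 q2 :: "real \<Rightarrow> real"
  assumes k0: "0 < k0" and M: "0 < M" and n0: "8 * M \<le> real n0"
    and p': "\<And>t. t \<in> {0..1} \<Longrightarrow> (p1 has_real_derivative q1 t) (at t)" "\<And>t. t \<in> {0..1} \<Longrightarrow> (p2 has_real_derivative q2 t) (at t)"
    and q: "\<And>t. t \<in> {0..1} \<Longrightarrow> \<bar>q1 t\<bar> \<le> M" "\<And>t. t \<in> {0..1} \<Longrightarrow> \<bar>q2 t\<bar> \<le> M"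
    and unit: "\<And>t. t \<in> {0..1} \<Longrightarrow> (p1 t)\<^sup>2 + (p2 t)\<^sup>2 = 1"
    and orth: "\<And>t. t \<in> {0..1} \<Longrightarrow> p1 t * q1 t + p2 t * q2 t = 0"
    and curv: "\<And>t. t \<in> {0..1} \<Longrightarrow> k0 \<le> \<bar>p1 t * q2 t - p2 t * q1 t\<bar>"
    and e: "e1\<^sup>2 + e2\<^sup>2 = 1" and \<eta>: "0 < \<eta>" "\<eta> < 1 / 4"
  shows "\<exists>c :: nat \<Rightarrow> real. (\<forall>j<n0. c j \<in> {0..1}) \<and>
     (\<forall>a\<in>{0..1}. \<bar>e1 * p1 a + e2 * p2 a\<bar> < \<eta> \<longrightarrow> (\<exists>j<n0. \<bar>a - c j\<bar> \<le> 4 / k0 * \<eta>))"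
proof -
  define f where "f t = e1 * p1 t + e2 * p2 t" for t
  define f' where "f' t = e1 * q1 t + e2 * q2 t" for t
  have n0': "0 < real n0" using n0 M by linarith
  have e1: "\<bar>e1\<bar> \<le> 1" "\<bar>e2\<bar> \<le> 1"
    using e zero_le_power2[of e1] zero_le_power2[of e2] unfolding abs_square_le_1[symmetric] by linarith+
  have D: "(f has_real_derivative f' t) (at t)" if "t \<in> {0..1}" for t
    unfolding f_def f'_def using p'[OF that] by (auto intro!: derivative_eq_intros)
  have f'le: "\<bar>f' t\<bar> \<le> 2 * M" if "t \<in> {0..1}" for t
  proof -
    have "\<bar>f' t\<bar> \<le> \<bar>e1\<bar> * \<bar>q1 t\<bar> + \<bar>e2\<bar> * \<bar>q2 t\<bar>"
      unfolding f'_def using abs_triangle_ineq[of "e1 * q1 t" "e2 * q2 t"] by (simp add: abs_mult)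
    also have "\<dots> \<le> 1 * M + 1 * M" using e1 q[OF that] M by (intro add_mono mult_mono) auto
    finally show ?thesis by simp
  qed
  \<comment> \<open>As \<open>q\<close> is orthogonal to the unit vector \<open>p\<close>,
    \<open>f'\<close> is the curvature \<open>k\<close> times the component \<open>h\<close> of
    \<open>e\<close> along the normal, and f^2 + h^2 = 1.\<close>
  have f'ge: "k0 / 2 \<le> \<bar>f' t\<bar>" if t: "t \<in> {0..1}" and small: "\<bar>f t\<bar> \<le> 1 / 2" for t
  proof -
    define k where "k = p1 t * q2 t - p2 t * q1 t"
    define h where "h = e2 * p1 t - e1 * p2 t"
    have "f' t = f' t * ((p1 t)\<^sup>2 + (p2 t)\<^sup>2)" by (simp add: unit[OF t])
    also have "\<dots> = k * h + (e1 * p1 t + e2 * p2 t) * (p1 t * q1 t + p2 t * q2 t)"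
      by (simp add: f'_def k_def h_def power2_eq_square algebra_simps)
    finally have f': "f' t = k * h" by (simp add: orth[OF t])
    have "(f t)\<^sup>2 + h\<^sup>2 = (e1\<^sup>2 + e2\<^sup>2) * ((p1 t)\<^sup>2 + (p2 t)\<^sup>2)"
      by (simp add: f_def h_def power2_eq_square algebra_simps)
    then have "(f t)\<^sup>2 + h\<^sup>2 = 1" using e unit[OF t] by simp
    moreover have "(f t)\<^sup>2 \<le> (1 / 2)\<^sup>2" using small by (simp add: abs_le_square_iff[symmetric])
    ultimately have "(1 / 2)\<^sup>2 \<le> h\<^sup>2" by (simp add: power2_eq_square)
    then have "1 / 2 \<le> \<bar>h\<bar>" by (simp add: abs_le_square_iff[symmetric])
    then have "k0 * (1 / 2) \<le> \<bar>k\<bar> * \<bar>h\<bar>"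
      using curv[OF t] k0 unfolding k_def by (intro mult_mono) auto
    then show ?thesis by (simp add: f' abs_mult)
  qed
  \<comment> \<open>Within length \<open>1 / n0\<close> the function \<open>f\<close> moves by at
    most \<open>2 * M / n0 \<le> 1 / 4\<close>. Starting below \<open>\<eta> < 1 / 4\<close> it
    therefore stays below 1/2, where its slope is at least \<open>k0 / 2\<close>, while its total
    change is at most \<open>2 * \<eta>\<close>.\<close>
  have close: "b - a \<le> 4 / k0 * \<eta>"
    if ab: "a \<le> b" "b - a \<le> 1 / real n0" "a \<in> {0..1}" "b \<in> {0..1}" "\<bar>f a\<bar> < \<eta>" "\<bar>f b\<bar> < \<eta>" for a b
  proof (cases "a = b")
    case False
    then have "a < b" using ab by simp
    then obtain z where z: "a < z" "z < b" "f b - f a = (b - a) * f' z"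
      using MVT2[of a b f f'] D ab by (metis atLeastAtMost_iff order_trans)
    obtain y where y: "a < y" "y < z" "f z - f a = (z - a) * f' y"
      using MVT2[of a z f f'] z D ab by (metis atLeastAtMost_iff order_trans less_imp_le)
    have yz: "y \<in> {0..1}" "z \<in> {0..1}" using y z ab by auto
    have "\<bar>f z - f a\<bar> \<le> (1 / real n0) * (2 * M)"
      unfolding y(3) abs_mult using f'le[OF yz(1)] z y ab by (intro mult_mono) auto
    also have "\<dots> \<le> 1 / 4" using n0 n0' by (simp add: field_simps)
    finally have "\<bar>f z\<bar> \<le> 1 / 2" using ab \<eta> by linarith
    from f'ge[OF yz(2) this] have "(b - a) * (k0 / 2) \<le> \<bar>f b - f a\<bar>"
      unfolding z(3) abs_mult using \<open>a < b\<close> k0 by (intro mult_mono) auto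
    also have "\<dots> \<le> 2 * \<eta>" using ab by linarith
    finally show ?thesis using k0 by (simp add: field_simps)
  qed (use k0 \<eta> in auto)
  define I where "I j = {real j / real n0..real (Suc j) / real n0}" for j
  \<comment> \<open>One centre per cell of length \<open>1 / n0\<close>: a nearly orthogonal point
    if the cell has one, otherwise 0, just to stay in \<open>[0, 1]\<close>.\<close>
  define c where "c j = (if \<exists>b\<in>I j \<inter> {0..1}. \<bar>f b\<bar> < \<eta> then SOME b. b \<in> I j \<inter> {0..1} \<and> \<bar>f b\<bar> < \<eta> else 0)" for j
  have c: "c j \<in> I j \<inter> {0..1} \<and> \<bar>f (c j)\<bar> < \<eta>" if "b \<in> I j \<inter> {0..1}" "\<bar>f b\<bar> < \<eta>" for b j
  proof -
    have "\<exists>b. b \<in> I j \<inter> {0..1} \<and> \<bar>f b\<bar> < \<eta>" using that by blast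
    from someI_ex[OF this] show ?thesis using that unfolding c_def by (auto simp del: Int_iff)
  qed
  show ?thesis
  proof (intro exI[of _ c] conjI allI impI ballI)
    fix j show "c j \<in> {0..1}"
    proof (cases "\<exists>b\<in>I j \<inter> {0..1}. \<bar>f b\<bar> < \<eta>")
      case True
      then show ?thesis using c by blast
    qed (simp add: c_def)
  next
    fix a assume a: "a \<in> {0..1}" "\<bar>e1 * p1 a + e2 * p2 a\<bar> < \<eta>"
    \<comment> \<open>The minimum with \<open>n0 - 1\<close> puts \<open>a = 1\<close> into the last
      cell.\<close>
    define j where "j = min (nat \<lfloor>a * real n0\<rfloor>) (n0 - 1)"
    have an: "0 \<le> a * real n0" "a * real n0 \<le> real n0" using a n0' by (auto simp: mult_left_le_one_le)
    have j: "j < n0" using n0' by (simp add: j_def)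
    have "real j \<le> real (nat \<lfloor>a * real n0\<rfloor>)" by (simp add: j_def)
    also have "\<dots> \<le> a * real n0" using an by simp
    finally have 1: "real j \<le> a * real n0" .
    have 2: "a * real n0 \<le> real (Suc j)"
    proof (cases "nat \<lfloor>a * real n0\<rfloor> \<le> n0 - 1")
      case True
      then have "j = nat \<lfloor>a * real n0\<rfloor>" by (simp add: j_def)
      then show ?thesis using an by linarith
    next
      case False
      then have "Suc j = n0" using n0' by (simp add: j_def)
      then show ?thesis using an by simp
    qed
    have aI: "a \<in> I j \<inter> {0..1}" using 1 2 a n0' by (auto simp: I_def field_simps)
    have fa: "\<bar>f a\<bar> < \<eta>" using a by (simp add: f_def)
    note cj = c[OF aI fa]
    have len: "\<bar>a - c j\<bar> \<le> 1 / real n0"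
      using aI cj n0' by (auto simp: I_def abs_le_iff field_simps)
    have "\<bar>a - c j\<bar> \<le> 4 / k0 * \<eta>"
    proof (cases "a \<le> c j")
      case True
      then show ?thesis using close[of a "c j"] len aI cj fa by auto
    next
      case False
      then show ?thesis using close[of "c j" a] len aI cj fa by auto
    qed
    with j show "\<exists>j<n0. \<bar>a - c j\<bar> \<le> 4 / k0 * \<eta>" by blast
  qed
qed

theorem analytic_curve_exists:
  fixes g1 g2 :: "complex \<Rightarrow> complex" and \<epsilon> :: real
  defines "\<gamma>1 \<equiv> (\<lambda>t::real. Re (g1 (complex_of_real t)))"
      and "\<gamma>2 \<equiv> (\<lambda>t::real. Re (g2 (complex_of_real t)))"
  assumes eps: "\<epsilon> > 0"
    and hol: "g1 holomorphic_on nbhd01 \<epsilon>" "g2 holomorphic_on nbhd01 \<epsilon>"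
    and real_on_seg: "\<forall>t\<in>{0..1::real}. g1 (complex_of_real t) \<in> \<real> \<and> g2 (complex_of_real t) \<in> \<real>"
    and arclength: "\<forall>t\<in>{0..1::real}. (deriv \<gamma>1 t)^2 + (deriv \<gamma>2 t)^2 = 1"
    and curvature: "\<forall>t\<in>{0..1::real}.
          deriv \<gamma>1 t * deriv (deriv \<gamma>2) t - deriv \<gamma>2 t * deriv (deriv \<gamma>1) t \<noteq> 0"
  shows "\<exists>M L p1 p2 n0. analytic_curve g1 g2 \<epsilon> M L p1 p2 n0"
proof -
  obtain M1 where M1: "0 < M1"
    "\<And>t w. t \<in> {0..1} \<Longrightarrow> norm w \<le> \<epsilon> / 2 \<Longrightarrow> norm (g1 (of_real t + w) - g1 (of_real t)) \<le> M1 * norm w"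
    "\<And>t w. t \<in> {0..1} \<Longrightarrow> norm w \<le> \<epsilon> / 2 \<Longrightarrow>
       norm (g1 (of_real t + w) - g1 (of_real t) - deriv g1 (of_real t) * w) \<le> M1 * (norm w)\<^sup>2"
    "\<And>t. t \<in> {0..1} \<Longrightarrow> norm (deriv (deriv g1) (of_real t)) \<le> M1"
    using holomorphic_Taylor_nbhd01[OF eps hol(1)] by blast
  obtain M2 where M2: "0 < M2"
    "\<And>t w. t \<in> {0..1} \<Longrightarrow> norm w \<le> \<epsilon> / 2 \<Longrightarrow> norm (g2 (of_real t + w) - g2 (of_real t)) \<le> M2 * norm w"
    "\<And>t w. t \<in> {0..1} \<Longrightarrow> norm w \<le> \<epsilon> / 2 \<Longrightarrow>
       norm (g2 (of_real t + w) - g2 (of_real t) - deriv g2 (of_real t) * w) \<le> M2 * (norm w)\<^sup>2"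
    "\<And>t. t \<in> {0..1} \<Longrightarrow> norm (deriv (deriv g2) (of_real t)) \<le> M2"
    using holomorphic_Taylor_nbhd01[OF eps hol(2)] by blast
  define M where "M = M1 + M2 + 1"
  define p1 where "p1 t = Re (deriv g1 (of_real t))" for t
  define p2 where "p2 t = Re (deriv g2 (of_real t))" for t
  define q1 where "q1 t = Re (deriv (deriv g1) (of_real t))" for t
  define q2 where "q2 t = Re (deriv (deriv g2) (of_real t))" for t
  have inU: "complex_of_real t \<in> nbhd01 \<epsilon>" if "t \<in> {0..1}" for t
    using that eps by (auto intro!: nbhd01I[of t])
  have d: "deriv \<gamma>1 t = p1 t" "deriv \<gamma>2 t = p2 t" "deriv (deriv \<gamma>1) t = q1 t" "deriv (deriv \<gamma>2) t = q2 t"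
    if "t \<in> {0..1}" for t
    unfolding \<gamma>1_def \<gamma>2_def p1_def p2_def q1_def q2_def
    using deriv_deriv_Re_of_real[OF hol(1) eps that] deriv_deriv_Re_of_real[OF hol(2) eps that] by simp_all
  have g': "deriv g1 holomorphic_on nbhd01 \<epsilon>" "deriv g2 holomorphic_on nbhd01 \<epsilon>"
    using hol open_nbhd01 by (auto intro: holomorphic_deriv)
  have p': "(p1 has_real_derivative q1 t) (at t within A)" "(p2 has_real_derivative q2 t) (at t within A)"
    if "t \<in> {0..1}" for t A
    unfolding p1_def p2_def q1_def q2_def
    using deriv_Re_of_real(1)[OF g'(1) inU[OF that]] deriv_Re_of_real(1)[OF g'(2) inU[OF that]] by auto
  have real_deriv: "deriv g (of_real t) = of_real (Re (deriv g (of_real t)))"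
    if g: "g holomorphic_on nbhd01 \<epsilon>" "\<And>t. t \<in> {0..1} \<Longrightarrow> g (complex_of_real t) \<in> \<real>" and t: "t \<in> {0..1}" for g t
  proof -
    have "Im (deriv g (of_real t)) = 0"
      by (rule has_real_derivative_const_on_01[OF deriv_Re_of_real(2)[OF g(1) inU[OF t]] t])
         (use g(2) in \<open>auto simp: complex_is_Real_iff\<close>)
    then show ?thesis by (simp add: complex_eq_iff)
  qed
  have g'real: "deriv g1 (of_real t) = of_real (p1 t)" "deriv g2 (of_real t) = of_real (p2 t)" if "t \<in> {0..1}" for t
    unfolding p1_def p2_def using real_deriv[OF hol(1) _ that] real_deriv[OF hol(2) _ that] real_on_seg by auto
  have unit: "(p1 t)\<^sup>2 + (p2 t)\<^sup>2 = 1" if "t \<in> {0..1}" for t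
    using bspec[OF arclength that] d[OF that] by simp
  have orth: "p1 t * q1 t + p2 t * q2 t = 0" if "t \<in> {0..1}" for t
  proof -
    have "((\<lambda>t. (p1 t)\<^sup>2 + (p2 t)\<^sup>2) has_real_derivative 2 * p1 t * q1 t + 2 * p2 t * q2 t) (at t within {0..1})"
      using p'[OF that] by (auto intro!: derivative_eq_intros)
    then have "2 * p1 t * q1 t + 2 * p2 t * q2 t = 0"
      by (rule has_real_derivative_const_on_01[OF _ that unit])
    then show ?thesis by simp
  qed
  define k where "k t = p1 t * q2 t - p2 t * q1 t" for t
  have "deriv (deriv g1) holomorphic_on nbhd01 \<epsilon>" "deriv (deriv g2) holomorphic_on nbhd01 \<epsilon>"
    using g' open_nbhd01 by (auto intro: holomorphic_deriv)
  then have cont: "continuous_on (nbhd01 \<epsilon>) (deriv (deriv g1))" "continuous_on (nbhd01 \<epsilon>) (deriv (deriv g2))"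
    "continuous_on (nbhd01 \<epsilon>) (deriv g1)" "continuous_on (nbhd01 \<epsilon>) (deriv g2)"
    using g' by (auto intro: holomorphic_on_imp_continuous_on)
  have "continuous_on {0..1} (\<lambda>t. \<bar>k t\<bar>)"
    unfolding k_def p1_def p2_def q1_def q2_def
    by (intro continuous_intros continuous_on_compose2[OF cont(1)] continuous_on_compose2[OF cont(2)]
        continuous_on_compose2[OF cont(3)] continuous_on_compose2[OF cont(4)]) (use inU in auto)
  then obtain t0 where t0: "t0 \<in> {0..1}" "\<And>t. t \<in> {0..1} \<Longrightarrow> \<bar>k t0\<bar> \<le> \<bar>k t\<bar>"
    using continuous_attains_inf[of "{0..1::real}" "\<lambda>t. \<bar>k t\<bar>"] by auto
  define k0 where "k0 = \<bar>k t0\<bar>"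
  have "k t0 \<noteq> 0" using bspec[OF curvature t0(1)] d[OF t0(1)] by (simp add: k_def)
  then have k0: "0 < k0" by (simp add: k0_def)
  define n0 where "n0 = nat \<lceil>8 * M\<rceil>"
  have M0: "1 \<le> M" using M1 M2 by (simp add: M_def)
  have n0: "8 * M \<le> real n0" by (simp add: n0_def real_nat_ceiling_ge)
  \<comment> \<open>\<open>4 / k0\<close> comes from the arcs; the summand 1 ensures
    \<open>1 \<le> L\<close>.\<close>
  have "analytic_curve g1 g2 \<epsilon> M (4 / k0 + 1) p1 p2 n0"
  proof
    show "0 < n0" using n0 M0 by (cases n0) auto
    fix t w assume t: "t \<in> {0..1::real}" and w: "norm (w :: complex) \<le> \<epsilon> / 2"
    have le: "M1 * norm w \<le> M * norm w" "M2 * norm w \<le> M * norm w"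
      "M1 * (norm w)\<^sup>2 \<le> M * (norm w)\<^sup>2" "M2 * (norm w)\<^sup>2 \<le> M * (norm w)\<^sup>2"
      using M1(1) M2(1) by (auto simp: M_def intro!: mult_right_mono)
    show "norm (g1 (of_real t + w) - g1 (of_real t)) \<le> M * norm w" using M1(2)[OF t w] le by linarith
    show "norm (g2 (of_real t + w) - g2 (of_real t)) \<le> M * norm w" using M2(2)[OF t w] le by linarith
    show "norm (g1 (of_real t + w) - g1 (of_real t) - of_real (p1 t) * w) \<le> M * (norm w)\<^sup>2"
      using M1(3)[OF t w] le g'real[OF t] by simp
    show "norm (g2 (of_real t + w) - g2 (of_real t) - of_real (p2 t) * w) \<le> M * (norm w)\<^sup>2"
      using M2(3)[OF t w] le g'real[OF t] by simp
  next
    fix e1 e2 \<eta> :: real assume e: "e1\<^sup>2 + e2\<^sup>2 = 1" "0 < \<eta>" "\<eta> < 1 / 4"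
    have q: "\<bar>q1 t\<bar> \<le> M" "\<bar>q2 t\<bar> \<le> M" if "t \<in> {0..1}" for t
      using M1(4)[OF that] M2(4)[OF that] M1(1) M2(1)
        abs_Re_le_cmod[of "deriv (deriv g1) (of_real t)"] abs_Re_le_cmod[of "deriv (deriv g2) (of_real t)"]
      unfolding q1_def q2_def M_def by linarith+
    have curv: "k0 \<le> \<bar>p1 t * q2 t - p2 t * q1 t\<bar>" if "t \<in> {0..1}" for t
      using t0(2)[OF that] by (simp add: k0_def k_def)
    have "0 < M" using M0 by simp
    from nearly_orthogonal_arcs[OF k0 this n0 p'(1) p'(2) q unit orth curv e]
    obtain c :: "nat \<Rightarrow> real" where c: "\<forall>j<n0. c j \<in> {0..1}"
      "\<forall>a\<in>{0..1}. \<bar>e1 * p1 a + e2 * p2 a\<bar> < \<eta> \<longrightarrow> (\<exists>j<n0. \<bar>a - c j\<bar> \<le> 4 / k0 * \<eta>)"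
      by blast
    have "4 / k0 * \<eta> \<le> (4 / k0 + 1) * \<eta>" using e by (intro mult_right_mono) auto
    then have "\<exists>j<n0. \<bar>a - c j\<bar> \<le> (4 / k0 + 1) * \<eta>" if "a \<in> {0..1}" "\<bar>e1 * p1 a + e2 * p2 a\<bar> < \<eta>" for a
      using c(2) that order_trans by blast
    with c(1) show "\<exists>c :: nat \<Rightarrow> real. (\<forall>j<n0. c j \<in> {0..1}) \<and>
        (\<forall>a\<in>{0..1}. \<bar>e1 * p1 a + e2 * p2 a\<bar> < \<eta> \<longrightarrow> (\<exists>j<n0. \<bar>a - c j\<bar> \<le> (4 / k0 + 1) * \<eta>))"
      by (intro exI[of _ c]) blast
  qed (use eps hol M0 k0 real_on_seg unit in auto)
  then show ?thesis by blast
qed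

section \<open>Directions of chords\<close>

definition gauss_of :: "int \<times> int \<Rightarrow> complex" where
  "gauss_of \<mu> = Complex (of_int (fst \<mu>)) (of_int (snd \<mu>))"

lemma gauss_of_eq_iff [simp]: "gauss_of \<mu> = gauss_of \<nu> \<longleftrightarrow> \<mu> = \<nu>"
  by (auto simp: gauss_of_def prod_eq_iff)

lemma cmod_gauss_of_sq: "(cmod (gauss_of \<mu>))\<^sup>2 = real_of_int ((fst \<mu>)\<^sup>2 + (snd \<mu>)\<^sup>2)"
  by (simp add: gauss_of_def cmod_def)

lemma lattice_pts_iff: "\<mu> \<in> lattice_pts m \<longleftrightarrow> (cmod (gauss_of \<mu>))\<^sup>2 = real m"
proof -
  have "(cmod (gauss_of \<mu>))\<^sup>2 = real m \<longleftrightarrow> real_of_int ((fst \<mu>)\<^sup>2 + (snd \<mu>)\<^sup>2) = real_of_int (int m)"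
    unfolding cmod_gauss_of_sq by simp
  also have "\<dots> \<longleftrightarrow> (fst \<mu>)\<^sup>2 + (snd \<mu>)\<^sup>2 = int m" by (rule of_int_eq_iff)
  finally show ?thesis by (auto simp: lattice_pts_def)
qed

lemma gauss_circle_eq: "gauss_circle m = gauss_of ` lattice_pts m"
proof (intro equalityI subsetI)
  fix z assume z: "z \<in> gauss_circle m"
  then obtain a b where "z = Complex (of_int a) (of_int b)" by (auto simp: gauss_circle_def elim: gauss_intsE)
  then have "z = gauss_of (a, b)" by (simp add: gauss_of_def)
  then show "z \<in> gauss_of ` lattice_pts m" using z by (auto simp: lattice_pts_iff gauss_circle_def)
qed (auto simp: lattice_pts_iff gauss_circle_def gauss_of_def)

lemma card_gauss_circle: "card (gauss_circle m) = card (lattice_pts m)"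
  unfolding gauss_circle_eq by (intro card_image) (simp add: inj_on_def)

lemma card_gauss_products_le_square: "card (gauss_products m) \<le> (card (lattice_pts m))\<^sup>2"
proof -
  have "card (gauss_products m) \<le> card (gauss_circle m \<times> gauss_circle m)"
    unfolding gauss_products_def by (intro card_image_le) simp
  then show ?thesis by (simp add: card_cartesian_product card_gauss_circle power2_eq_square)
qed

text \<open>For \<open>|z| = |w|\<close> the chord \<open>z - w\<close> is orthogonal to a square root of \<open>z w\<close>; so chords between points of
  the circle have no more directions than there are products of two such points.\<close>

lemma chord_direction:
  assumes "(cmod z)\<^sup>2 = r" "(cmod w)\<^sup>2 = r"
  shows "(z - w)\<^sup>2 * of_real r = - (z * w) * of_real ((cmod (z - w))\<^sup>2)"
proof -
  have r: "of_real r = z * cnj z" "of_real r = w * cnj w"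
    using assms by (auto simp flip: complex_norm_square)
  have "of_real ((cmod (z - w))\<^sup>2) = of_real r + of_real r - z * cnj w - w * cnj z"
    unfolding complex_norm_square by (subst r(1), subst r(2)) (simp add: algebra_simps)
  then have "- (z * w) * of_real ((cmod (z - w))\<^sup>2) = - (z * w) * (of_real r + of_real r - z * cnj w - w * cnj z)"
    by (rule arg_cong)
  also have "\<dots> = - 2 * z * w * of_real r + z * z * (w * cnj w) + w * w * (z * cnj z)"
    by (simp add: algebra_simps)
  also have "\<dots> = (z - w)\<^sup>2 * of_real r"
    unfolding r[symmetric] by (simp add: power2_eq_square algebra_simps)
  finally show ?thesis by simp
qed

context analytic_curve
begin

definition good_point :: "nat \<Rightarrow> real \<Rightarrow> real \<Rightarrow> bool" where
  "good_point m \<eta> a \<longleftrightarrow> (\<forall>\<mu>\<in>lattice_pts m. \<forall>\<nu>\<in>lattice_pts m. \<mu> \<noteq> \<nu> \<longrightarrow>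
     \<eta> * cmod (gauss_of \<mu> - gauss_of \<nu>)
       \<le> \<bar>Re (gauss_of \<mu> - gauss_of \<nu>) * p1 a + Im (gauss_of \<mu> - gauss_of \<nu>) * p2 a\<bar>)"

text \<open>A square root \<open>e w\<close> of \<open>- w / m\<close> is, up to sign, the unit
  vector of every chord whose endpoints have product \<open>w\<close>. So one family of
  \<open>n0\<close> arcs for each product catches all bad points.\<close>

lemma bad_points_covered:
  assumes m: "0 < m" and \<eta>: "0 < \<eta>" "\<eta> < 1 / 4"
  obtains P where "finite P" "P \<subseteq> {0..1}" "card P \<le> n0 * card (gauss_products m)"
    "\<And>a. a \<in> {0..1} \<Longrightarrow> \<not> good_point m \<eta> a \<Longrightarrow> \<exists>p\<in>P. \<bar>a - p\<bar> \<le> L * \<eta>"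
proof -
  define e where "e w = csqrt (- w / of_nat m)" for w :: complex
  have e1: "(Re (e w))\<^sup>2 + (Im (e w))\<^sup>2 = 1" if w: "w \<in> gauss_products m" for w
  proof -
    obtain z z' where "w = z * z'" "(cmod z)\<^sup>2 = real m" "(cmod z')\<^sup>2 = real m"
      using w by (auto simp: gauss_products_def gauss_circle_def)
    then have "(cmod w)\<^sup>2 = (real m)\<^sup>2"
      by (simp only: norm_mult power_mult_distrib power2_eq_square[of "real m"])
    then have "cmod w = real m" using m by (simp add: power2_eq_iff_nonneg)
    then have "cmod ((e w)\<^sup>2) = 1" using m by (simp add: e_def norm_divide)
    then show ?thesis by (simp add: norm_power cmod_power2)
  qed
  have "\<forall>w\<in>gauss_products m. \<exists>c :: nat \<Rightarrow> real. (\<forall>j<n0. c j \<in> {0..1}) \<and>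
        (\<forall>a\<in>{0..1}. \<bar>Re (e w) * p1 a + Im (e w) * p2 a\<bar> < \<eta> \<longrightarrow> (\<exists>j<n0. \<bar>a - c j\<bar> \<le> L * \<eta>))"
    using arcs[OF e1 \<eta>] by blast
  then obtain c :: "complex \<Rightarrow> nat \<Rightarrow> real" where c: "\<forall>w\<in>gauss_products m. (\<forall>j<n0. c w j \<in> {0..1}) \<and>
        (\<forall>a\<in>{0..1}. \<bar>Re (e w) * p1 a + Im (e w) * p2 a\<bar> < \<eta> \<longrightarrow> (\<exists>j<n0. \<bar>a - c w j\<bar> \<le> L * \<eta>))"
    unfolding bchoice_iff by blast
  define P where "P = (\<Union>w\<in>gauss_products m. c w ` {..<n0})"
  show ?thesis
  proof (rule that[of P])
    show "finite P" by (simp add: P_def)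
    show "P \<subseteq> {0..1}" using c unfolding P_def by blast
    have "card P \<le> (\<Sum>w\<in>gauss_products m. card (c w ` {..<n0}))"
      unfolding P_def by (rule card_UN_le) simp
    also have "\<dots> \<le> (\<Sum>w\<in>gauss_products m. n0)"
      by (intro sum_mono) (metis card_image_le card_lessThan finite_lessThan)
    finally show "card P \<le> n0 * card (gauss_products m)" by (simp add: mult.commute)
  next
    fix a assume a: "a \<in> {0..1}" "\<not> good_point m \<eta> a"
    then obtain \<mu> \<nu> where mn: "\<mu> \<in> lattice_pts m" "\<nu> \<in> lattice_pts m" "\<mu> \<noteq> \<nu>" and
      bad: "\<bar>Re (gauss_of \<mu> - gauss_of \<nu>) * p1 a + Im (gauss_of \<mu> - gauss_of \<nu>) * p2 a\<bar> < \<eta> * cmod (gauss_of \<mu> - gauss_of \<nu>)"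
      unfolding good_point_def not_le[symmetric] by blast
    define d where "d = gauss_of \<mu> - gauss_of \<nu>"
    define w where "w = gauss_of \<mu> * gauss_of \<nu>"
    have w: "w \<in> gauss_products m" using mn by (auto simp: w_def gauss_products_def gauss_circle_eq)
    have d0: "d \<noteq> 0" using mn by (simp add: d_def)
    have "d\<^sup>2 * of_nat m = - w * of_real ((cmod d)\<^sup>2)"
      using chord_direction[of "gauss_of \<mu>" "real m" "gauss_of \<nu>"] mn
      by (simp add: lattice_pts_iff d_def w_def)
    then have "d\<^sup>2 = (e w * of_real (cmod d))\<^sup>2"
      using m by (simp add: e_def power_mult_distrib field_simps)
    then have "d = e w * of_real (cmod d) \<or> d = - (e w * of_real (cmod d))" by (simp add: power2_eq_iff)
    then have "\<exists>s :: real. \<bar>s\<bar> = 1 \<and> d = of_real (s * cmod d) * e w"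
    proof
      assume "d = e w * of_real (cmod d)"
      then show ?thesis by (intro exI[of _ 1]) (simp add: mult.commute)
    next
      assume "d = - (e w * of_real (cmod d))"
      then show ?thesis by (intro exI[of _ "-1"]) (simp add: mult.commute)
    qed
    then obtain s :: real where s: "\<bar>s\<bar> = 1" "d = of_real (s * cmod d) * e w" by blast
    have "Re d * p1 a + Im d * p2 a = s * cmod d * (Re (e w) * p1 a + Im (e w) * p2 a)"
      by (subst (1 2) s(2)) (simp add: algebra_simps)
    then have "cmod d * \<bar>Re (e w) * p1 a + Im (e w) * p2 a\<bar> < cmod d * \<eta>"
      using bad s(1) unfolding d_def[symmetric] by (simp add: abs_mult mult.commute)
    then have "\<bar>Re (e w) * p1 a + Im (e w) * p2 a\<bar> < \<eta>" using d0 by simp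
    then obtain j where "j < n0" "\<bar>a - c w j\<bar> \<le> L * \<eta>" using c w a(1) by blast
    then show "\<exists>p\<in>P. \<bar>a - p\<bar> \<le> L * \<eta>" using w by (auto simp: P_def)
  qed
qed

text \<open>If every point of \<open>[l, r]\<close> were bad, the interval would be covered by at
  most n0 N^2 arcs of length \<open>2 * L * \<eta>\<close>, whose total length is too small. Here
  the trivial bound N^2 for the number of products is enough.\<close>

lemma good_point_exists:
  assumes m: "0 < m" and \<eta>: "0 < \<eta>" "\<eta> < 1 / 4"
    and lr: "0 \<le> l" "r \<le> 1" "2 * L * \<eta> * (real n0 * (real (card (lattice_pts m)))\<^sup>2) < r - l"
  obtains a where "l \<le> a" "a \<le> r" "good_point m \<eta> a"
proof (rule ccontr)
  assume no: "\<not> thesis"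
  have bad: "\<not> good_point m \<eta> a" if "a \<in> {l..r}" for a
    using no \<open>\<And>a. l \<le> a \<Longrightarrow> a \<le> r \<Longrightarrow> good_point m \<eta> a \<Longrightarrow> thesis\<close> \<open>a \<in> {l..r}\<close> by auto
  obtain P where P: "finite P" "P \<subseteq> {0..1}" "card P \<le> n0 * card (gauss_products m)"
    "\<And>a. a \<in> {0..1} \<Longrightarrow> \<not> good_point m \<eta> a \<Longrightarrow> \<exists>p\<in>P. \<bar>a - p\<bar> \<le> L * \<eta>"
    using bad_points_covered[OF m \<eta>] by blast
  have L\<eta>: "0 \<le> L * \<eta>" using L \<eta> by simp
  have "0 \<le> 2 * L * \<eta> * (real n0 * (real (card (lattice_pts m)))\<^sup>2)" using L \<eta> by simp
  then have lr': "l \<le> r" using lr by linarith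
  have "{l..r} \<subseteq> (\<Union>p\<in>P. {p - L * \<eta>..p + L * \<eta>})"
  proof
    fix a assume a: "a \<in> {l..r}"
    then have "a \<in> {0..1}" using lr by auto
    from P(4)[OF this bad[OF a]] obtain p where "p \<in> P" "\<bar>a - p\<bar> \<le> L * \<eta>" by blast
    then show "a \<in> (\<Union>p\<in>P. {p - L * \<eta>..p + L * \<eta>})" by (intro UN_I[of p]) (auto simp: abs_le_iff)
  qed
  then have "measure lborel {l..r} \<le> measure lborel (\<Union>p\<in>P. {p - L * \<eta>..p + L * \<eta>})"
  proof (rule measure_mono_fmeasurable)
    have "{x..y} \<in> fmeasurable lborel" for x y :: real
      using fmeasurable_cbox[of x y] by simp
    then show "(\<Union>p\<in>P. {p - L * \<eta>..p + L * \<eta>}) \<in> fmeasurable lborel"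
      using P(1) by (intro fmeasurable.finite_UN) auto
  qed auto
  also have "\<dots> \<le> (\<Sum>p\<in>P. measure lborel {p - L * \<eta>..p + L * \<eta>})"
    using P(1) by (intro measure_UNION_le) auto
  also have "\<dots> = real (card P) * (2 * L * \<eta>)"
    using L\<eta> by simp
  also have "\<dots> \<le> real (n0 * (card (lattice_pts m))\<^sup>2) * (2 * L * \<eta>)"
  proof (intro mult_right_mono)
    have "card P \<le> n0 * (card (lattice_pts m))\<^sup>2"
      using P(3) card_gauss_products_le_square[of m] by (meson mult_le_mono2 order_trans)
    then show "real (card P) \<le> real (n0 * (card (lattice_pts m))\<^sup>2)" by (simp only: of_nat_le_iff)
  qed (use L\<eta> in auto)
  finally show False using lr lr' by (simp add: mult_ac)
qed

end

section \<open>Eigenfunctions along the curve\<close>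

lemma norm_exp_minus_1_le:
  fixes z :: complex
  assumes "norm z \<le> 1"
  shows "norm (exp z - 1) \<le> 3 * norm z"
proof -
  have "norm (exp z - exp 0) \<le> 3 * norm (z - 0)"
  proof (rule field_differentiable_bound[OF convex_cball[of 0 1], where f' = exp])
    fix w :: complex assume "w \<in> cball 0 1"
    then have "norm (exp w) \<le> exp 1" using norm_exp[of w] by (auto intro: order_trans)
    then show "norm (exp w) \<le> 3" using exp_le by linarith
  qed (use assms in \<open>auto intro!: derivative_eq_intros\<close>)
  then show ?thesis by simp
qed

locale curve_eigenfunction = analytic_curve +
  fixes m :: nat and c :: "int \<times> int \<Rightarrow> complex"
  assumes m: "0 < m" and c: "(\<Sum>\<mu>\<in>lattice_pts m. (cmod (c \<mu>))\<^sup>2) = 1"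
begin

definition lam :: real where "lam = 2 * pi * sqrt (real m)"

definition N :: nat where "N = card (lattice_pts m)"

definition F :: "complex \<Rightarrow> complex" where "F z = eigenfun c m (g1 z) (g2 z)"

definition frequency :: "real \<Rightarrow> int \<times> int \<Rightarrow> real" where
  "frequency a \<mu> = (of_int (fst \<mu>) * p1 a + of_int (snd \<mu>) * p2 a) / sqrt (real m)"

text \<open>The phase at the base point is absorbed into the coefficient. It has modulus 1 because
  the curve is real on \<open>[0, 1]\<close>, so the normalization of \<open>c\<close> carries
  over.\<close>

definition amplitude :: "real \<Rightarrow> int \<times> int \<Rightarrow> complex" where
  "amplitude a \<mu> = c \<mu> * exp (2 * of_real pi * \<i> * (of_int (fst \<mu>) * g1 (of_real a) + of_int (snd \<mu>) * g2 (of_real a)))"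

lemma lam_pos: "0 < lam" using m by (simp add: lam_def)

lemma lattice_pts_nonempty: "lattice_pts m \<noteq> {}" using c by auto

lemma N_pos: "0 < N" unfolding N_def using lattice_pts_nonempty by (simp add: card_gt_0_iff)

lemma sum_c_le: "(\<Sum>\<mu>\<in>lattice_pts m. cmod (c \<mu>)) \<le> real N"
proof -
  have "(\<Sum>\<mu>\<in>lattice_pts m. cmod (c \<mu>))\<^sup>2 \<le> real N"
    unfolding N_def using c by (rule sum_norm_le_sqrt_card)
  also have "\<dots> \<le> (real N)\<^sup>2" using N_pos by (simp add: power2_eq_square)
  finally show ?thesis by (rule power2_le_imp_le) simp
qed

lemma coordinate_le:
  assumes "\<mu> \<in> lattice_pts m"
  shows "\<bar>real_of_int (fst \<mu>)\<bar> \<le> sqrt (real m)" "\<bar>real_of_int (snd \<mu>)\<bar> \<le> sqrt (real m)"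
proof -
  have "cmod (gauss_of \<mu>) = sqrt (real m)"
    using assms unfolding lattice_pts_iff by (simp add: real_sqrt_unique)
  then show "\<bar>real_of_int (fst \<mu>)\<bar> \<le> sqrt (real m)" "\<bar>real_of_int (snd \<mu>)\<bar> \<le> sqrt (real m)"
    using abs_Re_le_cmod[of "gauss_of \<mu>"] abs_Im_le_cmod[of "gauss_of \<mu>"] by (simp_all add: gauss_of_def)
qed

lemma frequency_le:
  assumes a: "a \<in> {0..1}" and \<mu>: "\<mu> \<in> lattice_pts m"
  shows "\<bar>frequency a \<mu>\<bar> \<le> 1"
proof -
  define x where "x = real_of_int (fst \<mu>)"
  define y where "y = real_of_int (snd \<mu>)"
  have "x\<^sup>2 + y\<^sup>2 = real m"
    using \<mu> unfolding lattice_pts_iff cmod_gauss_of_sq by (simp add: x_def y_def)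
  then have "(x * p1 a + y * p2 a)\<^sup>2 + (x * p2 a - y * p1 a)\<^sup>2 = real m * ((p1 a)\<^sup>2 + (p2 a)\<^sup>2)"
  proof -
    assume "x\<^sup>2 + y\<^sup>2 = real m"
    moreover have "(x * p1 a + y * p2 a)\<^sup>2 + (x * p2 a - y * p1 a)\<^sup>2 = (x\<^sup>2 + y\<^sup>2) * ((p1 a)\<^sup>2 + (p2 a)\<^sup>2)"
      by (simp add: power2_eq_square algebra_simps)
    ultimately show ?thesis by simp
  qed
  then have "(x * p1 a + y * p2 a)\<^sup>2 \<le> real m"
    using unit[OF a] zero_le_power2[of "x * p2 a - y * p1 a"] by (simp only: mult_1_right)
  then have "\<bar>x * p1 a + y * p2 a\<bar> \<le> sqrt (real m)"
    by (intro real_le_rsqrt) simp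
  then show ?thesis using m by (simp add: frequency_def x_def y_def)
qed

lemma amplitude_norm:
  assumes a: "a \<in> {0..1}"
  shows "cmod (amplitude a \<mu>) = cmod (c \<mu>)"
proof -
  obtain r1 r2 :: real where r: "g1 (of_real a) = of_real r1" "g2 (of_real a) = of_real r2"
    using real[OF a] by (auto elim!: Reals_cases)
  have "2 * of_real pi * \<i> * (of_int (fst \<mu>) * g1 (of_real a) + of_int (snd \<mu>) * g2 (of_real a))
     = \<i> * of_real (2 * pi * (of_int (fst \<mu>) * r1 + of_int (snd \<mu>) * r2))"
    unfolding r by (simp add: mult_ac)
  then have "cmod (exp (2 * of_real pi * \<i> * (of_int (fst \<mu>) * g1 (of_real a) + of_int (snd \<mu>) * g2 (of_real a)))) = 1"
    by (simp only: norm_exp_i_times)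
  then show ?thesis by (simp add: amplitude_def norm_mult)
qed

lemma amplitude_sum:
  assumes a: "a \<in> {0..1}"
  shows "(\<Sum>\<mu>\<in>lattice_pts m. (cmod (amplitude a \<mu>))\<^sup>2) = 1"
  using c by (simp add: amplitude_norm[OF a])

lemma weighted_coordinates_le:
  assumes "\<mu> \<in> lattice_pts m" "cmod x \<le> B" "cmod y \<le> B"
  shows "cmod (2 * of_real pi * \<i> * (of_int (fst \<mu>) * x + of_int (snd \<mu>) * y)) \<le> 2 * lam * B"
proof -
  have B: "0 \<le> B" using assms(2) norm_ge_zero order_trans by blast
  have "cmod (of_int (fst \<mu>) * x + of_int (snd \<mu>) * y) \<le> \<bar>real_of_int (fst \<mu>)\<bar> * cmod x + \<bar>real_of_int (snd \<mu>)\<bar> * cmod y"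
    by (metis norm_mult norm_of_int norm_triangle_ineq)
  also have "\<dots> \<le> sqrt (real m) * B + sqrt (real m) * B"
    using coordinate_le[OF assms(1)] assms(2,3) B by (intro add_mono mult_mono) auto
  finally have "2 * pi * cmod (of_int (fst \<mu>) * x + of_int (snd \<mu>) * y) \<le> 2 * pi * (sqrt (real m) * B + sqrt (real m) * B)"
    by (intro mult_left_mono) auto
  moreover have "cmod (2 * of_real pi * \<i> * S) = 2 * pi * cmod S" for S by (simp add: norm_mult)
  moreover have "2 * pi * (sqrt (real m) * B + sqrt (real m) * B) = 2 * lam * B" by (simp add: lam_def)
  ultimately show ?thesis by metis
qed

lemma F_expand:
  "F z = (\<Sum>\<mu>\<in>lattice_pts m. amplitude a \<mu> *
     exp (2 * of_real pi * \<i> * (of_int (fst \<mu>) * (g1 z - g1 (of_real a)) + of_int (snd \<mu>) * (g2 z - g2 (of_real a)))))"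
  unfolding F_def eigenfun_def amplitude_def
  by (intro sum.cong refl) (simp add: mult.assoc exp_add[symmetric] algebra_simps)

lemma F_upper:
  assumes a: "a \<in> {0..1}" and z: "cmod (z - of_real a) \<le> R" "R \<le> \<epsilon> / 2"
  shows "cmod (F z) \<le> real N * exp (2 * lam * M * R)"
proof -
  define w where "w = z - of_real a"
  have zw: "z = of_real a + w" by (simp add: w_def)
  have w: "cmod w \<le> \<epsilon> / 2" "cmod w \<le> R" using z by (auto simp: w_def)
  have g: "cmod (g1 z - g1 (of_real a)) \<le> M * R" "cmod (g2 z - g2 (of_real a)) \<le> M * R"
    using lipschitz(1)[OF a w(1)] lipschitz(2)[OF a w(1)] w(2) M unfolding zw
    by (meson mult_left_mono order_trans zero_le_one)+
  have "cmod (F z) \<le> (\<Sum>\<mu>\<in>lattice_pts m. cmod (c \<mu>) * exp (2 * lam * (M * R)))"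
    unfolding F_expand[of z a]
  proof (intro sum_norm_le)
    fix \<mu> assume \<mu>: "\<mu> \<in> lattice_pts m"
    show "cmod (amplitude a \<mu> * exp (2 * of_real pi * \<i> * (of_int (fst \<mu>) * (g1 z - g1 (of_real a)) + of_int (snd \<mu>) * (g2 z - g2 (of_real a)))))
      \<le> cmod (c \<mu>) * exp (2 * lam * (M * R))"
      unfolding norm_mult amplitude_norm[OF a]
      by (intro mult_left_mono order_trans[OF norm_exp]) (use weighted_coordinates_le[OF \<mu> g] in auto)
  qed
  also have "\<dots> \<le> real N * exp (2 * lam * M * R)"
    unfolding sum_distrib_right[symmetric] using sum_c_le by (simp add: mult_right_mono mult.assoc)
  finally show ?thesis .
qed

text \<open>The second order remainder of the curve adds \<open>\<xi> \<mu>\<close> to the exponent,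
  of size at most 2 M |u|^2 / \<lambda> \<le> 1, and then \<open>exp (\<xi> \<mu>) - 1\<close> is at
  most three times as large. The factor \<open>exp \<bar>Im u\<bar>\<close> is harmless on the real
  line; in complex discs it limits the radii for which the approximation helps.\<close>

lemma F_linearized:
  assumes a: "a \<in> {0..1}" and u: "cmod u \<le> lam * \<epsilon> / 2" "2 * M * (cmod u)\<^sup>2 \<le> lam"
  shows "cmod (F (of_real a + u / of_real lam) - (\<Sum>\<mu>\<in>lattice_pts m. amplitude a \<mu> * exp (\<i> * of_real (frequency a \<mu>) * u)))
     \<le> real N * exp \<bar>Im u\<bar> * (6 * M * (cmod u)\<^sup>2 / lam)"
proof -
  define w where "w = u / of_real lam"
  define z where "z = of_real a + w"
  define \<xi> where "\<xi> \<mu> = 2 * of_real pi * \<i> * (of_int (fst \<mu>) * (g1 z - g1 (of_real a) - of_real (p1 a) * w)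
      + of_int (snd \<mu>) * (g2 z - g2 (of_real a) - of_real (p2 a) * w))" for \<mu> :: "int \<times> int"
  have cw: "cmod w = cmod u / lam" using lam_pos by (simp add: w_def norm_divide)
  then have w: "cmod w \<le> \<epsilon> / 2" using u(1) lam_pos unfolding cw by (simp add: pos_divide_le_eq mult_ac)
  have \<xi>: "cmod (\<xi> \<mu>) \<le> 2 * M * (cmod u)\<^sup>2 / lam" if "\<mu> \<in> lattice_pts m" for \<mu>
  proof -
    have "cmod (\<xi> \<mu>) \<le> 2 * lam * (M * (cmod w)\<^sup>2)"
      unfolding \<xi>_def using taylor(1)[OF a w] taylor(2)[OF a w] unfolding z_def
      by (intro weighted_coordinates_le that) auto
    also have "\<dots> = 2 * M * (cmod u)\<^sup>2 / lam"
      using lam_pos by (simp add: cw power2_eq_square field_simps)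
    finally show ?thesis .
  qed
  have split: "exp (2 * of_real pi * \<i> * (of_int (fst \<mu>) * (g1 z - g1 (of_real a)) + of_int (snd \<mu>) * (g2 z - g2 (of_real a))))
     = exp (\<i> * of_real (frequency a \<mu>) * u) * exp (\<xi> \<mu>)" for \<mu> :: "int \<times> int"
  proof -
    have "frequency a \<mu> * lam = 2 * pi * (of_int (fst \<mu>) * p1 a + of_int (snd \<mu>) * p2 a)"
      using m by (simp add: frequency_def lam_def)
    then have "complex_of_real (frequency a \<mu>) * of_real lam = of_real (2 * pi * (of_int (fst \<mu>) * p1 a + of_int (snd \<mu>) * p2 a))"
      by (metis of_real_mult)
    moreover have "u = of_real lam * w" using lam_pos by (simp add: w_def)
    ultimately have "of_real (frequency a \<mu>) * u = of_real (2 * pi * (of_int (fst \<mu>) * p1 a + of_int (snd \<mu>) * p2 a)) * w"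
      by (metis mult.assoc)
    then have "\<i> * of_real (frequency a \<mu>) * u = 2 * of_real pi * \<i> * (of_int (fst \<mu>) * of_real (p1 a) + of_int (snd \<mu>) * of_real (p2 a)) * w"
      by (simp add: mult_ac)
    then have "2 * of_real pi * \<i> * (of_int (fst \<mu>) * (g1 z - g1 (of_real a)) + of_int (snd \<mu>) * (g2 z - g2 (of_real a)))
      = \<i> * of_real (frequency a \<mu>) * u + \<xi> \<mu>"
      by (simp add: \<xi>_def algebra_simps)
    then show ?thesis by (simp add: exp_add)
  qed
  have "F z - (\<Sum>\<mu>\<in>lattice_pts m. amplitude a \<mu> * exp (\<i> * of_real (frequency a \<mu>) * u))
     = (\<Sum>\<mu>\<in>lattice_pts m. amplitude a \<mu> * exp (\<i> * of_real (frequency a \<mu>) * u) * (exp (\<xi> \<mu>) - 1))"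
    unfolding F_expand[of z a] split by (simp add: sum_subtractf algebra_simps)
  also have "cmod \<dots> \<le> (\<Sum>\<mu>\<in>lattice_pts m. cmod (c \<mu>) * (exp \<bar>Im u\<bar> * (6 * M * (cmod u)\<^sup>2 / lam)))"
  proof (intro sum_norm_le)
    fix \<mu> assume \<mu>: "\<mu> \<in> lattice_pts m"
    have "\<bar>frequency a \<mu> * Im u\<bar> \<le> 1 * \<bar>Im u\<bar>"
      unfolding abs_mult using frequency_le[OF a \<mu>] by (intro mult_right_mono) auto
    then have "cmod (exp (\<i> * of_real (frequency a \<mu>) * u)) \<le> exp \<bar>Im u\<bar>" by simp
    moreover have "cmod (exp (\<xi> \<mu>) - 1) \<le> 6 * M * (cmod u)\<^sup>2 / lam"
    proof -
      have "2 * M * (cmod u)\<^sup>2 / lam \<le> 1" using u(2) lam_pos by simp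
      then have "cmod (exp (\<xi> \<mu>) - 1) \<le> 3 * cmod (\<xi> \<mu>)"
        using \<xi>[OF \<mu>] by (intro norm_exp_minus_1_le) linarith
      also have "\<dots> \<le> 3 * (2 * M * (cmod u)\<^sup>2 / lam)" using \<xi>[OF \<mu>] by simp
      finally show ?thesis by simp
    qed
    ultimately show "cmod (amplitude a \<mu> * exp (\<i> * of_real (frequency a \<mu>) * u) * (exp (\<xi> \<mu>) - 1))
      \<le> cmod (c \<mu>) * (exp \<bar>Im u\<bar> * (6 * M * (cmod u)\<^sup>2 / lam))"
      unfolding norm_mult amplitude_norm[OF a] mult.assoc by (intro mult_left_mono mult_mono) auto
  qed
  also have "\<dots> \<le> real N * (exp \<bar>Im u\<bar> * (6 * M * (cmod u)\<^sup>2 / lam))"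
    unfolding sum_distrib_right[symmetric] using sum_c_le M lam_pos
    by (intro mult_right_mono mult_nonneg_nonneg divide_nonneg_pos) auto
  finally show ?thesis by (simp add: z_def w_def mult.assoc)
qed

lemma F_holomorphic: "F holomorphic_on nbhd01 \<epsilon>"
  unfolding F_def eigenfun_def by (intro holomorphic_intros hol)

lemma frequency_separated:
  assumes good: "good_point m \<eta> a" and a: "a \<in> {0..1}" and \<delta>: "0 \<le> \<eta>"
    and sep: "\<And>\<mu> \<nu>. \<mu> \<in> lattice_pts m \<Longrightarrow> \<nu> \<in> lattice_pts m \<Longrightarrow> \<mu> \<noteq> \<nu> \<Longrightarrow>
        \<delta> * sqrt (real m) \<le> cmod (gauss_of \<mu> - gauss_of \<nu>)"
    and mn: "\<mu> \<in> lattice_pts m" "\<nu> \<in> lattice_pts m" "\<mu> \<noteq> \<nu>"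
  shows "\<eta> * \<delta> \<le> \<bar>frequency a \<mu> - frequency a \<nu>\<bar> \<and> \<bar>frequency a \<mu> - frequency a \<nu>\<bar> \<le> 2"
proof
  have "\<eta> * (\<delta> * sqrt (real m)) \<le> \<eta> * cmod (gauss_of \<mu> - gauss_of \<nu>)"
    using sep[OF mn] \<delta> by (rule mult_left_mono)
  also have "\<dots> \<le> \<bar>Re (gauss_of \<mu> - gauss_of \<nu>) * p1 a + Im (gauss_of \<mu> - gauss_of \<nu>) * p2 a\<bar>"
    using good mn unfolding good_point_def by blast
  also have "\<dots> = \<bar>(frequency a \<mu> - frequency a \<nu>) * sqrt (real m)\<bar>"
  proof -
    have "frequency a \<rho> * sqrt (real m) = of_int (fst \<rho>) * p1 a + of_int (snd \<rho>) * p2 a" for \<rho>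
      using m by (simp add: frequency_def)
    then show ?thesis unfolding left_diff_distrib by (simp add: gauss_of_def algebra_simps)
  qed
  finally have "(\<eta> * \<delta>) * sqrt (real m) \<le> \<bar>frequency a \<mu> - frequency a \<nu>\<bar> * sqrt (real m)"
    by (simp add: abs_mult mult.assoc)
  then show "\<eta> * \<delta> \<le> \<bar>frequency a \<mu> - frequency a \<nu>\<bar>" using m by simp
  show "\<bar>frequency a \<mu> - frequency a \<nu>\<bar> \<le> 2"
    using frequency_le[OF a mn(1)] frequency_le[OF a mn(2)] by linarith
qed

end

section \<open>Zeros of eigenfunctions for typical eigenvalues\<close>

text \<open>With \<open>\<rho> \<le> c0\<close> there is room for discs of radius
  \<open>13 * \<rho>\<close> in the \<open>\<epsilon> / 2\<close> neighbourhood, and for an interval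
  of length \<open>\<rho>\<close> in \<open>[0, 1]\<close> on one side of any point.\<close>

definition (in analytic_curve) c0 :: real where "c0 = min \<epsilon> 1 / 52"

text \<open>The parameter \<open>q\<close> is \<open>m\<close> to the power \<open>1/200\<close>, so that \<open>\<lambda> = 2 \<pi> q\<^sup>1\<^sup>0\<^sup>0\<close>.\<close>

definition large_param :: "real \<Rightarrow> real \<Rightarrow> real \<Rightarrow> real \<Rightarrow> real \<Rightarrow> bool" where
  "large_param M \<epsilon> c K q \<longleftrightarrow> 2 \<le> q \<and> 1 \<le> 200 * ln q \<and>
     (2 * (200 * ln q) powr (5 / 6) + 1) * ln (32 * (200 * ln q) ^ 5) \<le> 200 * ln q / 8 \<and>
     12 * M * q ^ 40 \<le> 2 * pi * q ^ 100 \<and> 18 * q ^ 7 \<le> \<epsilon> * (2 * pi * q ^ 100) \<and>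
     162 * M * q ^ 14 \<le> 2 * pi * q ^ 100 \<and> 972 * M * q ^ 58 \<le> 2 * pi * q ^ 100 \<and>
     K * q ^ 6 * sqrt ((200 * ln q) ^ 5) + 1 \<le> q ^ 20 \<and> 24 * M * q ^ 41 \<le> 2 * pi * q ^ 100 \<and>
     q ^ 23 \<le> c * (2 * pi * q ^ 100) \<and> 4 * q ^ 4 \<le> 2 * pi * q ^ 100"

text \<open>The exponents of \<open>q\<close> add up as follows. For r = N^7 one has N r^2 \<le>
  q^15; against a lower bound q^(-25) this gives 40, and a further factor exp(9 r) \<le> q^18 gives
  58. Sample points up to q^20 give 41 = 1 + 2 * 20 and, divided by \<open>\<lambda>\<close> and
  compared with N^(-3), 23 = 20 + 3.\<close>

lemma eventually_large_param:
  assumes "0 < M" "0 < \<epsilon>" "0 < c" "0 < K"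
  shows "eventually (large_param M \<epsilon> c K) at_top"
  unfolding large_param_def[abs_def] by (intro eventually_conj; use assms in real_asymp)

lemma (in analytic_curve) c0: "0 < c0" "52 * c0 \<le> \<epsilon>" "52 * c0 \<le> 1"
  using eps by (auto simp: c0_def)

locale large_eigenfunction = curve_eigenfunction +
  fixes q :: real
  assumes q: "real m = q ^ 200" "large_param M \<epsilon> c0 (32 * L * real n0 / c0) q" "real (card (lattice_pts m)) \<le> q"
    and separated: "\<mu> \<in> lattice_pts m \<Longrightarrow> \<nu> \<in> lattice_pts m \<Longrightarrow> \<mu> \<noteq> \<nu> \<Longrightarrow>
      real m \<le> (cmod (gauss_of \<mu> - gauss_of \<nu>))\<^sup>2 * ln (real m) ^ 5"
begin

definition y :: real where "y = ln (real m)"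

definition Y5 :: real where "Y5 = sqrt (y ^ 5)"

definition P :: "real \<Rightarrow> complex \<Rightarrow> complex" where
  "P a u = (\<Sum>\<mu>\<in>lattice_pts m. amplitude a \<mu> * exp (\<i> * of_real (frequency a \<mu>) * u))"

lemma q2: "2 \<le> q" using q(2) by (simp add: large_param_def)

lemma Nq: "real N \<le> q" using q(3) by (simp add: N_def)

lemma N1: "1 \<le> real N" using N_pos by simp

lemma y_q: "y = 200 * ln q" using q2 by (simp add: y_def q(1) ln_realpow)

lemma y1: "1 \<le> y" using q(2) unfolding y_q by (simp add: large_param_def)

lemma lam_q: "lam = 2 * pi * q ^ 100"
proof -
  have "real m = (q ^ 100)\<^sup>2" by (simp add: q(1) flip: power_mult)
  then have "sqrt (real m) = \<bar>q ^ 100\<bar>" by (simp only: real_sqrt_abs)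
  then have "sqrt (real m) = q ^ 100" using q2 by simp
  then show ?thesis by (simp add: lam_def)
qed

lemma large:
  "(2 * y powr (5 / 6) + 1) * ln (32 * y ^ 5) \<le> y / 8" "12 * M * q ^ 40 \<le> lam" "18 * q ^ 7 \<le> \<epsilon> * lam"
  "162 * M * q ^ 14 \<le> lam" "972 * M * q ^ 58 \<le> lam" "32 * L * real n0 / c0 * q ^ 6 * Y5 + 1 \<le> q ^ 20"
  "24 * M * q ^ 41 \<le> lam" "q ^ 23 \<le> c0 * lam" "4 * q ^ 4 \<le> lam"
  using q(2) unfolding y_q lam_q Y5_def large_param_def by blast+

lemma Y5: "1 \<le> Y5" "Y5\<^sup>2 = y ^ 5"
  using y1 one_le_power[of y 5] by (simp_all add: Y5_def)

lemma N_power_le: "real N ^ k \<le> q ^ k" using Nq by (intro power_mono) auto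

lemma separated_Y5:
  assumes "\<mu> \<in> lattice_pts m" "\<nu> \<in> lattice_pts m" "\<mu> \<noteq> \<nu>"
  shows "(1 / Y5) * sqrt (real m) \<le> cmod (gauss_of \<mu> - gauss_of \<nu>)"
proof -
  have "sqrt (real m) \<le> sqrt ((cmod (gauss_of \<mu> - gauss_of \<nu>))\<^sup>2 * y ^ 5)"
    using separated[OF assms] by (simp add: y_def)
  also have "\<dots> = cmod (gauss_of \<mu> - gauss_of \<nu>) * Y5" by (simp add: real_sqrt_mult Y5_def)
  finally show ?thesis using Y5 by (simp add: field_simps)
qed

lemma frequency_separated_Y5:
  assumes "good_point m \<eta> a" "a \<in> {0..1}" "0 \<le> \<eta>" "\<mu> \<in> lattice_pts m" "\<nu> \<in> lattice_pts m" "\<mu> \<noteq> \<nu>"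
  shows "\<eta> / Y5 \<le> \<bar>frequency a \<mu> - frequency a \<nu>\<bar> \<and> \<bar>frequency a \<mu> - frequency a \<nu>\<bar> \<le> 2"
  using frequency_separated[OF assms(1-3) separated_Y5 assms(4-6)] by simp

lemma P_of_nat: "P a (of_nat n) = (\<Sum>\<mu>\<in>lattice_pts m. amplitude a \<mu> * cis (frequency a \<mu>) ^ n)"
  unfolding P_def by (intro sum.cong refl) (simp add: cis_conv_exp exp_of_nat_mult[symmetric] mult_ac)

lemma P_mean_lower:
  assumes good: "good_point m \<eta> a" and a: "a \<in> {0..1}" and \<eta>: "0 < \<eta>" and T: "8 * real N * Y5 \<le> \<eta> * real T"
  shows "\<exists>n<T. 1 / 2 \<le> cmod (P a (of_nat n))"
  unfolding P_of_nat
proof (rule exp_sum_mean_lower)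
  show "8 * real (card (lattice_pts m)) \<le> \<eta> / Y5 * real T"
    using T Y5 by (simp add: N_def field_simps)
  show "0 < \<eta> / Y5" using \<eta> Y5 by simp
qed (use frequency_separated_Y5[OF good a] amplitude_sum[OF a] \<eta> in auto)

lemma P_lower:
  assumes good: "good_point m (1 / real N ^ 3) a" and a: "a \<in> {0..1}"
  shows "\<exists>n\<le>N ^ 7. 1 / q ^ 25 \<le> cmod (P a (of_nat n))"
proof (cases "8 * Y5 \<le> real N ^ 3")
  case True
  have "8 * real N * Y5 \<le> real N * real N ^ 3" using True N1 by (simp add: mult.commute mult_left_mono)
  also have "\<dots> = 1 / real N ^ 3 * real (N ^ 7)" using N1 by (simp add: field_simps flip: power_add power_Suc)
  finally have T: "8 * real N * Y5 \<le> 1 / real N ^ 3 * real (N ^ 7)" .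
  have "0 < 1 / real N ^ 3" using N1 by simp
  from P_mean_lower[OF good a this T] obtain n where "n < N ^ 7" "1 / 2 \<le> cmod (P a (of_nat n))"
    by blast
  moreover have "2 \<le> q ^ 25" using q2 self_le_power[of q 25] by simp
  then have "1 / q ^ 25 \<le> 1 / 2" using q2 by (simp add: field_simps)
  ultimately show ?thesis by (intro exI[of _ n]) auto
next
  case False
  define s where "s = 1 / real N ^ 3 / Y5"
  \<comment> \<open>\<open>E\<close> dominates both 4 / s = 4 N^3 Y5, which is at most 32 Y5^2 in
    this case, and N; so the lower bound \<open>(s / 4) ^ N / N\<close> is at least
    E^(-(N+1)).\<close>
  define E where "E = 32 * y ^ 5"
  have N3: "1 \<le> real N ^ 3" using N1 by (rule one_le_power)
  have pos: "1 \<le> real N ^ 3 * Y5" using N3 Y5 mult_mono[of 1 "real N ^ 3" 1 Y5] by simp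
  have "s = 1 / (real N ^ 3 * Y5)" by (simp add: s_def)
  moreover have "0 < 1 / x \<and> 1 / x \<le> 2" if "1 \<le> x" for x :: real
    using that by (simp add: field_simps)
  ultimately have s: "0 < s" "s \<le> 2" using pos by auto
  have "\<exists>n<card (lattice_pts m). (s / 4) ^ card (lattice_pts m) / real (card (lattice_pts m)) \<le> cmod (P a (of_nat n))"
    unfolding P_of_nat
    by (rule exp_sum_difference_lower)
       (use frequency_separated_Y5[OF good a] amplitude_sum[OF a] s in \<open>auto simp: s_def\<close>)
  then obtain n where n: "n < N" "(s / 4) ^ N / real N \<le> cmod (P a (of_nat n))"
    by (auto simp: N_def)
  have Y52: "Y5 \<le> Y5\<^sup>2" using Y5(1) by (simp add: power2_eq_square)
  have E1: "1 \<le> E" using one_le_power[OF y1, of 5] unfolding E_def by linarith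
  have "4 * (real N ^ 3 * Y5) \<le> 4 * (8 * Y5 * Y5)" using False Y5 by (intro mult_left_mono mult_right_mono) auto
  also have "\<dots> = E" using Y5(2) by (simp add: E_def power2_eq_square)
  finally have "4 * (real N ^ 3 * Y5) \<le> E" .
  moreover have "0 < real N ^ 3 * Y5" using pos by linarith
  ultimately have "1 / E \<le> 1 / (4 * (real N ^ 3 * Y5))" by (intro frac_le) linarith+
  then have "1 / E \<le> s / 4" by (simp add: s_def)
  then have "(1 / E) ^ N \<le> (s / 4) ^ N" using E1 by (intro power_mono) auto
  moreover have "real N \<le> E"
  proof -
    have "real N \<le> real N ^ 3" using N1 by (intro self_le_power) auto
    also have "\<dots> \<le> 8 * Y5\<^sup>2" using False Y52 by simp
    also have "\<dots> \<le> E" using Y5(2) y1 by (simp add: E_def)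
    finally show ?thesis .
  qed
  then have "1 / E \<le> 1 / real N" using N1 by (intro divide_left_mono) auto
  ultimately have "(1 / E) ^ N * (1 / E) \<le> (s / 4) ^ N * (1 / real N)"
    using E1 s by (intro mult_mono) auto
  \<comment> \<open>From N^3 < 8 Y5 = 8 y^(5/2) follows N < 2 y^(5/6), hence (N + 1) ln E \<le> y /
    8, which equals 25 ln q.\<close>
  moreover have "1 / q ^ 25 \<le> (1 / E) ^ N * (1 / E)"
  proof -
    have "real N < 2 * y powr (5 / 6)"
    proof (rule power_less_imp_less_base)
      have "(2 * y powr (5 / 6)) ^ 3 = 8 * y powr (5 / 2)"
        using y1 by (simp add: power_mult_distrib powr_power)
      also have "y powr (5 / 2) = Y5"
        using y1 by (simp add: Y5_def powr_half_sqrt[symmetric] powr_powr flip: powr_numeral)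
      finally show "real N ^ 3 < (2 * y powr (5 / 6)) ^ 3" using False by simp
    qed simp
    then have "(real N + 1) * ln E \<le> (2 * y powr (5 / 6) + 1) * ln E"
      using E1 by (intro mult_right_mono) auto
    also have "\<dots> \<le> y / 8" unfolding E_def by (rule large(1))
    finally have "real (Suc N) * ln E \<le> 25 * ln q" by (simp add: y_q add.commute)
    then have "exp (real (Suc N) * ln E) \<le> exp (real 25 * ln q)" by simp
    then have "E ^ Suc N \<le> q ^ 25"
      using E1 q2 unfolding exp_of_nat_mult by simp
    then have "1 / q ^ 25 \<le> 1 / E ^ Suc N" using E1 q2 by (intro divide_left_mono) auto
    then show ?thesis by (simp add: power_divide mult.commute)
  qed
  ultimately have "1 / q ^ 25 \<le> cmod (P a (of_nat n))" using n(2) by simp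
  moreover have "N \<le> N ^ 7" using N_pos by (intro self_le_power) auto
  ultimately show ?thesis using n(1) by (intro exI[of _ n]) auto
qed

lemma F_near_P:
  assumes a: "a \<in> {0..1}" and u: "cmod u \<le> B" and B: "2 * B \<le> \<epsilon> * lam" "2 * M * B\<^sup>2 \<le> lam"
  shows "cmod (F (of_real a + u / of_real lam) - P a u) \<le> real N * exp \<bar>Im u\<bar> * (6 * M * B\<^sup>2 / lam)"
proof -
  have uB: "(cmod u)\<^sup>2 \<le> B\<^sup>2" using u by (intro power_mono) auto
  have "cmod u \<le> lam * \<epsilon> / 2" using u B by (simp add: mult.commute)
  moreover have "2 * M * (cmod u)\<^sup>2 \<le> 2 * M * B\<^sup>2" using uB M by simp
  then have "2 * M * (cmod u)\<^sup>2 \<le> lam" using B by linarith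
  ultimately have "cmod (F (of_real a + u / of_real lam) - P a u) \<le> real N * exp \<bar>Im u\<bar> * (6 * M * (cmod u)\<^sup>2 / lam)"
    unfolding P_def by (rule F_linearized[OF a])
  also have "\<dots> \<le> real N * exp \<bar>Im u\<bar> * (6 * M * B\<^sup>2 / lam)"
    using uB M lam_pos by (intro mult_left_mono divide_right_mono) auto
  finally show ?thesis .
qed

lemma zeros_near_good_point:
  assumes good: "good_point m (1 / real N ^ 3) a" and a: "a \<in> {0..1}"
  defines "Z \<equiv> {z \<in> ball (of_real a) (real N ^ 7 / lam) \<inter> nbhd01 \<epsilon>. F z = 0}"
  shows "finite Z" "real (card Z) \<le> (18 * M + 15) * real N ^ 7"
proof -
  define r where "r = real N ^ 7"
  define R where "R = r / lam"
  have r1: "1 \<le> r" unfolding r_def using N1 by (rule one_le_power)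
  have Nr: "real N \<le> r" unfolding r_def using N1 by (intro self_le_power) auto
  have rq: "r \<le> q ^ 7" unfolding r_def by (rule N_power_le)
  have R0: "0 < R" using r1 lam_pos by (simp add: R_def)
  have M0: "0 < M" using M by simp
  have "18 * r \<le> \<epsilon> * lam" using rq large(3) by linarith
  then have R9: "9 * R \<le> \<epsilon> / 2" using lam_pos by (simp add: R_def field_simps)
  have r2: "r\<^sup>2 \<le> q ^ 14"
    using power_mono[OF rq, of 2] r1 by (simp flip: power_mult)
  have M2r: "2 * M * (9 * r)\<^sup>2 \<le> lam"
  proof -
    have "2 * M * (9 * r)\<^sup>2 = 162 * M * r\<^sup>2" by (simp add: power_mult_distrib)
    also have "\<dots> \<le> 162 * M * q ^ 14" using r2 M0 by simp
    finally show ?thesis using large(4) by linarith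
  qed
  have er: "2 * (9 * r) \<le> \<epsilon> * lam" using \<open>18 * r \<le> \<epsilon> * lam\<close> by simp
  have q25: "0 < q ^ 25" using q2 by simp
  have Nq15: "real N * r\<^sup>2 \<le> q ^ 15"
  proof -
    have "real N * r\<^sup>2 \<le> q * q ^ 14" using Nq r2 q2 by (intro mult_mono) auto
    then show ?thesis by (simp flip: power_Suc)
  qed
  \<comment> \<open>Both \<open>z0\<close> and the zeros lie within \<open>R\<close> of
    \<open>a\<close>, so the zeros are within \<open>2 * R\<close> of \<open>z0\<close>. Zero
    counting asks for four times that radius, and the disc of radius \<open>8 * R\<close> about
    \<open>z0\<close> stays within \<open>9 * R\<close> of \<open>a\<close>.\<close>
  have "\<exists>z0. cmod (z0 - of_real a) \<le> R \<and> F z0 \<noteq> 0 \<and>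
      (\<exists>M'. (\<forall>z\<in>cball z0 (8 * R). cmod (F z) \<le> M') \<and> M' \<le> exp ((18 * M + 15) * r) * cmod (F z0))"
  \<comment> \<open>The threshold is 2 ln q. Above it q^25 \<le> exp(25 r / 2), so the loss in the
    lower bound fits into the exponent. Below it exp(9 r) < q^18, so linearization is accurate in
    the whole complex disc.\<close>
  proof (cases "y / 100 \<le> r")
    case True
    obtain n where n: "n \<le> N ^ 7" "1 / q ^ 25 \<le> cmod (P a (of_nat n))" using P_lower[OF good a] by blast
    have nr: "real n \<le> r" using n(1) by (simp add: r_def flip: of_nat_power)
    define z0 where "z0 = of_real a + of_nat n / complex_of_real lam"
    have z0: "cmod (z0 - of_real a) \<le> R" using nr lam_pos by (simp add: z0_def R_def norm_divide divide_right_mono)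
    have "cmod (F z0 - P a (of_nat n)) \<le> real N * exp \<bar>Im (of_nat n)\<bar> * (6 * M * r\<^sup>2 / lam)"
      unfolding z0_def
    proof (rule F_near_P[OF a])
      show "2 * r \<le> \<epsilon> * lam" using er r1 by linarith
      have "2 * M * r\<^sup>2 \<le> 2 * M * (9 * r)\<^sup>2" using M0 by (simp add: power_mult_distrib)
      then show "2 * M * r\<^sup>2 \<le> lam" using M2r by linarith
    qed (use nr in simp)
    also have "\<dots> = 6 * M * (real N * r\<^sup>2) / lam" by simp
    also have "\<dots> \<le> 6 * M * q ^ 15 / lam" using Nq15 M0 lam_pos by (intro divide_right_mono mult_left_mono) auto
    also have "\<dots> \<le> 1 / (2 * q ^ 25)"
    proof -
      have "12 * M * (q ^ 15 * q ^ 25) \<le> lam" using large(2) by (simp flip: power_add)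
      then show ?thesis using lam_pos q25 by (simp add: field_simps)
    qed
    finally have "cmod (F z0 - P a (of_nat n)) \<le> 1 / (2 * q ^ 25)" .
    moreover have "cmod (P a (of_nat n)) \<le> cmod (F z0) + cmod (F z0 - P a (of_nat n))"
      by (metis add.commute norm_minus_commute norm_triangle_sub)
    moreover have "1 / q ^ 25 = 1 / (2 * q ^ 25) + 1 / (2 * q ^ 25)" by simp
    ultimately have Fz0: "1 / (2 * q ^ 25) \<le> cmod (F z0)" using n(2) by linarith
    have up: "\<forall>z\<in>cball z0 (8 * R). cmod (F z) \<le> real N * exp (18 * M * r)"
    proof
      fix z assume "z \<in> cball z0 (8 * R)"
      then have "cmod (z - of_real a) \<le> 9 * R"
        using z0 norm_triangle_ineq[of "z - z0" "z0 - of_real a"] by (simp add: dist_norm norm_minus_commute)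
      then have "cmod (F z) \<le> real N * exp (2 * lam * M * (9 * R))" using R9 by (rule F_upper[OF a])
      also have "2 * lam * M * (9 * R) = 18 * M * r" using lam_pos by (simp add: R_def)
      finally show "cmod (F z) \<le> real N * exp (18 * M * r)" .
    qed
    have "q ^ 25 = exp (25 * ln q)" using q2 exp_of_nat_mult[of 25 "ln q"] by simp
    also have "\<dots> \<le> exp (25 / 2 * r)" using True by (simp add: y_q)
    finally have qe: "q ^ 25 \<le> exp (25 / 2 * r)" .
    have "real N \<le> exp (real N - 1)" using exp_ge_add_one_self[of "real N - 1"] by simp
    also have "\<dots> \<le> exp (r - 1)" using Nr by simp
    finally have Ne: "real N \<le> exp (r - 1)" .
    have "real N * exp (18 * M * r) * (2 * q ^ 25) \<le> exp (r - 1) * exp (18 * M * r) * (exp 1 * exp (25 / 2 * r))"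
      using Ne qe q25 exp_ge_add_one_self[of 1] by (intro mult_mono) auto
    also have "\<dots> = exp (18 * M * r + 27 / 2 * r)" by (simp flip: exp_add)
    also have "\<dots> \<le> exp ((18 * M + 15) * r)" using r1 by (simp add: algebra_simps)
    finally have "real N * exp (18 * M * r) \<le> exp ((18 * M + 15) * r) * (1 / (2 * q ^ 25))"
      using q25 by (simp add: field_simps)
    also have "\<dots> \<le> exp ((18 * M + 15) * r) * cmod (F z0)" using Fz0 by (intro mult_left_mono) auto
    finally have "real N * exp (18 * M * r) \<le> exp ((18 * M + 15) * r) * cmod (F z0)" .
    moreover have "F z0 \<noteq> 0" using Fz0 q25 by (auto simp: field_simps)
    ultimately show ?thesis using z0 up by blast
  next
    case False
    have "continuous_on (cball 0 r) (\<lambda>u. cmod (P a u))" unfolding P_def by (intro continuous_intros)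
    \<comment> \<open>The maximum over the disc replaces the integer sample: growth is then measured
      relative to \<open>S\<close>, and the bound q^(-25) for \<open>S\<close> has only to beat the
      linearization error.\<close>
    then obtain u0 where u0: "u0 \<in> cball 0 r" "\<And>u. u \<in> cball 0 r \<Longrightarrow> cmod (P a u) \<le> cmod (P a u0)"
      using continuous_attains_sup[of "cball 0 r" "\<lambda>u. cmod (P a u)"] r1 by force
    define S where "S = cmod (P a u0)"
    obtain n where n: "n \<le> N ^ 7" "1 / q ^ 25 \<le> cmod (P a (of_nat n))" using P_lower[OF good a] by blast
    have "real n \<le> r" using n(1) by (simp add: r_def flip: of_nat_power)
    then have S: "1 / q ^ 25 \<le> S" using n(2) u0(2)[of "of_nat n"] unfolding S_def by simp
    have S0: "0 < S" by (rule less_le_trans[OF _ S]) (use q25 in simp)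
    have near: "cmod (F (of_real a + u / of_real lam) - P a u) \<le> S / 2" if "cmod u \<le> 9 * r" for u
    proof -
      have "cmod (F (of_real a + u / of_real lam) - P a u) \<le> real N * exp \<bar>Im u\<bar> * (6 * M * (9 * r)\<^sup>2 / lam)"
        by (rule F_near_P[OF a that er M2r])
      also have "\<dots> \<le> real N * exp (9 * r) * (6 * M * (9 * r)\<^sup>2 / lam)"
        using that abs_Im_le_cmod[of u] M0 lam_pos by (intro mult_left_mono mult_right_mono) auto
      also have "\<dots> = 486 * M * (real N * r\<^sup>2) * exp (9 * r) / lam" by (simp add: power_mult_distrib)
      also have "exp (9 * r) \<le> exp (18 * ln q)" using False by (simp add: y_q)
      also have "exp (18 * ln q) = q ^ 18" using q2 exp_of_nat_mult[of 18 "ln q"] by simp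
      also have "486 * M * (real N * r\<^sup>2) * q ^ 18 / lam \<le> 486 * M * q ^ 15 * q ^ 18 / lam"
        using Nq15 M0 lam_pos q2 by (intro divide_right_mono mult_left_mono mult_right_mono) auto
      also have "\<dots> \<le> 1 / q ^ 25 / 2"
      proof -
        have "972 * M * (q ^ 15 * q ^ 18 * q ^ 25) \<le> lam" using large(5) by (simp flip: power_add)
        then show ?thesis using lam_pos q25 by (simp add: field_simps)
      qed
      also have "\<dots> \<le> S / 2" using S by simp
      finally show ?thesis
        using M0 lam_pos N1 by (simp add: divide_right_mono mult_left_mono)
    qed
    define z0 where "z0 = of_real a + u0 / complex_of_real lam"
    have u0r: "cmod u0 \<le> r" using u0(1) by simp
    have z0: "cmod (z0 - of_real a) \<le> R" using u0r lam_pos by (simp add: z0_def R_def norm_divide divide_right_mono)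
    have "cmod (P a u0) \<le> cmod (F z0) + cmod (F z0 - P a u0)"
      by (metis add.commute norm_minus_commute norm_triangle_sub)
    then have Fz0: "S / 2 \<le> cmod (F z0)"
      using near[of u0] u0r r1 unfolding S_def z0_def by simp
    define G where "G = 3 ^ (9 * N) * exp (9 * r)"
    have G1: "1 \<le> G"
      unfolding G_def using r1 one_le_power[of "3::real" "9 * N"] mult_mono[of 1 "3 ^ (9 * N)" 1 "exp (9 * r)"] by simp
    have up: "\<forall>z\<in>cball z0 (8 * R). cmod (F z) \<le> 2 * G * S"
    proof
      fix z assume z: "z \<in> cball z0 (8 * R)"
      define u where "u = (z - of_real a) * of_real lam"
      have "cmod (z - of_real a) \<le> 9 * R"
        using z z0 norm_triangle_ineq[of "z - z0" "z0 - of_real a"] by (simp add: dist_norm norm_minus_commute)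
      then have "cmod (z - of_real a) * lam \<le> 9 * R * lam" using lam_pos by simp
      then have u: "cmod u \<le> 9 * r" using lam_pos by (simp add: u_def R_def norm_mult)
      have zu: "z = of_real a + u / of_real lam" using lam_pos by (simp add: u_def)
      have "cmod (P a u) \<le> G * S"
        unfolding P_def G_def N_def
      proof (rule exp_sum_growth)
        fix w :: complex assume "cmod w \<le> r"
        then show "cmod (\<Sum>j\<in>lattice_pts m. amplitude a j * exp (\<i> * of_real (frequency a j) * w)) \<le> S"
          using u0(2)[of w] by (simp add: S_def P_def)
      qed (use lattice_pts_nonempty frequency_le[OF a] u in auto)
      moreover have "cmod (F z) \<le> cmod (P a u) + cmod (F z - P a u)" by (metis norm_triangle_sub)
      moreover have "cmod (F z - P a u) \<le> S / 2" unfolding zu by (rule near[OF u])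
      moreover have "S \<le> G * S" using G1 S0 by simp
      ultimately show "cmod (F z) \<le> 2 * G * S" using S0 by linarith
    qed
    have "3 ^ (9 * N) \<le> exp (18 * r)"
    proof -
      have "(3::real) ^ (9 * N) \<le> exp 2 ^ (9 * N)" using exp_ge_add_one_self[of 2] by (intro power_mono) auto
      also have "\<dots> = exp (real (9 * N) * 2)" by (rule exp_of_nat_mult[symmetric])
      also have "\<dots> \<le> exp (18 * r)" using Nr by simp
      finally show ?thesis .
    qed
    then have "4 * G \<le> (exp 1 * exp 1) * (exp (18 * r) * exp (9 * r))"
      unfolding G_def using exp_ge_add_one_self[of 1] mult_mono[of 2 "exp 1" 2 "exp (1::real)"] by (intro mult_mono) auto
    also have "\<dots> = exp (2 + 27 * r)" by (simp flip: exp_add)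
    also have "\<dots> \<le> exp ((18 * M + 15) * r)"
    proof -
      \<comment> \<open>By \<open>1 \<le> M\<close> the constant is at least 33, while at most 29 is
        needed: 18 from \<open>3 ^ (9 * N)\<close>, 9 from \<open>exp (9 * r)\<close> and 2 from the
        factor 4.\<close>
      have "33 * r \<le> (18 * M + 15) * r" using M r1 by (intro mult_right_mono) auto
      then have "2 + 27 * r \<le> (18 * M + 15) * r" using r1 by linarith
      then show ?thesis by simp
    qed
    finally have "4 * G \<le> exp ((18 * M + 15) * r)" .
    then have "4 * G * (S / 2) \<le> exp ((18 * M + 15) * r) * cmod (F z0)"
      using Fz0 S0 by (intro mult_mono) auto
    then have "2 * G * S \<le> exp ((18 * M + 15) * r) * cmod (F z0)" by simp
    moreover have "F z0 \<noteq> 0" using Fz0 S0 by auto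
    ultimately show ?thesis using z0 up by blast
  qed
  then obtain z0 M' where z0: "cmod (z0 - of_real a) \<le> R" "F z0 \<noteq> 0"
    "\<And>z. z \<in> cball z0 (8 * R) \<Longrightarrow> cmod (F z) \<le> M'" "M' \<le> exp ((18 * M + 15) * r) * cmod (F z0)" by blast
  have sub: "cball z0 (8 * R) \<subseteq> nbhd01 \<epsilon>"
  proof
    fix z assume "z \<in> cball z0 (8 * R)"
    then have "cmod (z - of_real a) \<le> 9 * R"
      using z0(1) norm_triangle_ineq[of "z - z0" "z0 - of_real a"] by (simp add: dist_norm norm_minus_commute)
    then show "z \<in> nbhd01 \<epsilon>" using R9 eps a by (intro nbhd01I[of a]) auto
  qed
  have Z: "Z \<subseteq> {z \<in> cball z0 (2 * R). F z = 0}"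
  proof
    fix z assume "z \<in> Z"
    then have "cmod (z - of_real a) \<le> R" "F z = 0"
      by (auto simp: Z_def R_def r_def dist_norm norm_minus_commute)
    then show "z \<in> {z \<in> cball z0 (2 * R). F z = 0}"
      using z0(1) norm_triangle_ineq4[of "z0 - of_real a" "z - of_real a"] by (simp add: dist_norm)
  qed
  show "finite Z" "real (card Z) \<le> (18 * M + 15) * real N ^ 7"
    using card_zeros_le[OF open_nbhd01 sub _ _ _ F_holomorphic z0(2,3,4) Z] R0 unfolding r_def[symmetric] by auto
qed

section \<open>Zeros near arbitrary points, on the scale of the intervals\<close>

definition \<rho> :: real where "\<rho> = c0 / real N ^ 3"

lemma \<rho>: "0 < \<rho>" "52 * \<rho> \<le> \<epsilon>" "52 * \<rho> \<le> 1"
proof -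
  have "1 \<le> real N ^ 3" using N1 by (rule one_le_power)
  moreover have "c0 / x \<le> c0 / 1" if "1 \<le> x" for x :: real using that c0 by (simp add: field_simps)
  ultimately have "c0 / real N ^ 3 \<le> c0 / 1" by blast
  moreover have "0 < \<rho>" unfolding \<rho>_def using c0 N1 by (intro divide_pos_pos zero_less_power) auto
  ultimately have "\<rho> \<le> c0" "0 < \<rho>" by (simp_all add: \<rho>_def)
  then show "0 < \<rho>" "52 * \<rho> \<le> \<epsilon>" "52 * \<rho> \<le> 1" using c0 by linarith+
qed

lemma zeros_near_any_point:
  assumes x: "x \<in> {0..1}"
  defines "Z \<equiv> {z \<in> cball (of_real x) \<rho>. F z = 0}"
  shows "finite Z" "real (card Z) \<le> (1 + 26 * M * c0) * (lam / real N ^ 3)"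
proof -
  \<comment> \<open>For this threshold the bad points have measure at most
    \<open>\<rho> / 2\<close>, so an interval of length \<open>\<rho>\<close> cannot be entirely
    bad.\<close>
  define \<eta> where "\<eta> = \<rho> / (4 * L * real n0 * (real N)\<^sup>2)"
  have D: "1 \<le> L * real n0 * (real N)\<^sup>2"
  proof -
    have "1 \<le> real n0" using n0 by simp
    then have "1 * 1 * 1 \<le> L * real n0 * (real N)\<^sup>2"
      using L N1 one_le_power[of "real N" 2] by (intro mult_mono) auto
    then show ?thesis by simp
  qed
  have \<eta>: "0 < \<eta>" using \<rho> D by (simp add: \<eta>_def mult.assoc)
  have "\<eta> \<le> \<rho> / 4" unfolding \<eta>_def using D \<rho> by (intro divide_left_mono) (auto simp: mult.assoc)
  then have \<eta>4: "\<eta> < 1 / 4" using \<rho> by linarith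
  have eq: "2 * L * \<eta> * (real n0 * (real N)\<^sup>2) = \<rho> / 2"
  proof -
    have "2 * L * \<eta> * (real n0 * (real N)\<^sup>2) = \<rho> * (2 * (L * real n0 * (real N)\<^sup>2)) / (4 * (L * real n0 * (real N)\<^sup>2))"
      by (simp add: \<eta>_def mult_ac)
    also have "\<dots> = \<rho> / 2"
    proof -
      have "t * (2 * X) / (4 * X) = t / 2" if "1 \<le> X" for t X :: real using that by (simp add: field_simps)
      then show ?thesis using D .
    qed
    finally show ?thesis .
  qed
  \<comment> \<open>The interval from \<open>l\<close> to \<open>l + \<rho>\<close> has
    \<open>x\<close> as an endpoint and goes to the right or to the left according to the half of
    \<open>[0, 1]\<close> containing \<open>x\<close>.\<close>
  define l where "l = (if x \<le> 1 / 2 then x else x - \<rho>)"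
  have l: "0 \<le> l" "l + \<rho> \<le> 1" "\<bar>x - l\<bar> \<le> \<rho>" "\<bar>x - (l + \<rho>)\<bar> \<le> \<rho>" using x \<rho> by (auto simp: l_def)
  obtain a where a: "l \<le> a" "a \<le> l + \<rho>" "good_point m \<eta> a"
    using good_point_exists[OF m \<eta> \<eta>4 l(1,2)] eq \<rho> by (auto simp: N_def)
  have a01: "a \<in> {0..1}" and ax: "\<bar>a - x\<bar> \<le> \<rho>" using a l by auto
  define T where "T = nat \<lceil>8 * real N * Y5 / \<eta>\<rceil>"
  have "8 * real N * Y5 / \<eta> \<le> real T" by (simp add: T_def real_nat_ceiling_ge)
  then have "8 * real N * Y5 \<le> \<eta> * real T" using \<eta> by (simp add: field_simps)
  from P_mean_lower[OF a(3) a01 \<eta> this] obtain n where n: "n < T" "1 / 2 \<le> cmod (P a (of_nat n))" by blast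
  \<comment> \<open>Of the sixth power of N, one factor is the number of frequencies, two come from
    the number of chords and three from \<open>\<rho>\<close>.\<close>
  have N6: "8 * real N * Y5 / \<eta> = 32 * L * real n0 / c0 * real N ^ 6 * Y5"
    using \<rho> c0 N1 by (simp add: \<eta>_def \<rho>_def field_simps) (simp add: power2_eq_square eval_nat_numeral)
  have "0 \<le> 8 * real N * Y5 / \<eta>" using \<eta> Y5 by simp
  then have "real n \<le> 8 * real N * Y5 / \<eta> + 1" using n(1) unfolding T_def by linarith
  also have "\<dots> \<le> 32 * L * real n0 / c0 * q ^ 6 * Y5 + 1"
    unfolding N6 using N_power_le[of 6] L c0 Y5 by (intro add_mono mult_right_mono mult_left_mono) auto
  also have "\<dots> \<le> q ^ 20" by (rule large(6))
  finally have nq: "real n \<le> q ^ 20" .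
  define z0 where "z0 = of_real a + of_nat n / complex_of_real lam"
  have "q ^ 20 * real N ^ 3 \<le> q ^ 20 * q ^ 3" using N_power_le[of 3] q2 by (intro mult_left_mono) auto
  also have "\<dots> = q ^ 23" by (simp flip: power_add)
  also have "\<dots> \<le> c0 * lam" by (rule large(8))
  finally have q\<rho>: "q ^ 20 \<le> \<rho> * lam" using N1 by (simp add: \<rho>_def field_simps)
  then have "real n / lam \<le> \<rho>" using nq lam_pos by (simp add: field_simps)
  then have z0: "cmod (z0 - of_real a) \<le> \<rho>" using lam_pos by (simp add: z0_def norm_divide)
  have M0: "0 < M" using M by simp
  have q40: "(q ^ 20)\<^sup>2 = q ^ 40" by (simp flip: power_mult)
  have "cmod (F z0 - P a (of_nat n)) \<le> real N * exp \<bar>Im (of_nat n)\<bar> * (6 * M * (q ^ 20)\<^sup>2 / lam)"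
    unfolding z0_def
  proof (rule F_near_P[OF a01])
    have "2 * (\<rho> * lam) \<le> \<epsilon> * lam" using \<rho> lam_pos by simp
    then show "2 * q ^ 20 \<le> \<epsilon> * lam" using q\<rho> by linarith
    have "0 \<le> M * q ^ 40" using M0 q2 by simp
    then show "2 * M * (q ^ 20)\<^sup>2 \<le> lam" unfolding q40 using large(2) by linarith
  qed (use nq in simp)
  also have "\<dots> \<le> q * (6 * M * q ^ 40 / lam)"
    unfolding q40 using Nq by (simp only: abs_zero complex_Im_of_nat exp_zero mult_1_right)
      (rule mult_right_mono, use M0 lam_pos q2 in simp_all)
  also have "\<dots> = 6 * M * (q * q ^ 40) / lam" by simp
  also have "\<dots> = 6 * M * q ^ 41 / lam"
  proof -
    have "q * q ^ 40 = q ^ 41" by (simp flip: power_Suc)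
    then show ?thesis by (rule arg_cong)
  qed
  also have "\<dots> \<le> 1 / 4" using large(7) lam_pos by (simp add: field_simps)
  finally have "cmod (F z0 - P a (of_nat n)) \<le> 1 / 4" .
  moreover have "cmod (P a (of_nat n)) \<le> cmod (F z0) + cmod (F z0 - P a (of_nat n))"
    by (metis add.commute norm_minus_commute norm_triangle_sub)
  ultimately have Fz0: "1 / 4 \<le> cmod (F z0)" using n(2) by linarith
  have near: "cmod (z - of_real a) \<le> 13 * \<rho>" if "z \<in> cball z0 (12 * \<rho>)" for z
    using that z0 norm_triangle_ineq[of "z - z0" "z0 - of_real a"] by (simp add: dist_norm norm_minus_commute)
  \<comment> \<open>Going through \<open>x\<close> and \<open>a\<close>, the zeros are within
    \<open>3 * \<rho>\<close> of \<open>z0\<close>. Four times this is \<open>12 * \<rho>\<close>,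
    and one more \<open>\<rho>\<close> measures from \<open>a\<close>.\<close>
  have sub: "cball z0 (12 * \<rho>) \<subseteq> nbhd01 \<epsilon>"
    using near \<rho> by (intro subsetI nbhd01I[OF a01]) force
  have up: "cmod (F z) \<le> real N * exp (26 * M * c0 * (lam / real N ^ 3))" if "z \<in> cball z0 (12 * \<rho>)" for z
  proof -
    have "cmod (F z) \<le> real N * exp (2 * lam * M * (13 * \<rho>))"
      using near[OF that] \<rho> by (intro F_upper[OF a01]) auto
    also have "2 * lam * M * (13 * \<rho>) = 26 * M * c0 * (lam / real N ^ 3)" by (simp add: \<rho>_def)
    finally show ?thesis .
  qed
  have "4 * real N * real N ^ 3 \<le> 4 * q ^ 4" using N_power_le[of 4] by (simp flip: power_Suc)
  then have "4 * real N \<le> lam / real N ^ 3" using large(9) N1 by (simp add: field_simps)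
  moreover have "4 * real N \<le> exp (4 * real N)" using exp_ge_add_one_self[of "4 * real N"] by linarith
  ultimately have "4 * real N \<le> exp (lam / real N ^ 3)" by (meson exp_le_cancel_iff order_trans)
  then have "4 * real N * exp (26 * M * c0 * (lam / real N ^ 3)) \<le> exp (lam / real N ^ 3) * exp (26 * M * c0 * (lam / real N ^ 3))"
    by (intro mult_right_mono) auto
  also have "\<dots> = exp ((1 + 26 * M * c0) * (lam / real N ^ 3))"
  proof -
    have "exp x * exp (k * x) = exp ((1 + k) * x)" for x k :: real
      by (simp add: distrib_right flip: exp_add)
    then show ?thesis .
  qed
  finally have "real N * exp (26 * M * c0 * (lam / real N ^ 3)) \<le> exp ((1 + 26 * M * c0) * (lam / real N ^ 3)) * (1 / 4)" by simp
  also have "\<dots> \<le> exp ((1 + 26 * M * c0) * (lam / real N ^ 3)) * cmod (F z0)" using Fz0 by (intro mult_left_mono) auto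
  finally have B: "real N * exp (26 * M * c0 * (lam / real N ^ 3)) \<le> exp ((1 + 26 * M * c0) * (lam / real N ^ 3)) * cmod (F z0)" .
  have Z: "Z \<subseteq> {z \<in> cball z0 (3 * \<rho>). F z = 0}"
  proof
    fix z assume "z \<in> Z"
    then have z: "cmod (z - of_real x) \<le> \<rho>" "F z = 0" by (auto simp: Z_def dist_norm norm_minus_commute)
    have "cmod (of_real a - complex_of_real x) \<le> \<rho>" using ax by (metis norm_of_real of_real_diff)
    then have "cmod (z0 - z) \<le> 3 * \<rho>"
      using z(1) z0 norm_triangle_ineq[of "z0 - of_real a" "of_real a - of_real x"]
        norm_triangle_ineq4[of "z0 - of_real x" "z - of_real x"] by simp
    then show "z \<in> {z \<in> cball z0 (3 * \<rho>). F z = 0}" using z(2) by (simp add: dist_norm)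
  qed
  have "F z0 \<noteq> 0" using Fz0 by auto
  then show "finite Z" "real (card Z) \<le> (1 + 26 * M * c0) * (lam / real N ^ 3)"
    using card_zeros_le[OF open_nbhd01 sub _ _ _ F_holomorphic _ up B Z] \<rho>(1) by auto
qed

text \<open>At most B / c0 + 1 windows of radius \<open>\<rho>\<close> cover the interval, a number
  free of N. The real zeros in a window are among the complex zeros in the disc with the same
  centre.\<close>

lemma zeros_on_interval:
  assumes lr: "0 \<le> l" "l \<le> r" "r \<le> 1" and len: "r - l \<le> B / real N ^ 3"
  defines "Z \<equiv> {t \<in> {l..r}. F (of_real t) = 0}"
  shows "finite Z" "real (card Z) \<le> (B / c0 + 1) * ((1 + 26 * M * c0) * (lam / real N ^ 3))"
proof -
  define k where "k = nat \<lfloor>(r - l) / \<rho>\<rfloor>"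
  define W where "W i = {t \<in> {l..r}. \<bar>t - (l + real i * \<rho>)\<bar> \<le> \<rho> \<and> F (of_real t) = 0}" for i
  have k0: "0 \<le> (r - l) / \<rho>" using lr \<rho> by simp
  have W: "finite (W i) \<and> real (card (W i)) \<le> (1 + 26 * M * c0) * (lam / real N ^ 3)" if "i \<le> k" for i
  proof -
    define x where "x = l + real i * \<rho>"
    have "real i \<le> (r - l) / \<rho>" using that k0 unfolding k_def by linarith
    then have "real i * \<rho> \<le> r - l" using \<rho>(1) by (simp add: field_simps)
    then have "x \<in> {0..1}" using lr \<rho> by (auto simp: x_def)
    note z = zeros_near_any_point[OF this]
    have sub: "complex_of_real ` W i \<subseteq> {z \<in> cball (of_real x) \<rho>. F z = 0}"
      unfolding W_def x_def[symmetric] by (auto simp: dist_of_real dist_real_def abs_minus_commute)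
    have inj: "inj_on complex_of_real (W i)" by (simp add: inj_on_def)
    have "finite (W i)" using finite_subset[OF sub z(1)] inj by (rule finite_imageD)
    moreover have "card (W i) \<le> card {z \<in> cball (complex_of_real x) \<rho>. F z = 0}"
      using card_mono[OF z(1) sub] card_image[OF inj] by simp
    then have "real (card (W i)) \<le> (1 + 26 * M * c0) * (lam / real N ^ 3)" using z(2) by linarith
    ultimately show ?thesis by blast
  qed
  have sub: "Z \<subseteq> (\<Union>i\<in>{..k}. W i)"
  proof
    fix t assume t: "t \<in> Z"
    define i where "i = nat \<lfloor>(t - l) / \<rho>\<rfloor>"
    have t0: "0 \<le> (t - l) / \<rho>" using t \<rho> by (simp add: Z_def)
    have "(t - l) / \<rho> \<le> (r - l) / \<rho>" using t \<rho> by (intro divide_right_mono) (auto simp: Z_def)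
    then have ik: "i \<le> k" unfolding i_def k_def by (intro nat_mono floor_mono)
    have "real i \<le> (t - l) / \<rho>" "(t - l) / \<rho> \<le> real i + 1" using t0 unfolding i_def by linarith+
    then have "real i * \<rho> \<le> t - l" "t - l \<le> real i * \<rho> + \<rho>" using \<rho>(1) by (simp_all add: field_simps)
    then have "\<bar>t - (l + real i * \<rho>)\<bar> \<le> \<rho>" using \<rho>(1) by linarith
    then have "t \<in> W i" using t by (simp add: W_def Z_def)
    then show "t \<in> (\<Union>i\<in>{..k}. W i)" using ik by blast
  qed
  have fin: "finite (\<Union>i\<in>{..k}. W i)" using W by simp
  show "finite Z" using sub fin by (rule finite_subset)
  have "card Z \<le> card (\<Union>i\<in>{..k}. W i)" by (rule card_mono[OF fin sub])
  also have "\<dots> \<le> (\<Sum>i\<in>{..k}. card (W i))" by (rule card_UN_le) simp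
  finally have "real (card Z) \<le> (\<Sum>i\<in>{..k}. real (card (W i)))" by (metis of_nat_le_iff of_nat_sum)
  also have "\<dots> \<le> (\<Sum>i\<in>{..k}. (1 + 26 * M * c0) * (lam / real N ^ 3))"
    using W by (intro sum_mono) simp
  also have "\<dots> = (real k + 1) * ((1 + 26 * M * c0) * (lam / real N ^ 3))" by simp
  also have "\<dots> \<le> (B / c0 + 1) * ((1 + 26 * M * c0) * (lam / real N ^ 3))"
  proof (intro mult_right_mono add_mono)
    have "real k \<le> (r - l) / \<rho>" using k0 by (simp add: k_def)
    also have "\<dots> \<le> (B / real N ^ 3) / \<rho>" using len \<rho> by (intro divide_right_mono) auto
    also have "\<dots> = B / c0" using N1 by (simp add: \<rho>_def)
    finally show "real k \<le> B / c0" .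
  qed (use M c0 lam_pos in auto)
  finally show "real (card Z) \<le> (B / c0 + 1) * ((1 + 26 * M * c0) * (lam / real N ^ 3))" .
qed

lemma zeros_on_intervals:
  assumes Is: "finite Is" "card Is \<le> N\<^sup>2" and B: "0 \<le> B"
    and I: "\<And>I. I \<in> Is \<Longrightarrow> \<exists>l r. 0 \<le> l \<and> l \<le> r \<and> r \<le> 1 \<and> I = {l..r} \<and> r - l \<le> B / real N ^ 3"
  defines "Z \<equiv> {t \<in> \<Union>Is. F (of_real t) = 0}"
  shows "finite Z" "real (card Z) \<le> (B / c0 + 1) * (1 + 26 * M * c0) * lam / real N"
proof -
  define K where "K = (B / c0 + 1) * ((1 + 26 * M * c0) * (lam / real N ^ 3))"
  have K0: "0 \<le> K" using B M c0 lam_pos by (auto simp: K_def)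
  have ZI: "Z = (\<Union>I\<in>Is. {t \<in> I. F (of_real t) = 0})" by (auto simp: Z_def)
  have W: "finite {t \<in> I. F (of_real t) = 0} \<and> real (card {t \<in> I. F (of_real t) = 0}) \<le> K" if "I \<in> Is" for I
    using I[OF that] zeros_on_interval[where B = B] unfolding K_def by blast
  show "finite Z" unfolding ZI using Is W by simp
  have "card Z \<le> (\<Sum>I\<in>Is. card {t \<in> I. F (of_real t) = 0})" unfolding ZI by (rule card_UN_le[OF Is(1)])
  then have "real (card Z) \<le> real (\<Sum>I\<in>Is. card {t \<in> I. F (of_real t) = 0})" by (simp only: of_nat_le_iff)
  also have "\<dots> = (\<Sum>I\<in>Is. real (card {t \<in> I. F (of_real t) = 0}))" by (rule of_nat_sum)
  also have "\<dots> \<le> (\<Sum>I\<in>Is. K)" using W by (intro sum_mono) simp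
  also have "\<dots> \<le> (real N)\<^sup>2 * K" using Is(2) K0
    by (simp add: mult_right_mono flip: of_nat_power)
  also have "\<dots> = (B / c0 + 1) * (1 + 26 * M * c0) * lam / real N"
    using N1 by (simp add: K_def power2_eq_square power3_eq_cube)
  finally show "real (card Z) \<le> (B / c0 + 1) * (1 + 26 * M * c0) * lam / real N" .
qed

end

section \<open>Choice of the intervals and conclusion\<close>

definition (in analytic_curve) interval_const :: real where
  "interval_const = 2 * L + real (n0 ^ 3 + 1) ^ 3"

text \<open>If \<open>N\<close> is bounded in terms of the curve, then \<open>[0, 1]\<close> itself is an interval of length \<open>O(\<kappa>)\<close>. For larger \<open>N\<close>
  the power saving in the number of products of two points makes up for the \<open>n0\<close> arcs that each chord direction may require.\<close>

lemma (in analytic_curve) exceptional_intervals: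
  assumes m: "0 < m" and N: "0 < card (lattice_pts m)"
  obtains Is where "finite Is" "card Is \<le> (card (lattice_pts m))\<^sup>2"
    "\<And>I. I \<in> Is \<Longrightarrow> \<exists>l r. 0 \<le> l \<and> l \<le> r \<and> r \<le> 1 \<and> I = {l..r} \<and>
       r - l \<le> interval_const / real (card (lattice_pts m)) ^ 3"
    "\<And>a. a \<in> {0..1} - \<Union>Is \<Longrightarrow> good_point m (1 / real (card (lattice_pts m)) ^ 3) a"
proof (cases "card (lattice_pts m) \<le> n0 ^ 3 + 1")
  case True
  define N where "N = card (lattice_pts m)"
  have "real N ^ 3 \<le> real (n0 ^ 3 + 1) ^ 3" using True by (intro power_mono) (simp_all add: N_def del: of_nat_add of_nat_power)
  also have "\<dots> \<le> interval_const" using L by (simp add: interval_const_def)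
  finally have "1 \<le> interval_const / real N ^ 3" using N by (simp add: N_def)
  then show ?thesis
    using N by (intro that[of "{{0..1}}"]) (auto simp: N_def Suc_le_eq)
next
  case False
  define N where "N = card (lattice_pts m)"
  have N2: "n0 ^ 3 + 1 < N" using False by (simp add: N_def)
  have "1 \<le> n0 ^ 3" using n0 by simp
  then have N3: "3 \<le> N" using N2 by linarith
  define \<eta> where "\<eta> = 1 / real N ^ 3"
  have "(3::real) ^ 3 \<le> real N ^ 3" using N3 by (intro power_mono) auto
  then have \<eta>: "0 < \<eta>" "\<eta> < 1 / 4" using N3 by (simp_all add: \<eta>_def divide_simps)
  obtain P where P: "finite P" "P \<subseteq> {0..1}" "card P \<le> n0 * card (gauss_products m)"
    "\<And>a. a \<in> {0..1} \<Longrightarrow> \<not> good_point m \<eta> a \<Longrightarrow> \<exists>p\<in>P. \<bar>a - p\<bar> \<le> L * \<eta>"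
    using bad_points_covered[OF m \<eta>] by blast
  define J where "J p = {max 0 (p - L * \<eta>)..min 1 (p + L * \<eta>)}" for p
  have L\<eta>: "0 < L * \<eta>" using L \<eta> by simp
  show ?thesis
  proof (rule that[of "J ` P"])
    show "finite (J ` P)" using P(1) by simp
    have "(n0 * card (gauss_products m)) ^ 5 \<le> n0 ^ 5 * N ^ 8"
      using card_gauss_products_le[OF m] by (simp add: power_mult_distrib card_gauss_circle N_def)
    \<comment> \<open>The threshold n0^3 on N enters here, through n0^5 \<le> (n0^3)^2 \<le> N^2;
      the total N^10 is the fifth power of the allowed N^2.\<close>
    also have "\<dots> \<le> N ^ 2 * N ^ 8"
    proof (rule mult_right_mono)
      have "n0 ^ 5 \<le> (n0 ^ 3) ^ 2" using n0 by (simp add: power_increasing flip: power_mult)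
      also have "\<dots> \<le> N ^ 2" using N2 by (intro power_mono) auto
      finally show "n0 ^ 5 \<le> N ^ 2" .
    qed simp
    also have "\<dots> = (N\<^sup>2) ^ 5" by (simp flip: power_add power_mult)
    finally have "n0 * card (gauss_products m) \<le> N\<^sup>2"
      by (subst (asm) power_mono_iff) auto
    then show "card (J ` P) \<le> (card (lattice_pts m))\<^sup>2"
      using card_image_le[OF P(1), of J] P(3) by (simp add: N_def)
  next
    fix I assume "I \<in> J ` P"
    then obtain p where p: "p \<in> P" "I = J p" by blast
    have "0 \<le> p" "p \<le> 1" using P(2) p by auto
    moreover have "2 * L * \<eta> \<le> interval_const / real N ^ 3"
    proof -
      have "2 * L \<le> interval_const" by (simp add: interval_const_def)
      then have "2 * L * \<eta> \<le> interval_const * \<eta>" using \<eta> by (intro mult_right_mono) auto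
      then show ?thesis by (simp add: \<eta>_def)
    qed
    ultimately show "\<exists>l r. 0 \<le> l \<and> l \<le> r \<and> r \<le> 1 \<and> I = {l..r} \<and> r - l \<le> interval_const / real (card (lattice_pts m)) ^ 3"
      using L\<eta> unfolding p(2) J_def N_def[symmetric]
      by (intro exI[of _ "max 0 (p - L * \<eta>)"] exI[of _ "min 1 (p + L * \<eta>)"]) auto
  next
    fix a assume a: "a \<in> {0..1} - \<Union>(J ` P)"
    show "good_point m (1 / real (card (lattice_pts m)) ^ 3) a"
    proof (rule ccontr)
      assume "\<not> ?thesis"
      then have "\<not> good_point m \<eta> a" by (simp add: \<eta>_def N_def)
      then obtain p where "p \<in> P" "\<bar>a - p\<bar> \<le> L * \<eta>" using P(4) a by blast
      then have "a \<in> J p" using a by (auto simp: J_def)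
      then show False using a \<open>p \<in> P\<close> by blast
    qed
  qed
qed

text \<open>Every cardinality bound is accompanied by \<open>finite\<close>, because
  \<open>card\<close> is 0 on infinite sets. Zeros on the curve are counted as points of the torus,
  so parameters meeting at one point count once; complex zeros are counted where the continuation is
  given, in \<open>nbhd01 \<epsilon>\<close>. The order of the quantifiers makes \<open>C\<close>
  uniform in m and in the eigenfunction, and the intervals independent of the coefficients.\<close>

theorem theorem5p1:
  fixes g1 g2 :: "complex \<Rightarrow> complex" and \<epsilon> :: real
  defines "\<gamma>1 \<equiv> (\<lambda>t::real. Re (g1 (complex_of_real t)))"
      and "\<gamma>2 \<equiv> (\<lambda>t::real. Re (g2 (complex_of_real t)))"
  assumes eps: "\<epsilon> > 0"
    and hol: "g1 holomorphic_on nbhd01 \<epsilon>" "g2 holomorphic_on nbhd01 \<epsilon>"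
    and real_on_seg: "\<forall>t\<in>{0..1::real}. g1 (complex_of_real t) \<in> \<real> \<and> g2 (complex_of_real t) \<in> \<real>"
    and arclength: "\<forall>t\<in>{0..1::real}. (deriv \<gamma>1 t)^2 + (deriv \<gamma>2 t)^2 = 1"
    and curvature: "\<forall>t\<in>{0..1::real}.
          deriv \<gamma>1 t * deriv (deriv \<gamma>2) t - deriv \<gamma>2 t * deriv (deriv \<gamma>1) t \<noteq> 0"
  shows "\<exists>C > 0. \<exists>E. E \<subseteq> sums_two_sq \<and> rel_density_zero E sums_two_sq \<and>
    (\<forall>m \<in> sums_two_sq - E.
      (\<exists>Is :: real set set.
         finite Is \<and> card Is \<le> (card (lattice_pts m))^2 \<and>
         (\<forall>I\<in>Is. \<exists>l r. 0 \<le> l \<and> l \<le> r \<and> r \<le> 1 \<and> I = {l..r} \<and>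
                     r - l \<le> C * real (card (lattice_pts m)) powr (-3)) \<and>
         (\<forall>c :: int \<times> int \<Rightarrow> complex.
            (\<Sum>\<mu>\<in>lattice_pts m. (cmod (c \<mu>))^2) = 1 \<longrightarrow>
            (finite (torus_proj ` (\<lambda>t. (\<gamma>1 t, \<gamma>2 t)) `
                       {t \<in> \<Union>Is. eigenfun c m (g1 (complex_of_real t)) (g2 (complex_of_real t)) = 0}) \<and>
             real (card (torus_proj ` (\<lambda>t. (\<gamma>1 t, \<gamma>2 t)) `
                       {t \<in> \<Union>Is. eigenfun c m (g1 (complex_of_real t)) (g2 (complex_of_real t)) = 0}))
               \<le> C * (2 * pi * sqrt (real m)) / real (card (lattice_pts m))) \<and>
            (\<forall>a \<in> {0..1} - \<Union>Is.
               finite {z \<in> ball (complex_of_real a)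
                          (real (card (lattice_pts m)) ^ 7 / (2 * pi * sqrt (real m))) \<inter> nbhd01 \<epsilon>.
                        eigenfun c m (g1 z) (g2 z) = 0} \<and>
               real (card {z \<in> ball (complex_of_real a)
                          (real (card (lattice_pts m)) ^ 7 / (2 * pi * sqrt (real m))) \<inter> nbhd01 \<epsilon>.
                        eigenfun c m (g1 z) (g2 z) = 0})
                 \<le> C * real (card (lattice_pts m)) ^ 7))))"
proof -
  obtain M L p1 p2 n0 where "analytic_curve g1 g2 \<epsilon> M L p1 p2 n0"
    using analytic_curve_exists[OF eps hol real_on_seg arclength[unfolded \<gamma>1_def \<gamma>2_def] curvature[unfolded \<gamma>1_def \<gamma>2_def]]
    by blast
  then interpret analytic_curve g1 g2 \<epsilon> M L p1 p2 n0 .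
  define K where "K = 32 * L * real n0 / c0"
  have "0 < K" using L n0 c0 by (simp add: K_def)
  then have "eventually (large_param M \<epsilon> c0 K) at_top"
    using M eps c0 by (intro eventually_large_param) auto
  then obtain Q where Q: "\<And>q. Q \<le> q \<Longrightarrow> large_param M \<epsilon> c0 K q" by (auto simp: eventually_at_top_linorder)
  \<comment> \<open>Taking the power 200 turns \<open>m0 \<le> m\<close> into
    \<open>Q \<le> q\<close> for the root \<open>q\<close> of m.\<close>
  define m0 where "m0 = nat \<lceil>max Q 1 ^ 200\<rceil>"
  define B where "B = interval_const"
  define C where "C = B + (B / c0 + 1) * (1 + 26 * M * c0) + (18 * M + 15)"
  have B0: "0 < B" using L by (simp add: B_def interval_const_def add_pos_nonneg)
  have C: "B \<le> C" "(B / c0 + 1) * (1 + 26 * M * c0) \<le> C" "18 * M + 15 \<le> C" "0 < C"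
    using B0 M c0 by (auto simp: C_def add_nonneg_nonneg add_pos_nonneg)
  show ?thesis
  proof (rule exI[of _ C], intro conjI C(4), rule exI[of _ "exceptional m0"], intro conjI ballI)
    show "exceptional m0 \<subseteq> sums_two_sq" by (auto simp: exceptional_def)
    show "rel_density_zero (exceptional m0) sums_two_sq" by (rule rel_density_zero_exceptional)
    fix m assume mE: "m \<in> sums_two_sq - exceptional m0"
    then have m: "0 < m" "lattice_pts m \<noteq> {}" by (auto simp: sums_two_sq_iff)
    define N where "N = card (lattice_pts m)"
    have N: "0 < N" using m(2) by (simp add: N_def card_gt_0_iff)
    define q where "q = real m powr (1 / 200)"
    have q200: "real m = q ^ 200" using m by (simp add: q_def powr_power)
    have "max Q 1 ^ 200 \<le> real m0" unfolding m0_def by (rule real_nat_ceiling_ge)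
    also have "\<dots> \<le> q ^ 200"
    proof -
      have "\<not> m < m0" using mE unfolding exceptional_def by blast
      then show ?thesis unfolding q200[symmetric] by simp
    qed
    finally have "max Q 1 \<le> q" by (subst (asm) power_mono_iff) (auto simp: q_def)
    then have large: "large_param M \<epsilon> c0 K q" by (intro Q) simp
    have Nq: "real (card (lattice_pts m)) \<le> q"
      using mE unfolding exceptional_def q_def not_less[symmetric] by blast
    have sep: "real m \<le> (cmod (gauss_of \<mu> - gauss_of \<nu>))\<^sup>2 * ln (real m) ^ 5"
      if "\<mu> \<in> lattice_pts m" "\<nu> \<in> lattice_pts m" "\<mu> \<noteq> \<nu>" for \<mu> \<nu>
    proof -
      have "(cmod (gauss_of \<mu> - gauss_of \<nu>))\<^sup>2 = real_of_int ((fst \<mu> - fst \<nu>)\<^sup>2 + (snd \<mu> - snd \<nu>)\<^sup>2)"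
        by (simp add: gauss_of_def cmod_power2)
      moreover have "\<not> real_of_int ((fst \<mu> - fst \<nu>)\<^sup>2 + (snd \<mu> - snd \<nu>)\<^sup>2) * ln (real m) ^ 5 < real m"
        using mE that unfolding exceptional_def has_close_points_def by blast
      ultimately show ?thesis by (simp only: not_less)
    qed
    obtain Is where Is: "finite Is" "card Is \<le> (card (lattice_pts m))\<^sup>2"
      "\<And>I. I \<in> Is \<Longrightarrow> \<exists>l r. 0 \<le> l \<and> l \<le> r \<and> r \<le> 1 \<and> I = {l..r} \<and> r - l \<le> B / real (card (lattice_pts m)) ^ 3"
      "\<And>a. a \<in> {0..1} - \<Union>Is \<Longrightarrow> good_point m (1 / real (card (lattice_pts m)) ^ 3) a"
      using exceptional_intervals[OF m(1)] N unfolding B_def N_def by blast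
    let ?Z = "\<lambda>c. {t \<in> \<Union>Is. eigenfun c m (g1 (complex_of_real t)) (g2 (complex_of_real t)) = 0}"
    let ?T = "\<lambda>c. torus_proj ` (\<lambda>t. (\<gamma>1 t, \<gamma>2 t)) ` ?Z c"
    let ?W = "\<lambda>c a. {z \<in> ball (complex_of_real a) (real (card (lattice_pts m)) ^ 7 / (2 * pi * sqrt (real m))) \<inter> nbhd01 \<epsilon>.
          eigenfun c m (g1 z) (g2 z) = 0}"
    have main: "finite (?T c) \<and> real (card (?T c)) \<le> C * (2 * pi * sqrt (real m)) / real (card (lattice_pts m)) \<and>
        (\<forall>a\<in>{0..1} - \<Union>Is. finite (?W c a) \<and> real (card (?W c a)) \<le> C * real (card (lattice_pts m)) ^ 7)"
      if c: "(\<Sum>\<mu>\<in>lattice_pts m. (cmod (c \<mu>))\<^sup>2) = 1" for c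
    proof -
      interpret E: large_eigenfunction g1 g2 \<epsilon> M L p1 p2 n0 m c q
        by unfold_locales (use m c q200 large Nq sep in \<open>auto simp: K_def\<close>)
      have lam: "E.lam = 2 * pi * sqrt (real m)" by (rule E.lam_def)
      have "\<And>I. I \<in> Is \<Longrightarrow> \<exists>l r. 0 \<le> l \<and> l \<le> r \<and> r \<le> 1 \<and> I = {l..r} \<and> r - l \<le> B / real E.N ^ 3"
        using Is(3) unfolding E.N_def .
      note Z = E.zeros_on_intervals[OF Is(1) Is(2)[folded E.N_def] less_imp_le[OF B0] this, unfolded E.F_def]
      have T: "finite (?T c)" using Z(1) by simp
      \<comment> \<open>Passing from parameters to points of the torus can only merge zeros.\<close>
      have "card (?T c) \<le> card (?Z c)"
        using Z(1) by (meson card_image_le finite_imageI order_trans)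
      then have "real (card (?T c)) \<le> (B / c0 + 1) * (1 + 26 * M * c0) * E.lam / real E.N" using Z(2) by linarith
      also have "\<dots> \<le> C * E.lam / real E.N"
        using C(2) E.lam_pos by (intro divide_right_mono mult_right_mono) auto
      finally have T2: "real (card (?T c)) \<le> C * (2 * pi * sqrt (real m)) / real (card (lattice_pts m))"
        unfolding lam E.N_def .
      have W: "finite (?W c a) \<and> real (card (?W c a)) \<le> C * real (card (lattice_pts m)) ^ 7"
        if a: "a \<in> {0..1} - \<Union>Is" for a
      proof -
        have g: "good_point m (1 / real E.N ^ 3) a" "a \<in> {0..1}" using Is(4)[OF a] a by (auto simp: E.N_def)
        note W = E.zeros_near_good_point[OF g, unfolded E.F_def lam E.N_def]
        have "(18 * M + 15) * real (card (lattice_pts m)) ^ 7 \<le> C * real (card (lattice_pts m)) ^ 7"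
          using C(3) by (intro mult_right_mono) auto
        with W show ?thesis by linarith
      qed
      show ?thesis using T T2 W by blast
    qed
    have len: "\<exists>l r. 0 \<le> l \<and> l \<le> r \<and> r \<le> 1 \<and> I = {l..r} \<and> r - l \<le> C * real (card (lattice_pts m)) powr (-3)"
      if "I \<in> Is" for I
    proof -
      have "real (card (lattice_pts m)) powr (-3) = 1 / real (card (lattice_pts m)) ^ 3"
        using N by (simp add: N_def powr_minus_divide)
      moreover have "B / real (card (lattice_pts m)) ^ 3 \<le> C / real (card (lattice_pts m)) ^ 3"
        using C(1) by (intro divide_right_mono) auto
      ultimately show ?thesis using Is(3)[OF that] by fastforce
    qed
    show "\<exists>Is :: real set set.
         finite Is \<and> card Is \<le> (card (lattice_pts m))^2 \<and>
         (\<forall>I\<in>Is. \<exists>l r. 0 \<le> l \<and> l \<le> r \<and> r \<le> 1 \<and> I = {l..r} \<and>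
          r - l \<le> C * real (card (lattice_pts m)) powr (-3)) \<and>
         (\<forall>c :: int \<times> int \<Rightarrow> complex.
          (\<Sum>\<mu>\<in>lattice_pts m. (cmod (c \<mu>))^2) = 1 \<longrightarrow>
          (finite (torus_proj ` (\<lambda>t. (\<gamma>1 t, \<gamma>2 t)) `
          {t \<in> \<Union>Is. eigenfun c m (g1 (complex_of_real t)) (g2 (complex_of_real t)) = 0}) \<and>
          real (card (torus_proj ` (\<lambda>t. (\<gamma>1 t, \<gamma>2 t)) `
          {t \<in> \<Union>Is. eigenfun c m (g1 (complex_of_real t)) (g2 (complex_of_real t)) = 0}))
          \<le> C * (2 * pi * sqrt (real m)) / real (card (lattice_pts m))) \<and>
          (\<forall>a \<in> {0..1} - \<Union>Is.
          finite {z \<in> ball (complex_of_real a)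
          (real (card (lattice_pts m)) ^ 7 / (2 * pi * sqrt (real m))) \<inter> nbhd01 \<epsilon>.
          eigenfun c m (g1 z) (g2 z) = 0} \<and>
          real (card {z \<in> ball (complex_of_real a)
          (real (card (lattice_pts m)) ^ 7 / (2 * pi * sqrt (real m))) \<inter> nbhd01 \<epsilon>.
          eigenfun c m (g1 z) (g2 z) = 0})
          \<le> C * real (card (lattice_pts m)) ^ 7))"
      by (rule exI[of _ Is]) (use Is(1,2) len main in blast)
  qed
qed

end
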